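(* Assume that, for some $\alpha\in(0,1)$: $c_T\in C^{(1+\alpha/2)}([0,T_{max}])$ and $c_T\ge0$ for every $T\in[0,T_{max}]$; the map $T\in[0,T_{max}]\mapsto c_T\in C^{(1+\alpha/2)}([0,T_{max}])$ is continuous; $m_0\in C^{(2+\alpha)}(\Gamma)$ with $m_0(v_0)=0$; and $$\partial_xm_0(v_0)>0 .$$ Then the map $\Psi:[t_0,T_{max}]\to[t_0,T_{max}]$ defined in the context admits a fixed point.
   Context: Network. $\Gamma\subset\mathbb R^n$ is a network: a finite set of vertices $V=\{v_i\}_{i\in I}$ connected by finitely many continuous, non self-intersecting arcs (edges) $E=\{e_j\}_{j\in J}$, each parametrized by a smooth $\pi_j:[0,l_j]\to\mathbb R^n$, $l_j>0$. $Inc_i=\{j\in J: e_j \text{ is incident to } v_i\}$, $I_B=\{i:\#Inc_i=1\}$, $I_T=I\setminus I_B$, $\partial\Gamma=\{v_i: i\in I_B\}$, $\Gamma_T=\{v_i:i\in I_T\}$. It is assumed that $\partial\Gamma=\{v_0\}$ is a single boundary vertex. $a_{ij}=1$ if $v_i\in e_j$ and $\pi_j(0)=v_i$, $a_{ij}=-1$ if $v_i\in e_j$ and $\pi_j(l_j)=v_i$, $a_{ij}=0$ otherwise. A point $x\in e_j$ is identified with $y=\pi_j^{-1}(x)\in[0,l_j]$; for $u:\Gamma\to\mathbb R$, $u_j(y)=u(\pi_j(y))$; $\partial_x^\gamma u$ (inside $e_j$) and $\partial_j^\gamma u(v_i)$ (at a vertex, $j\in Inc_i$) denote $\frac{d^\gamma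 u_j}{dy^\gamma}$ at the corresponding $y$. The unique edge $e_0$ incident to $v_0$ is parametrized so that $\pi_0(0)=v_0$; derivatives $\partial_x$ at $v_0$ are taken along $e_0$. $C^{(q+\alpha)}([a,b])$ is the usual Hölder space and $C^{(q+\alpha)}(\Gamma)=\{u\in C(\Gamma): u_j\in C^{(q+\alpha)}([0,l_j])\ \forall j\in J\}$. Data. $0<t_0<T_{max}$; $\theta\in(0,1)$; $m_0:\Gamma\to\mathbb R$ is the initial distribution (a probability density on $\Gamma$: $m_0\ge0$, $\int_\Gamma m_0=1$). The cost is $c_T(s)=c_1(s-t_0)+c_2(s-T)+c_3(T-s)$, $s\in[0,T_{max}]$, where $c_i:\mathbb R\to\mathbb R$ are smooth with $c_i(s)=0$ for $s\le0$ and $c_i(s)>0$ for $s>0$. The map $\Psi$. Given $T$, let $(\phi,\psi)$, $\phi>0$, be the classical solution (continuous on $\Gamma\times[0,T_{max}]$, $C^{2,1}$ on each edge up to its endpoints for times in $(0,T_{max})$; it exists and is unique under the stated hypotheses on $c_T,m_0$) of: $-\partial_t\phi-\partial_x^2\phi=0$ and $\partial_t\psi-\partial_x^2\psi=0$ in $\Gamma\times(0,T_{max})$; $\sum_{j\in Inc_i}a_{ij}\partial_j\phi(v_i,s)=0$ and $\sum_{j\in Inc_i}a_{ij}\partial_j\psi(v_i,s)=0$ for $(v_i,s)\in\Gamma_T\times(0,T_{max})$; $\psi(x,0)=m_0(x)/\phi(x,0)$ and $\phi(x,T_{max})=e^{c_T(T_{max})}$ for $x\in\Gamma$; $\psi(v_0,s)=0$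 and $\phi(v_0,s)=e^{c_T(s)}$ for $s\in[0,T_{max}]$. Set $F(s)=\int_0^se^{c_T(r)}\,\partial_x\psi(v_0,r)\,dr$ and define $\Psi(T)=T^*$ by the quorum rule: $T^*=t_0$ if $F^{-1}(\theta)\le t_0$; $T^*=F^{-1}(\theta)$ if $t_0<F^{-1}(\theta)<T_{max}$; $T^*=T_{max}$ if $F^{-1}(\theta)\ge T_{max}$. Here $F^{-1}(\theta)=\inf\{s\in[0,T_{max}]:F(s)\ge\theta\}$, with the convention $F^{-1}(\theta)=+\infty$ if $F$ does not reach $\theta$ on $[0,T_{max}]$. *)

theory Defs
  imports "HOL-Analysis.Analysis"
begin

section \<open>Derivatives on intervals, smooth functions and Hoelder spaces\<close>

text \<open>
  The \<open>k\<close>-th derivative of \<open>u\<close> relative to \<open>S\<close>: one-sided at the end points of a compact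
  interval.  Only its values on \<open>S\<close> are meaningful.
\<close>

definition iter_deriv :: "real set \<Rightarrow> nat \<Rightarrow> (real \<Rightarrow> 'a::real_normed_vector) \<Rightarrow> real \<Rightarrow> 'a" where
  "iter_deriv S k u = ((\<lambda>f x. vector_derivative f (at x within S)) ^^ k) u"

definition smooth_on :: "real set \<Rightarrow> (real \<Rightarrow> 'a::real_normed_vector) \<Rightarrow> bool" where
  "smooth_on S u \<longleftrightarrow> (\<forall>k. \<forall>x\<in>S. iter_deriv S k u differentiable (at x within S))"

text \<open>
  \<open>holder_space q \<beta> a b\<close> is \<open>C\<^sup>(\<^sup>q\<^sup>+\<^sup>\<beta>\<^sup>)([a,b])\<close>, for \<open>0 < \<beta> < 1\<close> and \<open>a < b\<close>; continuity of the
  \<open>q\<close>-th derivative is implied by its Hoelder condition.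
\<close>

definition holder_space :: "nat \<Rightarrow> real \<Rightarrow> real \<Rightarrow> real \<Rightarrow> (real \<Rightarrow> real) set" where
  "holder_space q \<beta> a b =
     {u. (\<forall>k<q. \<forall>x\<in>{a..b}. iter_deriv {a..b} k u differentiable (at x within {a..b})) \<and>
         (\<exists>C. \<forall>x\<in>{a..b}. \<forall>y\<in>{a..b}.
            \<bar>iter_deriv {a..b} q u x - iter_deriv {a..b} q u y\<bar> \<le> C * \<bar>x - y\<bar> powr \<beta>)}"

definition holder_norm :: "nat \<Rightarrow> real \<Rightarrow> real \<Rightarrow> real \<Rightarrow> (real \<Rightarrow> real) \<Rightarrow> real" where
  "holder_norm q \<beta> a b u =
     (\<Sum>k\<le>q. SUP x\<in>{a..b}. \<bar>iter_deriv {a..b} k u x\<bar>) +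
     (SUP (x, y)\<in>{(x, y). x \<in> {a..b} \<and> y \<in> {a..b} \<and> x \<noteq> y}.
        \<bar>iter_deriv {a..b} q u x - iter_deriv {a..b} q u y\<bar> / \<bar>x - y\<bar> powr \<beta>)"


section \<open>Networks\<close>

record ('i, 'j, 'n) net =
  verts :: "'i set"
  edges :: "'j set"
  vertex :: "'i \<Rightarrow> real ^ 'n"
  param :: "'j \<Rightarrow> real \<Rightarrow> real ^ 'n"
  len :: "'j \<Rightarrow> real"

definition edge_set :: "('i, 'j, 'n::finite) net \<Rightarrow> 'j \<Rightarrow> (real ^ 'n) set" where
  "edge_set N j = param N j ` {0..len N j}"

definition points :: "('i, 'j, 'n::finite) net \<Rightarrow> (real ^ 'n) set" where
  "points N = vertex N ` verts N \<union> (\<Union>j\<in>edges N. edge_set N j)"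

definition Inc :: "('i, 'j, 'n::finite) net \<Rightarrow> 'i \<Rightarrow> 'j set" where
  "Inc N i = {j \<in> edges N. vertex N i \<in> edge_set N j}"

definition bdry_ix :: "('i, 'j, 'n::finite) net \<Rightarrow> 'i set" where
  "bdry_ix N = {i \<in> verts N. card (Inc N i) = 1}"

definition trans_ix :: "('i, 'j, 'n::finite) net \<Rightarrow> 'i set" where
  "trans_ix N = verts N - bdry_ix N"

text \<open>
  Arcs join vertices, contain no vertex in their interior and meet each other at most in
  vertices; parallel edges are allowed.  The last clause excludes isolated vertices.
\<close>

definition network :: "('i, 'j, 'n::finite) net \<Rightarrow> bool" where
  "network N \<longleftrightarrow>
     finite (verts N) \<and> finite (edges N) \<and> inj_on (vertex N) (verts N) \<and>
     (\<forall>j\<in>edges N.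
        len N j > 0 \<and>
        smooth_on {0..len N j} (param N j) \<and>
        inj_on (param N j) {0..len N j} \<and>
        param N j 0 \<in> vertex N ` verts N \<and>
        param N j (len N j) \<in> vertex N ` verts N \<and>
        param N j ` {0<..<len N j} \<inter> vertex N ` verts N = {}) \<and>
     (\<forall>j\<in>edges N. \<forall>k\<in>edges N. j \<noteq> k \<longrightarrow> edge_set N j \<inter> edge_set N k \<subseteq> vertex N ` verts N) \<and>
     (\<forall>i\<in>verts N. Inc N i \<noteq> {})"

definition orient :: "('i, 'j, 'n::finite) net \<Rightarrow> 'i \<Rightarrow> 'j \<Rightarrow> real" where
  "orient N i j =
     (if vertex N i \<in> edge_set N j \<and> param N j 0 = vertex N i then 1
      else if vertex N i \<in> edge_set N j \<and> param N j (len N j) = vertex N i then -1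
      else 0)"

text \<open>The derivative \<open>\<partial>\<^sub>x\<^sup>k u\<close> along the edge \<open>j\<close>, at the point with parameter \<open>y\<close>.\<close>

definition edge_deriv ::
    "('i, 'j, 'n::finite) net \<Rightarrow> nat \<Rightarrow> 'j \<Rightarrow> (real ^ 'n \<Rightarrow> real) \<Rightarrow> real \<Rightarrow> real" where
  "edge_deriv N k j u y = iter_deriv {0..len N j} k (\<lambda>z. u (param N j z)) y"

text \<open>The derivative \<open>\<partial>\<^sub>j u(v\<^sub>i)\<close>, for \<open>j \<in> Inc N i\<close>.\<close>

definition vertex_deriv ::
    "('i, 'j, 'n::finite) net \<Rightarrow> 'j \<Rightarrow> (real ^ 'n \<Rightarrow> real) \<Rightarrow> 'i \<Rightarrow> real" where
  "vertex_deriv N j u i =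
     edge_deriv N 1 j u (the_inv_into {0..len N j} (param N j) (vertex N i))"

definition net_integral :: "('i, 'j, 'n::finite) net \<Rightarrow> (real ^ 'n \<Rightarrow> real) \<Rightarrow> real" where
  "net_integral N u = (\<Sum>j\<in>edges N. integral {0..len N j} (\<lambda>y. u (param N j y)))"

definition net_holder_space ::
    "('i, 'j, 'n::finite) net \<Rightarrow> nat \<Rightarrow> real \<Rightarrow> (real ^ 'n \<Rightarrow> real) set" where
  "net_holder_space N q \<beta> =
     {u. continuous_on (points N) u \<and>
         (\<forall>j\<in>edges N. (\<lambda>y. u (param N j y)) \<in> holder_space q \<beta> 0 (len N j))}"


section \<open>The parabolic system and the map \<open>\<Psi>\<close>\<close>

definition time_deriv ::
    "('i, 'j, 'n::finite) net \<Rightarrow> 'j \<Rightarrow> (real ^ 'n \<Rightarrow> real \<Rightarrow> real) \<Rightarrow> real \<Rightarrow> real \<Rightarrow> real" where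
  "time_deriv N j u y s = deriv (\<lambda>r. u (param N j y) r) s"

text \<open>
  Continuous on \<open>\<Gamma> \<times> [0,Tmax]\<close>, and \<open>C\<^sup>2\<^sup>,\<^sup>1\<close> on \<open>[0,l\<^sub>j] \<times> (0,Tmax)\<close> for every edge.
\<close>

definition classical ::
    "('i, 'j, 'n::finite) net \<Rightarrow> real \<Rightarrow> (real ^ 'n \<Rightarrow> real \<Rightarrow> real) \<Rightarrow> bool" where
  "classical N Tmax u \<longleftrightarrow>
     continuous_on (points N \<times> {0..Tmax}) (\<lambda>(x, s). u x s) \<and>
     (\<forall>j\<in>edges N.
        (\<forall>s\<in>{0<..<Tmax}. \<forall>y\<in>{0..len N j}.
           (\<forall>k<2. edge_deriv N k j (\<lambda>x. u x s) differentiable (at y within {0..len N j})) \<and>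
           (\<lambda>r. u (param N j y) r) field_differentiable (at s)) \<and>
        (\<forall>k\<in>{1, 2}. continuous_on ({0..len N j} \<times> {0<..<Tmax})
           (\<lambda>(y, s). edge_deriv N k j (\<lambda>x. u x s) y)) \<and>
        continuous_on ({0..len N j} \<times> {0<..<Tmax}) (\<lambda>(y, s). time_deriv N j u y s))"

definition kirchhoff ::
    "('i, 'j, 'n::finite) net \<Rightarrow> real \<Rightarrow> (real ^ 'n \<Rightarrow> real \<Rightarrow> real) \<Rightarrow> bool" where
  "kirchhoff N Tmax u \<longleftrightarrow>
     (\<forall>i\<in>trans_ix N. \<forall>s\<in>{0<..<Tmax}.
        (\<Sum>j\<in>Inc N i. orient N i j * vertex_deriv N j (\<lambda>x. u x s) i) = 0)"

text \<open>
  \<open>cT\<close> is the cost \<open>c\<^sub>T\<close> for one fixed \<open>T\<close>, and \<open>i0\<close> is the index of the boundary vertex.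
\<close>

definition is_solution ::
    "('i, 'j, 'n::finite) net \<Rightarrow> 'i \<Rightarrow> real \<Rightarrow> (real ^ 'n \<Rightarrow> real) \<Rightarrow> (real \<Rightarrow> real) \<Rightarrow>
     (real ^ 'n \<Rightarrow> real \<Rightarrow> real) \<Rightarrow> (real ^ 'n \<Rightarrow> real \<Rightarrow> real) \<Rightarrow> bool" where
  "is_solution N i0 Tmax m0 cT \<phi> \<psi> \<longleftrightarrow>
     classical N Tmax \<phi> \<and> classical N Tmax \<psi> \<and>
     (\<forall>x\<in>points N. \<forall>s\<in>{0..Tmax}. \<phi> x s > 0) \<and>
     (\<forall>j\<in>edges N. \<forall>y\<in>{0<..<len N j}. \<forall>s\<in>{0<..<Tmax}.
        - time_deriv N j \<phi> y s - edge_deriv N 2 j (\<lambda>x. \<phi> x s) y = 0 \<and>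
        time_deriv N j \<psi> y s - edge_deriv N 2 j (\<lambda>x. \<psi> x s) y = 0) \<and>
     kirchhoff N Tmax \<phi> \<and> kirchhoff N Tmax \<psi> \<and>
     (\<forall>x\<in>points N. \<psi> x 0 = m0 x / \<phi> x 0 \<and> \<phi> x Tmax = exp (cT Tmax)) \<and>
     (\<forall>s\<in>{0..Tmax}. \<psi> (vertex N i0) s = 0 \<and> \<phi> (vertex N i0) s = exp (cT s))"

definition cost ::
    "(real \<Rightarrow> real) \<Rightarrow> (real \<Rightarrow> real) \<Rightarrow> (real \<Rightarrow> real) \<Rightarrow> real \<Rightarrow> real \<Rightarrow> real \<Rightarrow> real" where
  "cost c1 c2 c3 t0 T s = c1 (s - t0) + c2 (s - T) + c3 (T - s)"

text \<open>The cumulative flux \<open>F\<close> through the boundary vertex, along its edge \<open>j0\<close>.\<close>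

definition flux ::
    "('i, 'j, 'n::finite) net \<Rightarrow> 'i \<Rightarrow> 'j \<Rightarrow> (real \<Rightarrow> real) \<Rightarrow> (real ^ 'n \<Rightarrow> real \<Rightarrow> real) \<Rightarrow>
     real \<Rightarrow> real" where
  "flux N i0 j0 cT \<psi> s =
     integral {0..s} (\<lambda>r. exp (cT r) * vertex_deriv N j0 (\<lambda>x. \<psi> x r) i0)"

text \<open>The infimum of the empty set in \<^typ>\<open>ereal\<close> is \<open>\<infinity>\<close>.\<close>

definition quantile :: "real \<Rightarrow> (real \<Rightarrow> real) \<Rightarrow> real \<Rightarrow> ereal" where
  "quantile Tmax F \<theta> = Inf (ereal ` {s \<in> {0..Tmax}. F s \<ge> \<theta>})"

definition quorum_time :: "real \<Rightarrow> real \<Rightarrow> real \<Rightarrow> (real \<Rightarrow> real) \<Rightarrow> real" where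
  "quorum_time t0 Tmax \<theta> F =
     (if quantile Tmax F \<theta> \<le> ereal t0 then t0
      else if quantile Tmax F \<theta> < ereal Tmax then real_of_ereal (quantile Tmax F \<theta>)
      else Tmax)"

text \<open>
  The solution is unique on \<open>\<Gamma> \<times> [0,Tmax]\<close> only, not as a pair of total functions; the
  description is therefore applied to the resulting time, which depends on no values elsewhere.
\<close>

definition Psi ::
    "('i, 'j, 'n::finite) net \<Rightarrow> 'i \<Rightarrow> 'j \<Rightarrow> real \<Rightarrow> real \<Rightarrow> real \<Rightarrow> (real ^ 'n \<Rightarrow> real) \<Rightarrow>
     (real \<Rightarrow> real \<Rightarrow> real) \<Rightarrow> real \<Rightarrow> real" where
  "Psi N i0 j0 t0 Tmax \<theta> m0 c T =
     (THE Ts. \<exists>\<phi> \<psi>. is_solution N i0 Tmax m0 (c T) \<phi> \<psi> \<and>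
                    Ts = quorum_time t0 Tmax \<theta> (flux N i0 j0 (c T) \<psi>))"

end

theory Submission
  imports Defs "HOL-Probability.Distributions"
begin

text \<open>
Why the fixed point exists.  Let \<open>(\<phi>, \<psi>)\<close> be the solution for a given \<open>T\<close> and \<open>F\<^sub>T\<close> its cumulative
flux.  Since \<open>\<phi>\<close> solves the backward and \<open>\<psi>\<close> the forward heat equation, Green's formula gives
the time derivative of \<open>\<integral>\<phi>\<psi>\<close> as a sum of vertex terms; the Kirchhoff conditions cancel all of
them except the one at \<open>v\<^sub>0\<close>, which is, up to sign, the density of
\<open>F\<^sub>T\<close>.  Hence
\<open>F\<^sub>T(s) = 1 - \<integral>\<phi>(\<cdot>,s) \<psi>(\<cdot>,s)\<close> (\<open>solution_flux\<close>), an expression without derivatives.  The maximum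
principle bounds the differences of two solutions uniformly by the difference of their boundary
data (\<open>solution_stability\<close>), so \<open>T \<mapsto> F\<^sub>T(T)\<close> is continuous (\<open>diagonal_flux_continuous\<close>).
Moreover \<open>F\<^sub>T\<close> is strictly increasing: because \<open>m\<^sub>0\<close> has positive slope at \<open>v\<^sub>0\<close>, \<open>\<psi>\<close> stays above a
decaying sine mode on a short piece of \<open>e\<^sub>0\<close>, whence \<open>\<partial>\<^sub>x\<psi>(v\<^sub>0,s) > 0\<close>
(\<open>boundary_derivative_positive\<close>).  If \<open>F\<^sub>T(T) \<ge> \<theta>\<close> at \<open>T = t\<^sub>0\<close>, then \<open>t\<^sub>0\<close> is a fixed point; if
\<open>F\<^sub>T(T) < \<theta>\<close> at \<open>T = T\<^sub>m\<^sub>a\<^sub>x\<close>, then \<open>T\<^sub>m\<^sub>a\<^sub>x\<close> is one; otherwise the intermediate value theorem gives \<open>T\<close>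
with \<open>F\<^sub>T(T) = \<theta>\<close>, and by strict monotonicity this \<open>T\<close> is the quantile of \<open>F\<^sub>T\<close>.

Why \<open>\<Psi>\<close> is well defined.  Uniqueness of \<open>(\<phi>, \<psi>)\<close> is again the maximum principle.  Existence rests
on a method of images for networks.  A function on an edge evolves under the heat equation when
some extension \<open>F\<^sub>j\<close> of it to the whole line is averaged against the heat kernel.  At a vertex,
with \<open>s\<close> the outward coordinate on each incident edge, the reflection law
\<open>F\<^sub>j(- s) = 2 U(s) - F\<^sub>j(s)\<close>, where \<open>U(s)\<close> is the mean of the \<open>F\<^sub>k(s)\<close> over the incident edges, makes the
even parts of all \<open>F\<^sub>k\<close> agree and the odd parts sum to zero.  The Gaussian average at the vertex
sees only the even part and its derivative only the odd part, so these are exactly continuity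
and the Kirchhoff condition.  At \<open>v\<^sub>0\<close> one prescribes \<open>U\<close> instead, and the boundary value of the flow
is the Gaussian average of \<open>U\<close>.  The reflection law determines the extensions recursively, because
the value at distance \<open>r\<close> from an edge only refers to points that lie on their edges or are closer
to them by at least the shortest edge length (\<open>images_exist\<close>); each such step costs a constant factor, so the
extensions grow exponentially, which the Gaussian absorbs.

With \<open>U = 0\<close> this yields \<open>\<psi>\<close>.  With the polynomials \<open>s\<^sup>2/2\<close> and \<open>s\<^sup>4/24\<close> it yields flows \<open>K\<^sub>1\<close>, \<open>K\<^sub>2\<close>
that start from zero and have the boundary values \<open>t\<close> and \<open>t\<^sup>2/2\<close> (\<open>ramp_solutions\<close>).  By Taylor's
formula a smooth function \<open>b\<close> is a superposition of \<open>1\<close>, \<open>t\<close>, \<open>t\<^sup>2/2\<close> and of the translates of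
\<open>max(0, t)\<^sup>2/2\<close> with weight \<open>b'''\<close>, and the same superposition of flows has boundary value \<open>b\<close>
(\<open>boundary_value_solution\<close>); reversing time gives \<open>\<phi>\<close>.
\<close>

section \<open>Averages against the Gauss kernel\<close>

text \<open>
Completing the square bounds the integrand by a multiple of a normal density.  The dominating
functions for the Gaussian averages below are multiples of integrands of this shape.
\<close>

lemma integrable_exp_neg_square_plus_abs:
  fixes a B :: real
  assumes "0 < a"
  shows "integrable lborel (\<lambda>z. exp (- a * z\<^sup>2 + B * \<bar>z\<bar>))"
proof -
  define \<sigma> where "\<sigma> = sqrt (1 / a)"
  have \<sigma>: "\<sigma>\<^sup>2 = 1 / a" "0 < \<sigma>" using assms by (auto simp: \<sigma>_def)
  have "integrable lborel (\<lambda>z. sqrt (2 * pi * \<sigma>\<^sup>2) * exp (B\<^sup>2 / (2 * a)) * normal_density 0 \<sigma> z)"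
    using \<sigma> by simp
  moreover have "sqrt (2 * pi * \<sigma>\<^sup>2) * exp (B\<^sup>2 / (2 * a)) * normal_density 0 \<sigma> z
      = exp (B\<^sup>2 / (2 * a) - a * z\<^sup>2 / 2)" for z
  proof -
    have "sqrt (2 * pi * \<sigma>\<^sup>2) \<noteq> 0" using \<sigma> assms by simp
    then have "sqrt (2 * pi * \<sigma>\<^sup>2) * exp (B\<^sup>2 / (2 * a)) * normal_density 0 \<sigma> z
        = exp (B\<^sup>2 / (2 * a) + - (z - 0)\<^sup>2 / (2 * \<sigma>\<^sup>2))"
      unfolding normal_density_def exp_add by simp
    also have "\<dots> = exp (B\<^sup>2 / (2 * a) - a * z\<^sup>2 / 2)" by (simp add: \<sigma>(1))
    finally show ?thesis .
  qed
  ultimately have int: "integrable lborel (\<lambda>z. exp (B\<^sup>2 / (2 * a) - a * z\<^sup>2 / 2))" by simp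
  show ?thesis
  proof (rule Bochner_Integration.integrable_bound[OF int])
    show "(\<lambda>z. exp (- a * z\<^sup>2 + B * \<bar>z\<bar>)) \<in> borel_measurable lborel" by measurable
    have "- a * z\<^sup>2 + B * \<bar>z\<bar> \<le> B\<^sup>2 / (2 * a) - a * z\<^sup>2 / 2" for z
    proof -
      have "0 \<le> (a / 2) * (\<bar>z\<bar> - B / a)\<^sup>2" using assms by simp
      also have "\<dots> = B\<^sup>2 / (2 * a) - a * z\<^sup>2 / 2 - (- a * z\<^sup>2 + B * \<bar>z\<bar>)"
        using assms by (simp add: power2_eq_square field_simps)
      finally show ?thesis by simp
    qed
    then show "AE z in lborel. norm (exp (- a * z\<^sup>2 + B * \<bar>z\<bar>)) \<le> norm (exp (B\<^sup>2 / (2 * a) - a * z\<^sup>2 / 2))"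
      by simp
  qed
qed

text \<open>
By the mean value theorem the difference quotients are dominated by the bound on the
derivative, so dominated convergence applies to them.
\<close>

lemma has_real_derivative_integral_dominated:
  fixes f f' :: "real \<Rightarrow> 'a \<Rightarrow> real"
  assumes "0 < d"
    and deriv: "\<And>x s. \<bar>x - x0\<bar> < d \<Longrightarrow> ((\<lambda>x. f x s) has_real_derivative f' x s) (at x)"
    and int: "\<And>x. \<bar>x - x0\<bar> < d \<Longrightarrow> integrable M (f x)"
    and meas: "f' x0 \<in> borel_measurable M"
    and bound: "\<And>x s. \<bar>x - x0\<bar> < d \<Longrightarrow> \<bar>f' x s\<bar> \<le> g s"
    and g: "integrable M g"
  shows "((\<lambda>x. \<integral>s. f x s \<partial>M) has_real_derivative (\<integral>s. f' x0 s \<partial>M)) (at x0)"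
  unfolding has_field_derivative_iff tendsto_at_iff_sequentially o_def
proof (intro allI impI)
  fix X :: "nat \<Rightarrow> real"
  assume X: "\<forall>i. X i \<in> UNIV - {x0}" and lim: "X \<longlonglongrightarrow> x0"
  obtain m where m: "\<And>n. n \<ge> m \<Longrightarrow> \<bar>X n - x0\<bar> < d"
    using LIMSEQ_D[OF lim \<open>0 < d\<close>] by auto
  define Y where "Y n = X (n + m)" for n
  have Y: "\<bar>Y n - x0\<bar> < d" "Y n \<noteq> x0" for n using m X by (auto simp: Y_def)
  have Ylim: "Y \<longlonglongrightarrow> x0" unfolding Y_def using lim by (rule LIMSEQ_ignore_initial_segment)
  have x0: "\<bar>x0 - x0\<bar> < d" using \<open>0 < d\<close> by simp
  have "(\<lambda>n. \<integral>s. (f (Y n) s - f x0 s) / (Y n - x0) \<partial>M) \<longlonglongrightarrow> (\<integral>s. f' x0 s \<partial>M)"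
  proof (rule integral_dominated_convergence[where w = g])
    show "(\<lambda>s. (f (Y n) s - f x0 s) / (Y n - x0)) \<in> borel_measurable M" for n
      using int[OF Y(1)[of n]] int[OF x0] by measurable
    show "AE s in M. (\<lambda>n. (f (Y n) s - f x0 s) / (Y n - x0)) \<longlonglongrightarrow> f' x0 s"
    proof (rule AE_I2)
      fix s
      from deriv[OF x0, of s] show "(\<lambda>n. (f (Y n) s - f x0 s) / (Y n - x0)) \<longlonglongrightarrow> f' x0 s"
        unfolding has_field_derivative_iff tendsto_at_iff_sequentially o_def
        using Y(2) Ylim by blast
    qed
    show "AE s in M. norm ((f (Y n) s - f x0 s) / (Y n - x0)) \<le> g s" for n
    proof (rule AE_I2)
      fix s
      have "\<bar>f (Y n) s - f x0 s\<bar> \<le> g s * \<bar>Y n - x0\<bar>"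
        using field_differentiable_bound[of "ball x0 d" "\<lambda>x. f x s" "\<lambda>x. f' x s" "g s" x0 "Y n"]
          deriv[of _ s] bound[of _ s] Y(1)[of n] \<open>0 < d\<close>
        by (auto simp: dist_real_def abs_minus_commute norm_minus_commute intro: has_field_derivative_at_within)
      then show "norm ((f (Y n) s - f x0 s) / (Y n - x0)) \<le> g s"
        using Y(2)[of n] by (simp add: field_simps)
    qed
  qed (use meas g in auto)
  moreover have "(\<integral>s. (f (Y n) s - f x0 s) / (Y n - x0) \<partial>M)
      = ((\<integral>s. f (Y n) s \<partial>M) - (\<integral>s. f x0 s \<partial>M)) / (Y n - x0)" for n
    using int[OF Y(1)[of n]] int[OF x0] by simp
  ultimately have "(\<lambda>n. ((\<integral>s. f (Y n) s \<partial>M) - (\<integral>s. f x0 s \<partial>M)) / (Y n - x0)) \<longlonglongrightarrow> (\<integral>s. f' x0 s \<partial>M)"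
    by (simp only:)
  then show "(\<lambda>n. ((\<integral>s. f (X n) s \<partial>M) - (\<integral>s. f x0 s \<partial>M)) / (X n - x0)) \<longlonglongrightarrow> (\<integral>s. f' x0 s \<partial>M)"
    unfolding Y_def by (rule LIMSEQ_offset)
qed

text \<open>
Exponential growth is the class preserved by reflections at the vertices, and every Gaussian
average of such a function converges.
\<close>

definition tame :: "(real \<Rightarrow> real) \<Rightarrow> bool" where
  "tame F \<longleftrightarrow> continuous_on UNIV F \<and> (\<exists>A\<ge>0. \<exists>B\<ge>0. \<forall>s. \<bar>F s\<bar> \<le> A * exp (B * \<bar>s\<bar>))"

text \<open>
The kernel and its first two derivatives are a polynomial times \<open>exp (- z\<^sup>2/2)\<close>; the weaker
exponent \<open>1/4\<close> absorbs the polynomial.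
\<close>

definition gaussian_weight :: "(real \<Rightarrow> real) \<Rightarrow> bool" where
  "gaussian_weight w \<longleftrightarrow> continuous_on UNIV w \<and> (\<exists>C\<ge>0. \<forall>z. \<bar>w z\<bar> \<le> C * exp (- (1/4) * z\<^sup>2))"

text \<open>
For \<open>w\<close> the standard normal density this is the solution at time \<open>t\<close> of the heat equation on the
line with initial values \<open>F\<close>, after the substitution \<open>s = x + sqrt (2 * t) * z\<close>.  In this form the
value at \<open>t = 0\<close> is \<open>F x\<close> itself, and continuity up to \<open>t = 0\<close> is dominated convergence.
\<close>

definition gavg :: "(real \<Rightarrow> real) \<Rightarrow> (real \<Rightarrow> real) \<Rightarrow> real \<Rightarrow> real \<Rightarrow> real" where
  "gavg w F x t = (\<integral>z. w z * F (x + sqrt (2 * t) * z) \<partial>lborel)"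

abbreviation "gauss \<equiv> std_normal_density"

definition gauss1 :: "real \<Rightarrow> real" where "gauss1 z = z * gauss z"

text \<open>
\<open>gauss1\<close> and \<open>gauss2\<close> are \<open>- gauss'\<close> and \<open>gauss''\<close>, that is, the density times the Hermite
polynomials of degree one and two.
\<close>

definition gauss2 :: "real \<Rightarrow> real" where "gauss2 z = (z\<^sup>2 - 1) * gauss z"

lemma DERIV_gauss: "(gauss has_real_derivative - gauss1 z) (at z)"
proof -
  have "((\<lambda>x. K * exp (- x\<^sup>2 / 2)) has_real_derivative - (z * (K * exp (- z\<^sup>2 / 2)))) (at z)" for K :: real
    by (auto intro!: derivative_eq_intros)
  from this[of "1 / sqrt (2 * pi)"] show ?thesis
    unfolding std_normal_density_def[abs_def] gauss1_def by simp
qed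

lemma DERIV_gauss1: "(gauss1 has_real_derivative - gauss2 z) (at z)"
  unfolding gauss1_def[abs_def] gauss2_def
  by (auto intro!: derivative_eq_intros DERIV_gauss simp: gauss1_def power2_eq_square algebra_simps)

lemma continuous_on_gauss [continuous_intros]: "continuous_on S f \<Longrightarrow> continuous_on S (\<lambda>x. gauss (f x))"
  unfolding std_normal_density_def[abs_def] by (intro continuous_intros) auto

lemma gauss_bound: "(1 + z\<^sup>2) * gauss z \<le> 4 * exp (- (1/4) * z\<^sup>2)"
proof -
  have "1 + z\<^sup>2 \<le> 4 * (1 + z\<^sup>2 / 4)" by simp
  also have "\<dots> \<le> 4 * exp (z\<^sup>2 / 4)" by (rule mult_left_mono[OF exp_ge_add_one_self]) simp
  finally have 1: "1 + z\<^sup>2 \<le> 4 * exp (z\<^sup>2 / 4)" .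
  have 2: "gauss z \<le> exp (- z\<^sup>2 / 2)"
  proof -
    have "1 \<le> sqrt (2 * pi)" using pi_gt3 by (simp add: real_le_rsqrt)
    then show ?thesis unfolding std_normal_density_def by (simp add: field_simps)
  qed
  have "(1 + z\<^sup>2) * gauss z \<le> (4 * exp (z\<^sup>2 / 4)) * exp (- z\<^sup>2 / 2)"
    by (rule mult_mono[OF 1 2]) auto
  also have "\<dots> = 4 * exp (- (1/4) * z\<^sup>2)" by (simp add: exp_add[symmetric] mult.assoc)
  finally show ?thesis .
qed

lemma gaussian_weight_gauss: "gaussian_weight gauss"
  unfolding gaussian_weight_def
proof (intro conjI exI[of _ 4] allI)
  fix z :: real
  have "\<bar>gauss z\<bar> \<le> (1 + z\<^sup>2) * gauss z" using mult_right_mono[OF _ normal_density_nonneg[of 0 1 z], of 1 "1 + z\<^sup>2"] by simp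
  with gauss_bound[of z] show "\<bar>gauss z\<bar> \<le> 4 * exp (- (1/4) * z\<^sup>2)" by linarith
qed (auto intro!: continuous_intros)

lemma gaussian_weight_gauss1: "gaussian_weight gauss1"
  unfolding gaussian_weight_def
proof (intro conjI exI[of _ 4] allI)
  fix z :: real
  have "\<bar>z\<bar> \<le> 1 + z\<^sup>2"
  proof -
    have "0 \<le> (\<bar>z\<bar> - 1/2)\<^sup>2" by simp
    then show ?thesis by (simp add: power2_eq_square algebra_simps) 
  qed
  then have "\<bar>gauss1 z\<bar> \<le> (1 + z\<^sup>2) * gauss z"
    by (simp add: gauss1_def abs_mult mult_right_mono)
  with gauss_bound[of z] show "\<bar>gauss1 z\<bar> \<le> 4 * exp (- (1/4) * z\<^sup>2)" by linarith
qed (auto intro!: continuous_intros simp: gauss1_def[abs_def])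

lemma gaussian_weight_gauss2: "gaussian_weight gauss2"
  unfolding gaussian_weight_def
proof (intro conjI exI[of _ 4] allI)
  fix z :: real
  have "\<bar>z\<^sup>2 - 1\<bar> \<le> 1 + z\<^sup>2" by (simp add: abs_le_iff)
  then have "\<bar>gauss2 z\<bar> \<le> (1 + z\<^sup>2) * gauss z"
    by (simp add: gauss2_def abs_mult mult_right_mono)
  with gauss_bound[of z] show "\<bar>gauss2 z\<bar> \<le> 4 * exp (- (1/4) * z\<^sup>2)" by linarith
qed (auto intro!: continuous_intros simp: gauss2_def[abs_def])

lemma integrable_bounded_by_gauss:
  fixes f :: "real \<Rightarrow> real"
  assumes "0 < a" "f \<in> borel_measurable borel" "\<And>z. \<bar>f z\<bar> \<le> C * exp (- a * z\<^sup>2 + B * \<bar>z\<bar>)"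
  shows "integrable lborel f"
proof (rule Bochner_Integration.integrable_bound)
  show "integrable lborel (\<lambda>z. C * exp (- a * z\<^sup>2 + B * \<bar>z\<bar>))"
    using integrable_exp_neg_square_plus_abs[OF assms(1)] by simp
  show "AE z in lborel. norm (f z) \<le> norm (C * exp (- a * z\<^sup>2 + B * \<bar>z\<bar>))"
    using assms(3) by (intro AE_I2) (smt (verit) real_norm_def)
qed (use assms in simp)

lemma tame_shift_bound:
  fixes x c z :: real
  assumes "\<forall>s. \<bar>F s\<bar> \<le> A * exp (B * \<bar>s\<bar>)" "0 \<le> A" "0 \<le> B" "\<bar>x\<bar> \<le> X" "\<bar>c\<bar> \<le> R"
  shows "\<bar>F (x + c * z)\<bar> \<le> A * exp (B * X + (B * R) * \<bar>z\<bar>)"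
proof -
  have "\<bar>x + c * z\<bar> \<le> X + R * \<bar>z\<bar>"
  proof -
    have "\<bar>x + c * z\<bar> \<le> \<bar>x\<bar> + \<bar>c\<bar> * \<bar>z\<bar>" using abs_triangle_ineq[of x "c * z"] by (simp add: abs_mult)
    also have "\<dots> \<le> X + R * \<bar>z\<bar>" using assms by (intro add_mono mult_right_mono) auto
    finally show ?thesis .
  qed
  then have "B * \<bar>x + c * z\<bar> \<le> B * (X + R * \<bar>z\<bar>)" using assms by (intro mult_left_mono)
  then have "A * exp (B * \<bar>x + c * z\<bar>) \<le> A * exp (B * X + (B * R) * \<bar>z\<bar>)"
    using assms by (intro mult_left_mono) (auto simp: algebra_simps)
  with assms(1) show ?thesis by (meson order_trans)
qed

lemma tame_continuous_on:
  assumes "tame F" "continuous_on S g"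
  shows "continuous_on S (\<lambda>x. F (g x))"
  using continuous_on_compose2[of UNIV F S g] assms by (auto simp: tame_def)

text \<open>
One dominating function serves all \<open>x\<close> and \<open>c\<close> in a bounded set, which gives joint continuity in
space and time.
\<close>

lemma gavg_dominated:
  assumes "gaussian_weight w" "tame F"
  obtains C b where "\<And>x c z. \<bar>x\<bar> \<le> X \<Longrightarrow> \<bar>c\<bar> \<le> R \<Longrightarrow> \<bar>w z * F (x + c * z)\<bar> \<le> C * exp (- (1/4) * z\<^sup>2 + b * \<bar>z\<bar>)"
proof -
  from assms(1) obtain C0 where C0: "C0 \<ge> 0" "\<And>z. \<bar>w z\<bar> \<le> C0 * exp (- (1/4) * z\<^sup>2)"
    unfolding gaussian_weight_def by blast
  from assms(2) obtain A B where AB: "0 \<le> A" "0 \<le> B" "\<forall>s. \<bar>F s\<bar> \<le> A * exp (B * \<bar>s\<bar>)"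
    unfolding tame_def by blast
  show thesis
  proof (rule that)
    fix x c z :: real assume "\<bar>x\<bar> \<le> X" "\<bar>c\<bar> \<le> R"
    from tame_shift_bound[OF AB(3,1,2) this, of z]
    have "\<bar>w z\<bar> * \<bar>F (x + c * z)\<bar> \<le> (C0 * exp (- (1/4) * z\<^sup>2)) * (A * exp (B * X + (B * R) * \<bar>z\<bar>))"
      using C0 by (intro mult_mono) auto
    also have "\<dots> = (C0 * A * exp (B * X)) * exp (- (1/4) * z\<^sup>2 + (B * R) * \<bar>z\<bar>)"
      by (simp only: exp_add mult_ac)
    finally show "\<bar>w z * F (x + c * z)\<bar> \<le> (C0 * A * exp (B * X)) * exp (- (1/4) * z\<^sup>2 + (B * R) * \<bar>z\<bar>)"
      by (simp add: abs_mult)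
  qed
qed

lemma gavg_measurable:
  assumes "gaussian_weight w" "tame F"
  shows "(\<lambda>z. w z * F (x + c * z)) \<in> borel_measurable borel"
proof -
  have "continuous_on UNIV w"
    using assms by (auto simp: gaussian_weight_def)
  then have "continuous_on UNIV (\<lambda>z. w z * F (x + c * z))"
    by (intro continuous_intros tame_continuous_on[OF assms(2)])
  then show ?thesis by (rule borel_measurable_continuous_onI)
qed

lemma gavg_integrable:
  assumes "gaussian_weight w" "tame F"
  shows "integrable lborel (\<lambda>z. w z * F (x + c * z))"
proof -
  obtain C b where "\<And>x' c' z. \<bar>x'\<bar> \<le> \<bar>x\<bar> \<Longrightarrow> \<bar>c'\<bar> \<le> \<bar>c\<bar> \<Longrightarrow> \<bar>w z * F (x' + c' * z)\<bar> \<le> C * exp (- (1/4) * z\<^sup>2 + b * \<bar>z\<bar>)"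
    using gavg_dominated[OF assms, of "\<bar>x\<bar>" "\<bar>c\<bar>"] by blast
  then show ?thesis
    by (intro integrable_bounded_by_gauss[of "1/4" _ C b] gavg_measurable assms) auto
qed

lemma continuous_on_gavg:
  assumes "gaussian_weight w" "tame F"
  shows "continuous_on UNIV (\<lambda>(x, t). gavg w F x t)"
proof (rule continuous_on_sequentiallyI, goal_cases)
  case (1 u a)
  have lim1: "(\<lambda>n. fst (u n)) \<longlonglongrightarrow> fst a" and lim2: "(\<lambda>n. sqrt (2 * snd (u n))) \<longlonglongrightarrow> sqrt (2 * snd a)"
    by (rule tendsto_fst[OF 1(3)], intro tendsto_intros tendsto_snd[OF 1(3)])
  obtain X where X: "\<And>n. \<bar>fst (u n)\<bar> \<le> X"
    using convergent_imp_Bseq[OF convergentI[OF lim1]] by (auto simp: Bseq_def)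
  obtain R where R: "\<And>n. \<bar>sqrt (2 * snd (u n))\<bar> \<le> R"
    using convergent_imp_Bseq[OF convergentI[OF lim2]] unfolding Bseq_def real_norm_def by blast
  obtain C b where dom: "\<And>x c z. \<bar>x\<bar> \<le> X \<Longrightarrow> \<bar>c\<bar> \<le> R \<Longrightarrow> \<bar>w z * F (x + c * z)\<bar> \<le> C * exp (- (1/4) * z\<^sup>2 + b * \<bar>z\<bar>)"
    using gavg_dominated[OF assms, of X R] by blast
  have "(\<lambda>n. \<integral>z. w z * F (fst (u n) + sqrt (2 * snd (u n)) * z) \<partial>lborel)
      \<longlonglongrightarrow> (\<integral>z. w z * F (fst a + sqrt (2 * snd a) * z) \<partial>lborel)"
  proof (rule integral_dominated_convergence[where w = "\<lambda>z. C * exp (- (1/4) * z\<^sup>2 + b * \<bar>z\<bar>)"])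
    show "integrable lborel (\<lambda>z. C * exp (- (1/4) * z\<^sup>2 + b * \<bar>z\<bar>))"
      using integrable_exp_neg_square_plus_abs[of "1/4" b] by simp
    show "AE z in lborel. (\<lambda>n. w z * F (fst (u n) + sqrt (2 * snd (u n)) * z))
        \<longlonglongrightarrow> w z * F (fst a + sqrt (2 * snd a) * z)"
    proof (rule AE_I2)
      fix z
      have "isCont F (fst a + sqrt (2 * snd a) * z)"
        using assms(2) by (auto simp: tame_def continuous_on_eq_continuous_at)
      moreover have "(\<lambda>n. fst (u n) + sqrt (2 * snd (u n)) * z) \<longlonglongrightarrow> fst a + sqrt (2 * snd a) * z"
        by (intro tendsto_add tendsto_mult tendsto_const lim1 lim2)
      ultimately show "(\<lambda>n. w z * F (fst (u n) + sqrt (2 * snd (u n)) * z))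
        \<longlonglongrightarrow> w z * F (fst a + sqrt (2 * snd a) * z)"
        by (rule tendsto_mult[OF tendsto_const isCont_tendsto_compose])
    qed
  qed (use gavg_measurable[OF assms] dom[OF X R] in \<open>auto\<close>)
  then show ?case by (simp add: gavg_def case_prod_beta)
qed

lemma continuous_on_gavg' [continuous_intros]:
  assumes "gaussian_weight w" "tame F" "continuous_on S f" "continuous_on S g"
  shows "continuous_on S (\<lambda>p. gavg w F (f p) (g p))"
  using continuous_on_compose2[OF continuous_on_gavg[OF assms(1,2)], of S "\<lambda>p. (f p, g p)"] assms(3,4)
  by (auto intro: continuous_intros)

text \<open>
Moving \<open>x\<close> is, after a translation of the integration variable, a shift of the weight.  The
derivative therefore falls on \<open>w\<close>, and \<open>F\<close> may be merely continuous.
\<close>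

lemma DERIV_gavg_space:
  assumes w: "gaussian_weight w" and v: "gaussian_weight v"
    and wv: "\<And>z. (w has_real_derivative - v z) (at z)" and F: "tame F" and t: "0 < t"
  shows "((\<lambda>x. gavg w F x t) has_real_derivative gavg v F x t / sqrt (2 * t)) (at x)"
proof -
  define c where "c = sqrt (2 * t)"
  have c: "0 < c" using t by (simp add: c_def)
  from v obtain C where C: "C \<ge> 0" "\<And>z. \<bar>v z\<bar> \<le> C * exp (- (1/4) * z\<^sup>2)"
    unfolding gaussian_weight_def by blast
  from F obtain A B where AB: "0 \<le> A" "0 \<le> B" "\<forall>s. \<bar>F s\<bar> \<le> A * exp (B * \<bar>s\<bar>)"
    unfolding tame_def by blast
  define g where "g z = (C * exp (1/4) * A * exp (B * \<bar>x\<bar>)) * exp (- (1/8) * z\<^sup>2 + (B * c) * \<bar>z\<bar>)" for z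
  have shift: "(\<lambda>z. w (z - h) * F (x + c * z)) = (\<lambda>z. w (z + (- h)) * F ((x + c * h) + c * (z + (- h))))" for h
    by (auto simp: algebra_simps)
  have eq: "gavg w F (x + c * h) t = (\<integral>z. w (z - h) * F (x + c * z) \<partial>lborel)" for h
    unfolding shift
    using lborel_integral_real_affine[of 1 "\<lambda>z. w z * F (x + c * h + c * z)" "- h"]
    by (simp add: gavg_def c_def add.commute)
  have veq: "(\<integral>z. v z * F (x + c * z) \<partial>lborel) = gavg v F x t" by (simp add: gavg_def c_def)
  have int: "integrable lborel (\<lambda>z. w (z - h) * F (x + c * z))" for h
    unfolding shift
    using lborel_integrable_real_affine_iff[of 1 "\<lambda>z. w z * F (x + c * h + c * z)" "- h"]
      gavg_integrable[OF w F, of "x + c * h" c]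
    by (simp add: add.commute)
  have "((\<lambda>h. \<integral>z. w (z - h) * F (x + c * z) \<partial>lborel) has_real_derivative
      (\<integral>z. v (z - 0) * F (x + c * z) \<partial>lborel)) (at 0)"
  proof (rule has_real_derivative_integral_dominated[where d = 1 and g = g])
    show "((\<lambda>h. w (z - h) * F (x + c * z)) has_real_derivative v (z - h) * F (x + c * z)) (at h)" for h z
      by (rule DERIV_cong, rule derivative_eq_intros, rule DERIV_chain2[OF wv])
         (auto intro!: derivative_eq_intros)
    show "(\<lambda>z. v (z - 0) * F (x + c * z)) \<in> borel_measurable lborel"
      using gavg_measurable[OF v F] by simp
    show "integrable lborel g"
      unfolding g_def using integrable_exp_neg_square_plus_abs[of "1/8" "B * c"] by simp
    fix h z :: real assume h: "\<bar>h - 0\<bar> < 1"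
    have "- (1/4) * (z - h)\<^sup>2 \<le> 1/4 - (1/8) * z\<^sup>2"
    proof -
      have "0 \<le> (z - 2 * h)\<^sup>2" by simp
      moreover have "h\<^sup>2 \<le> 1" using h by (simp add: abs_square_le_1)
      ultimately show ?thesis by (simp add: power2_eq_square algebra_simps)
    qed
    then have "\<bar>v (z - h)\<bar> \<le> C * exp (1/4 - (1/8) * z\<^sup>2)"
      using C(2)[of "z - h"] C(1) by (smt (verit) exp_le_cancel_iff mult_left_mono)
    moreover have "\<bar>F (x + c * z)\<bar> \<le> A * exp (B * \<bar>x\<bar> + (B * c) * \<bar>z\<bar>)"
      using tame_shift_bound[OF AB(3,1,2), of x "\<bar>x\<bar>" c c z] c by simp
    ultimately have "\<bar>v (z - h)\<bar> * \<bar>F (x + c * z)\<bar> \<le> (C * exp (1/4 - (1/8) * z\<^sup>2)) * (A * exp (B * \<bar>x\<bar> + (B * c) * \<bar>z\<bar>))"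
      using C(1) by (intro mult_mono) auto
    also have "exp (1/4 - (1/8) * z\<^sup>2) = exp (1/4) * exp (- (1/8) * z\<^sup>2)" by (simp add: exp_add[symmetric])
    also have "C * (exp (1/4) * exp (- (1/8) * z\<^sup>2)) * (A * exp (B * \<bar>x\<bar> + (B * c) * \<bar>z\<bar>)) = g z"
      by (simp only: g_def exp_add mult_ac)
    finally show "\<bar>v (z - h) * F (x + c * z)\<bar> \<le> g z" by (simp add: abs_mult)
  qed (use int in auto)
  then have "((\<lambda>h. gavg w F (x + c * h) t) has_real_derivative gavg v F x t) (at ((x - x) / c))"
    unfolding eq[symmetric] by (simp add: veq)
  then have "((\<lambda>y. gavg w F (x + c * ((y - x) / c)) t) has_real_derivative gavg v F x t * (1 / c)) (at x)"
    by (rule DERIV_chain2[where g = "\<lambda>y. (y - x) / c"]) (use c in \<open>auto intro!: derivative_eq_intros\<close>)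
  then show ?thesis using c by (simp add: c_def)
qed

text \<open>
Rescaling time is, after a dilation of the integration variable, a dilation of the weight:
\<open>k * gauss (k * z)\<close> has the \<open>k\<close>-derivative \<open>- gauss2 (k * z)\<close>.
\<close>

lemma DERIV_gavg_scale:
  assumes F: "tame F" and c: "0 < c"
  shows "((\<lambda>k. \<integral>z. k * gauss (k * z) * F (x + c * z) \<partial>lborel) has_real_derivative
           - (\<integral>z. gauss2 z * F (x + c * z) \<partial>lborel)) (at 1)"
proof -
  obtain C where C: "C \<ge> 0" "\<And>z. \<bar>gauss2 z\<bar> \<le> C * exp (- (1/4) * z\<^sup>2)"
    using gaussian_weight_gauss2 unfolding gaussian_weight_def by blast
  obtain C' where C': "C' \<ge> 0" "\<And>z. \<bar>gauss z\<bar> \<le> C' * exp (- (1/4) * z\<^sup>2)"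
    using gaussian_weight_gauss unfolding gaussian_weight_def by blast
  from F obtain A B where AB: "0 \<le> A" "0 \<le> B" "\<forall>s. \<bar>F s\<bar> \<le> A * exp (B * \<bar>s\<bar>)"
    unfolding tame_def by blast
  have FB: "\<bar>F (x + c * z)\<bar> \<le> A * exp (B * \<bar>x\<bar> + (B * c) * \<bar>z\<bar>)" for z
    using tame_shift_bound[OF AB(3,1,2), of x "\<bar>x\<bar>" c c z] c by simp
  have contF: "continuous_on UNIV (\<lambda>z. F (x + c * z))"
    by (intro continuous_intros tame_continuous_on[OF F])
  have sq: "- (1/4) * (k * z)\<^sup>2 \<le> - (1/16) * z\<^sup>2" if "\<bar>k - 1\<bar> < 1/2" for k z :: real
  proof -
    have "(1/2)\<^sup>2 \<le> k\<^sup>2" using that by (intro power_mono) (auto simp: abs_if split: if_splits)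
    then have "(1/4) * z\<^sup>2 \<le> k\<^sup>2 * z\<^sup>2" by (intro mult_right_mono) (auto simp: power2_eq_square)
    then show ?thesis by (simp add: power_mult_distrib)
  qed
  define D where "D K z = (K * A * exp (B * \<bar>x\<bar>)) * exp (- (1/16) * z\<^sup>2 + (B * c) * \<bar>z\<bar>)" for K z
  have D: "\<bar>u * F (x + c * z)\<bar> \<le> D K z"
    if "\<bar>k - 1\<bar> < 1/2" "\<bar>u\<bar> \<le> K * exp (- (1/4) * (k * z)\<^sup>2)" "0 \<le> K" for u k K z
  proof -
    have "\<bar>u\<bar> \<le> K * exp (- (1/16) * z\<^sup>2)"
      using that sq[OF that(1), of z] by (smt (verit) exp_le_cancel_iff mult_left_mono)
    then have "\<bar>u\<bar> * \<bar>F (x + c * z)\<bar> \<le> (K * exp (- (1/16) * z\<^sup>2)) * (A * exp (B * \<bar>x\<bar> + (B * c) * \<bar>z\<bar>))"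
      using FB that by (intro mult_mono) auto
    also have "\<dots> = D K z" by (simp only: D_def exp_add mult_ac)
    finally show ?thesis by (simp add: abs_mult)
  qed
  have "((\<lambda>k. \<integral>z. k * gauss (k * z) * F (x + c * z) \<partial>lborel) has_real_derivative
      (\<integral>z. - gauss2 (1 * z) * F (x + c * z) \<partial>lborel)) (at 1)"
  proof (rule has_real_derivative_integral_dominated[where d = "1/2" and g = "D C"])
    fix k z :: real
    have "((\<lambda>k. k * gauss (k * z)) has_real_derivative 1 * gauss (k * z) + (- gauss1 (k * z) * z) * k) (at k)"
      by (intro DERIV_mult DERIV_chain2[OF DERIV_gauss]) (auto intro!: derivative_eq_intros)
    moreover have "1 * gauss (k * z) + (- gauss1 (k * z) * z) * k = - gauss2 (k * z)"
      by (simp add: gauss1_def gauss2_def power2_eq_square algebra_simps)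
    ultimately show "((\<lambda>k. k * gauss (k * z) * F (x + c * z)) has_real_derivative
        - gauss2 (k * z) * F (x + c * z)) (at k)"
      by (metis DERIV_cmult_right)
  next
    fix k :: real assume k: "\<bar>k - 1\<bar> < 1/2"
    show "integrable lborel (\<lambda>z. k * gauss (k * z) * F (x + c * z))"
    proof (rule integrable_bounded_by_gauss)
      have "continuous_on UNIV (\<lambda>z. k * gauss (k * z) * F (x + c * z))"
        by (intro continuous_intros contF)
      then show "(\<lambda>z. k * gauss (k * z) * F (x + c * z)) \<in> borel_measurable borel"
        by (rule borel_measurable_continuous_onI)
      fix z
      have "\<bar>k * gauss (k * z)\<bar> \<le> \<bar>k\<bar> * (C' * exp (- (1/4) * (k * z)\<^sup>2))"
        unfolding abs_mult[of k] by (rule mult_left_mono[OF C'(2)]) simp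
      then have "\<bar>k * gauss (k * z) * F (x + c * z)\<bar> \<le> D (\<bar>k\<bar> * C') z"
        using C'(1) by (intro D[OF k]) (simp_all only: mult.assoc zero_le_mult_iff abs_ge_zero, simp)
      then show "\<bar>k * gauss (k * z) * F (x + c * z)\<bar>
          \<le> ((\<bar>k\<bar> * C') * A * exp (B * \<bar>x\<bar>)) * exp (- (1/16) * z\<^sup>2 + (B * c) * \<bar>z\<bar>)"
        unfolding D_def .
    qed simp
    fix z
    show "\<bar>- gauss2 (k * z) * F (x + c * z)\<bar> \<le> D C z"
      using C by (intro D[OF k]) auto
  next
    show "(\<lambda>z. - gauss2 (1 * z) * F (x + c * z)) \<in> borel_measurable lborel"
      using gavg_measurable[OF gaussian_weight_gauss2 F, of x c] by simp
    show "integrable lborel (D C)"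
      unfolding D_def using integrable_exp_neg_square_plus_abs[of "1/16" "B * c"] by simp
  qed simp
  then show ?thesis by simp
qed

text \<open>
The right-hand side is also the second space derivative, so this is the heat equation.
\<close>

lemma DERIV_gavg_time:
  assumes F: "tame F" and t: "0 < t"
  shows "((\<lambda>t. gavg gauss F x t) has_real_derivative gavg gauss2 F x t / (2 * t)) (at t)"
proof -
  define c where "c = sqrt (2 * t)"
  have c: "0 < c" using t by (simp add: c_def)
  \<comment> \<open>The dilation by \<open>k = sqrt (t / s)\<close> moves the dependence on the time \<open>s\<close> from \<open>F\<close> into the weight.\<close>
  define \<Phi> where "\<Phi> k = (\<integral>z. k * gauss (k * z) * F (x + c * z) \<partial>lborel)" for k
  have eq: "\<Phi> (sqrt (t / s)) = gavg gauss F x s" if "0 < s" for s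
  proof -
    define k where "k = sqrt (t / s)"
    have k: "0 < k" using that t by (simp add: k_def)
    have "gavg gauss F x s = k * (\<integral>z. gauss (0 + k * z) * F (x + sqrt (2 * s) * (0 + k * z)) \<partial>lborel)"
      unfolding gavg_def using lborel_integral_real_affine[of k "\<lambda>z. gauss z * F (x + sqrt (2 * s) * z)" 0] k
      by simp
    also have "(\<lambda>z. sqrt (2 * s) * (0 + k * z)) = (\<lambda>z. c * z)"
    proof -
      have "sqrt (2 * s) * k = c"
        unfolding k_def c_def real_sqrt_mult[symmetric] using that by simp
      then show ?thesis by (simp add: mult.assoc[symmetric])
    qed
    finally show ?thesis unfolding \<Phi>_def k_def[symmetric] by (simp add: mult.assoc)
  qed
  have "((\<lambda>s. sqrt (t / s)) has_real_derivative - (1 / (2 * t))) (at t)"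
  proof -
    have "((\<lambda>s. sqrt (t / s)) has_real_derivative (- (t / t\<^sup>2)) * (inverse (sqrt (t / t)) / 2)) (at t)"
      using t by (auto intro!: derivative_eq_intros simp: power2_eq_square)
    then show ?thesis using t by (simp add: power2_eq_square field_simps)
  qed
  moreover have "(\<Phi> has_real_derivative - (\<integral>z. gauss2 z * F (x + c * z) \<partial>lborel)) (at (sqrt (t / t)))"
    using DERIV_gavg_scale[OF F c, of x] t unfolding \<Phi>_def by simp
  ultimately have "((\<lambda>s. \<Phi> (sqrt (t / s))) has_real_derivative
      - (\<integral>z. gauss2 z * F (x + c * z) \<partial>lborel) * - (1 / (2 * t))) (at t)"
    by (rule DERIV_chain2[rotated])
  then have "((\<lambda>s. \<Phi> (sqrt (t / s))) has_real_derivative gavg gauss2 F x t / (2 * t)) (at t)"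
    by (simp add: gavg_def c_def)
  then show ?thesis
    by (rule has_field_derivative_transform_within_open[where S = "{0<..}"]) (use t eq in auto)
qed

section \<open>Functions of exponential growth and symmetries of the average\<close>

lemma tame_affine:
  assumes "tame F"
  shows "tame (\<lambda>s. F (a + b * s))"
proof -
  from assms obtain A B where AB: "0 \<le> A" "0 \<le> B" "\<forall>s. \<bar>F s\<bar> \<le> A * exp (B * \<bar>s\<bar>)"
    unfolding tame_def by blast
  have "\<bar>F (a + b * s)\<bar> \<le> (A * exp (B * \<bar>a\<bar>)) * exp ((B * \<bar>b\<bar>) * \<bar>s\<bar>)" for s
    using tame_shift_bound[OF AB(3,1,2), of a "\<bar>a\<bar>" b "\<bar>b\<bar>" s] by (simp add: exp_add mult_ac)
  then show ?thesis
    unfolding tame_def using AB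
    by (intro conjI tame_continuous_on[OF assms] continuous_intros exI[of _ "A * exp (B * \<bar>a\<bar>)"] exI[of _ "B * \<bar>b\<bar>"]) auto
qed

lemma tame_reflect: "tame F \<Longrightarrow> tame (\<lambda>s. F (l - s))"
  using tame_affine[of F l "-1"] by simp

lemma tame_abs:
  assumes "tame F" shows "tame (\<lambda>s. F \<bar>s\<bar>)"
proof -
  from assms obtain A B where "0 \<le> A" "0 \<le> B" "\<forall>s. \<bar>F s\<bar> \<le> A * exp (B * \<bar>s\<bar>)"
    unfolding tame_def by blast
  moreover from this have "\<forall>s. \<bar>F \<bar>s\<bar>\<bar> \<le> A * exp (B * \<bar>s\<bar>)" by (metis abs_idempotent)
  ultimately show ?thesis
    unfolding tame_def
    by (intro conjI tame_continuous_on[OF assms] continuous_intros exI[of _ A] exI[of _ B])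
qed

lemma tame_const: "tame (\<lambda>s. k)"
  unfolding tame_def
  by (rule conjI, simp, rule exI[of _ "\<bar>k\<bar>"], rule conjI, simp, rule exI[of _ 0], simp)

lemma tame_add:
  assumes "tame F" "tame G" shows "tame (\<lambda>s. F s + G s)"
proof -
  from assms(1) obtain A B where 1: "0 \<le> A" "0 \<le> B" "\<forall>s. \<bar>F s\<bar> \<le> A * exp (B * \<bar>s\<bar>)"
    unfolding tame_def by blast
  from assms(2) obtain A' B' where 2: "0 \<le> A'" "0 \<le> B'" "\<forall>s. \<bar>G s\<bar> \<le> A' * exp (B' * \<bar>s\<bar>)"
    unfolding tame_def by blast
  have "\<bar>F s + G s\<bar> \<le> (A + A') * exp ((B + B') * \<bar>s\<bar>)" for s
  proof -
    have "B * \<bar>s\<bar> \<le> (B + B') * \<bar>s\<bar>" "B' * \<bar>s\<bar> \<le> (B + B') * \<bar>s\<bar>"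
      using 1 2 by (auto intro!: mult_right_mono)
    then have "A * exp (B * \<bar>s\<bar>) \<le> A * exp ((B + B') * \<bar>s\<bar>)" "A' * exp (B' * \<bar>s\<bar>) \<le> A' * exp ((B + B') * \<bar>s\<bar>)"
      using 1 2 by (auto intro!: mult_left_mono)
    then show ?thesis
      using 1(3)[rule_format, of s] 2(3)[rule_format, of s] abs_triangle_ineq[of "F s" "G s"]
      unfolding distrib_right by linarith
  qed
  then show ?thesis
    unfolding tame_def using 1 2 assms
    by (intro conjI continuous_intros exI[of _ "A + A'"] exI[of _ "B + B'"]) (auto simp: tame_def)
qed

lemma tame_cmult:
  assumes "tame F" shows "tame (\<lambda>s. k * F s)"
proof -
  from assms obtain A B where 1: "0 \<le> A" "0 \<le> B" "\<forall>s. \<bar>F s\<bar> \<le> A * exp (B * \<bar>s\<bar>)"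
    unfolding tame_def by blast
  have "\<bar>k * F s\<bar> \<le> (\<bar>k\<bar> * A) * exp (B * \<bar>s\<bar>)" for s
    using mult_left_mono[OF 1(3)[rule_format, of s], of "\<bar>k\<bar>"] by (simp add: abs_mult mult.assoc)
  then show ?thesis
    unfolding tame_def using 1 assms
    by (intro conjI continuous_intros exI[of _ "\<bar>k\<bar> * A"] exI[of _ B]) (auto simp: tame_def)
qed

lemma tame_sum: "(\<And>j. j \<in> J \<Longrightarrow> tame (F j)) \<Longrightarrow> tame (\<lambda>s. \<Sum>j\<in>J. F j s)"
  by (induction J rule: infinite_finite_induct) (auto intro: tame_const tame_add)

lemma tame_antiderivative:
  assumes "tame f" and deriv: "\<And>s. (F has_real_derivative f s) (at s)"
  shows "tame F"
proof -
  from assms obtain A B where AB: "0 \<le> A" "0 \<le> B" "\<forall>s. \<bar>f s\<bar> \<le> A * exp (B * \<bar>s\<bar>)"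
    unfolding tame_def by blast
  have "\<bar>F s\<bar> \<le> (\<bar>F 0\<bar> + A) * exp ((B + 1) * \<bar>s\<bar>)" for s
  proof -
    have "\<bar>f y\<bar> \<le> A * exp (B * \<bar>s\<bar>)" if "\<bar>y\<bar> \<le> \<bar>s\<bar>" for y
    proof -
      have "A * exp (B * \<bar>y\<bar>) \<le> A * exp (B * \<bar>s\<bar>)" using AB that by (intro mult_left_mono) (auto intro: mult_left_mono)
      with AB(3) show ?thesis by (meson order_trans)
    qed
    then have "\<bar>F s - F 0\<bar> \<le> (A * exp (B * \<bar>s\<bar>)) * \<bar>s - 0\<bar>"
      using field_differentiable_bound[of "cball 0 \<bar>s\<bar>" F f "A * exp (B * \<bar>s\<bar>)" s 0] deriv
      by (auto intro: has_field_derivative_at_within)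
    also have "\<dots> \<le> (A * exp (B * \<bar>s\<bar>)) * exp \<bar>s\<bar>"
    proof (rule mult_left_mono)
      show "\<bar>s - 0\<bar> \<le> exp \<bar>s\<bar>" using exp_ge_add_one_self[of "\<bar>s\<bar>"] by linarith
    qed (use AB in simp)
    also have "\<dots> = A * exp ((B + 1) * \<bar>s\<bar>)" by (simp add: mult_exp_exp algebra_simps)
    finally have "\<bar>F s\<bar> \<le> \<bar>F 0\<bar> * 1 + A * exp ((B + 1) * \<bar>s\<bar>)" by linarith
    moreover have "\<bar>F 0\<bar> * 1 \<le> \<bar>F 0\<bar> * exp ((B + 1) * \<bar>s\<bar>)"
      using AB by (intro mult_left_mono) auto
    ultimately show ?thesis by (simp add: distrib_right)
  qed
  moreover have "continuous_on UNIV F"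
    using deriv by (meson DERIV_continuous_on has_field_derivative_at_within)
  ultimately show ?thesis
    unfolding tame_def using AB by (intro conjI exI[of _ "\<bar>F 0\<bar> + A"] exI[of _ "B + 1"]) auto
qed

text \<open>
Iterated antiderivatives of image systems are again image systems, which is how the second ramp
flow is built from the first.
\<close>

lemma tame_has_antiderivative:
  assumes "tame f"
  obtains F where "F 0 = 0" "\<And>s. (F has_real_derivative f s) (at s)" "tame F"
proof -
  have "\<exists>F. \<forall>x::real. - \<infinity> < ereal x \<longrightarrow> ereal x < \<infinity> \<longrightarrow> (F has_vector_derivative f x) (at x)"
    using assms by (intro einterval_antiderivative) (auto simp: tame_def continuous_on_eq_continuous_at)
  then obtain G where G: "\<And>x. (G has_real_derivative f x) (at x)"
    by (auto simp: has_real_derivative_iff_has_vector_derivative)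
  define F where "F s = G s - G 0" for s
  have "(F has_real_derivative f s) (at s)" for s
    unfolding F_def[abs_def] using G by (auto intro!: derivative_eq_intros)
  with tame_antiderivative[OF assms] show thesis by (intro that[of F]) (auto simp: F_def)
qed

lemma gauss_minus [simp]: "gauss (- z) = gauss z"
  by (simp add: std_normal_density_def)

lemma gavg_initial [simp]: "gavg gauss F x 0 = F x"
  by (simp add: gavg_def)

lemma gavg_sum:
  assumes "gaussian_weight w" "\<And>j. j \<in> J \<Longrightarrow> tame (F j)"
  shows "gavg w (\<lambda>s. \<Sum>j\<in>J. F j s) x t = (\<Sum>j\<in>J. gavg w (F j) x t)"
  unfolding gavg_def sum_distrib_left
  using assms by (intro Bochner_Integration.integral_sum gavg_integrable)

lemma gavg_reflect: "gavg gauss (\<lambda>s. F (l - s)) x t = gavg gauss F (l - x) t"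
  using lborel_integral_real_affine[of "-1" "\<lambda>z. gauss z * F (l - x + sqrt (2 * t) * z)" 0]
  by (simp add: gavg_def diff_diff_eq)

lemma gavg_reflect1: "gavg gauss1 (\<lambda>s. F (l - s)) x t = - gavg gauss1 F (l - x) t"
  using lborel_integral_real_affine[of "-1" "\<lambda>z. gauss1 z * F (l - x + sqrt (2 * t) * z)" 0]
  by (simp add: gavg_def diff_diff_eq gauss1_def)

text \<open>
The Gaussian is even, so at the origin the average only sees the even part \<open>G \<bar>s\<bar>\<close> of \<open>F\<close>.
\<close>

lemma gavg_even_part:
  assumes F: "tame F" and G: "tame (\<lambda>s. G \<bar>s\<bar>)" and FG: "\<And>s. 0 \<le> s \<Longrightarrow> F (- s) = 2 * G s - F s"
  shows "gavg gauss F 0 t = gavg gauss (\<lambda>s. G \<bar>s\<bar>) 0 t"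
proof -
  define c where "c = sqrt (2 * t)"
  have FG': "F s + F (0 - s) = 2 * G \<bar>s\<bar>" for s
    using FG[of s] FG[of "- s"] by (cases "0 \<le> s") auto
  have "2 * gavg gauss F 0 t = gavg gauss F 0 t + gavg gauss (\<lambda>s. F (0 - s)) 0 t"
    by (simp only: gavg_reflect) simp
  also have "\<dots> = (\<integral>z. gauss z * F (0 + c * z) + gauss z * F (0 - (0 + c * z)) \<partial>lborel)"
    unfolding gavg_def c_def[symmetric]
    by (intro Bochner_Integration.integral_add[symmetric] gavg_integrable[OF gaussian_weight_gauss F]
        gavg_integrable[OF gaussian_weight_gauss tame_reflect[OF F]])
  also have "\<dots> = (\<integral>z. gauss z * (2 * G \<bar>0 + c * z\<bar>) \<partial>lborel)"
    by (simp only: FG' distrib_left[symmetric])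
  also have "\<dots> = 2 * gavg gauss (\<lambda>s. G \<bar>s\<bar>) 0 t"
    by (simp add: gavg_def c_def mult.left_commute)
  finally show ?thesis by simp
qed

lemma gavg_gauss1_even:
  assumes "\<And>s. S (- s) = S s"
  shows "gavg gauss1 S 0 t = 0"
proof -
  have "(\<lambda>s. S (0 - s)) = S" using assms by auto
  with gavg_reflect1[of S 0 0 t] show ?thesis by simp
qed

lemma gavg_half_square:
  assumes "0 \<le> t"
  shows "gavg gauss (\<lambda>s. s\<^sup>2 / 2) 0 t = t"
proof -
  have "gavg gauss (\<lambda>s. s\<^sup>2 / 2) 0 t = t * (\<integral>z. gauss z * z ^ (2 * 1) \<partial>lborel)"
    using assms by (simp add: gavg_def power_mult_distrib mult.left_commute)
  also have "\<dots> = t"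
    unfolding integral_std_normal_moment_even by (simp add: fact_numeral)
  finally show ?thesis .
qed

text \<open>
If \<open>F\<close> is differentiable, the derivative may fall on \<open>F\<close>.  In contrast to \<open>DERIV_gavg_space\<close> this
version persists at \<open>t = 0\<close>.
\<close>

lemma DERIV_gavg_tame:
  assumes F: "tame F" and F': "tame F'" and deriv: "\<And>s. (F has_real_derivative F' s) (at s)"
  shows "((\<lambda>x. gavg gauss F x t) has_real_derivative gavg gauss F' x t) (at x)"
proof -
  define c where "c = sqrt (2 * t)"
  obtain C b where dom: "\<And>x' c' z. \<bar>x'\<bar> \<le> \<bar>x\<bar> + 1 \<Longrightarrow> \<bar>c'\<bar> \<le> \<bar>c\<bar> \<Longrightarrow> \<bar>gauss z * F' (x' + c' * z)\<bar> \<le> C * exp (- (1/4) * z\<^sup>2 + b * \<bar>z\<bar>)"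
    using gavg_dominated[OF gaussian_weight_gauss F', of "\<bar>x\<bar> + 1" "\<bar>c\<bar>"] by blast
  show ?thesis
    unfolding gavg_def c_def[symmetric]
  proof (rule has_real_derivative_integral_dominated[where d = 1 and g = "\<lambda>z. C * exp (- (1/4) * z\<^sup>2 + b * \<bar>z\<bar>)"])
    show "((\<lambda>x. gauss z * F (x + c * z)) has_real_derivative gauss z * F' (y + c * z)) (at y)" for y z
      by (intro DERIV_cmult DERIV_shift[THEN iffD1] deriv)
    show "integrable lborel (\<lambda>z. gauss z * F (y + c * z))" for y
      by (rule gavg_integrable[OF gaussian_weight_gauss F])
    show "(\<lambda>z. gauss z * F' (x + c * z)) \<in> borel_measurable lborel"
      using gavg_measurable[OF gaussian_weight_gauss F'] by simp
    show "\<bar>gauss z * F' (y + c * z)\<bar> \<le> C * exp (- (1/4) * z\<^sup>2 + b * \<bar>z\<bar>)" if "\<bar>y - x\<bar> < 1" for y z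
      using that by (intro dom) auto
    show "integrable lborel (\<lambda>z. C * exp (- (1/4) * z\<^sup>2 + b * \<bar>z\<bar>))"
      using integrable_exp_neg_square_plus_abs[of "1/4" b] by simp
  qed simp
qed

text \<open>
Both ways of differentiating must agree: for smooth \<open>F\<close>, the averages with differentiated weight
are averages of the derivatives of \<open>F\<close>.
\<close>

lemma gavg_gauss2_tame:
  assumes F: "tame F" and F': "tame F'" and F'': "tame F''" and t: "0 < t"
    and deriv: "\<And>s. (F has_real_derivative F' s) (at s)"
    and deriv': "\<And>s. (F' has_real_derivative F'' s) (at s)"
  shows "gavg gauss1 F x t / sqrt (2 * t) = gavg gauss F' x t"
    and "gavg gauss2 F x t / (2 * t) = gavg gauss F'' x t"
proof -
  have 1: "gavg gauss1 F x t / sqrt (2 * t) = gavg gauss F' x t" for x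
    using DERIV_unique[OF DERIV_gavg_space[OF gaussian_weight_gauss gaussian_weight_gauss1 DERIV_gauss F t]
        DERIV_gavg_tame[OF F F' deriv]] .
  then show "gavg gauss1 F x t / sqrt (2 * t) = gavg gauss F' x t" .
  have "((\<lambda>x. gavg gauss1 F x t / sqrt (2 * t)) has_real_derivative
      gavg gauss2 F x t / sqrt (2 * t) / sqrt (2 * t)) (at x)"
    by (intro DERIV_cdivide DERIV_gavg_space[OF gaussian_weight_gauss1 gaussian_weight_gauss2 DERIV_gauss1 F t])
  then have "((\<lambda>x. gavg gauss F' x t) has_real_derivative gavg gauss2 F x t / (2 * t)) (at x)"
    using t unfolding 1 by simp
  from DERIV_unique[OF this DERIV_gavg_tame[OF F' F'' deriv']]
  show "gavg gauss2 F x t / (2 * t) = gavg gauss F'' x t" .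
qed

section \<open>Coordinates on a network\<close>

text \<open>
The coordinate on edge \<open>j\<close> of the point at distance \<open>s\<close> from its end at vertex \<open>i\<close>.  Negative \<open>s\<close>
and \<open>s\<close> beyond the edge length are used as well, for functions extended to the whole line.
\<close>

definition out :: "('i, 'j, 'n::finite) net \<Rightarrow> 'i \<Rightarrow> 'j \<Rightarrow> real \<Rightarrow> real" where
  "out N i j s = (if param N j 0 = vertex N i then s else len N j - s)"

definition start_ix :: "('i, 'j, 'n::finite) net \<Rightarrow> 'j \<Rightarrow> 'i" where
  "start_ix N j = the_inv_into (verts N) (vertex N) (param N j 0)"

definition end_ix :: "('i, 'j, 'n::finite) net \<Rightarrow> 'j \<Rightarrow> 'i" where
  "end_ix N j = the_inv_into (verts N) (vertex N) (param N j (len N j))"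

lemma network_finite: "network N \<Longrightarrow> finite (verts N)" "network N \<Longrightarrow> finite (edges N)"
  by (auto simp: network_def)

lemma network_len: "network N \<Longrightarrow> j \<in> edges N \<Longrightarrow> 0 < len N j"
  by (auto simp: network_def)

lemma network_inj: "network N \<Longrightarrow> j \<in> edges N \<Longrightarrow> inj_on (param N j) {0..len N j}"
  by (auto simp: network_def)

lemma network_continuous:
  assumes "network N" "j \<in> edges N"
  shows "continuous_on {0..len N j} (param N j)"
proof -
  have "smooth_on {0..len N j} (param N j)" using assms by (auto simp: network_def)
  then have "\<forall>x\<in>{0..len N j}. iter_deriv {0..len N j} 0 (param N j) differentiable (at x within {0..len N j})"
    unfolding smooth_on_def by blast
  then show ?thesis
    by (auto simp: iter_deriv_def intro!: differentiable_imp_continuous_on simp: differentiable_on_def)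
qed

lemma network_ends:
  assumes "network N" "j \<in> edges N"
  shows "start_ix N j \<in> verts N" "vertex N (start_ix N j) = param N j 0"
    "end_ix N j \<in> verts N" "vertex N (end_ix N j) = param N j (len N j)"
  using assms unfolding network_def start_ix_def end_ix_def
  by (auto simp: f_the_inv_into_f the_inv_into_into)

lemma network_vertex_eq:
  "network N \<Longrightarrow> i \<in> verts N \<Longrightarrow> i' \<in> verts N \<Longrightarrow> vertex N i = vertex N i' \<longleftrightarrow> i = i'"
  unfolding network_def by (meson inj_on_eq_iff)

lemma network_ends_neq:
  assumes "network N" "j \<in> edges N"
  shows "param N j 0 \<noteq> param N j (len N j)" "start_ix N j \<noteq> end_ix N j"
proof -
  show 1: "param N j 0 \<noteq> param N j (len N j)"
    using inj_onD[OF network_inj[OF assms], of 0 "len N j"] network_len[OF assms] by auto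
  show "start_ix N j \<noteq> end_ix N j" using network_ends[OF assms] 1 by metis
qed

lemma network_vertex_param:
  assumes "network N" "j \<in> edges N" "i \<in> verts N" "y \<in> {0..len N j}" "param N j y = vertex N i"
  shows "y = 0 \<or> y = len N j"
proof (rule ccontr)
  assume "\<not> ?thesis"
  with assms have "y \<in> {0<..<len N j}" by auto
  with assms(5) have "vertex N i \<in> param N j ` {0<..<len N j}" by (metis imageI)
  with assms(1-3) show False unfolding network_def by blast
qed

lemma Inc_iff:
  assumes "network N" "i \<in> verts N"
  shows "j \<in> Inc N i \<longleftrightarrow> j \<in> edges N \<and> (i = start_ix N j \<or> i = end_ix N j)"
proof safe
  assume j: "j \<in> Inc N i"
  then show je: "j \<in> edges N" by (simp add: Inc_def)
  from j obtain y where y: "y \<in> {0..len N j}" "param N j y = vertex N i"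
    unfolding Inc_def edge_set_def by force
  assume "i \<noteq> end_ix N j"
  moreover from network_vertex_param[OF assms(1) je assms(2) y] have "y = 0 \<or> y = len N j" .
  ultimately show "i = start_ix N j"
    using network_ends[OF assms(1) je] y(2) assms network_vertex_eq[OF assms] by metis
next
  assume j: "j \<in> edges N"
  with network_ends[OF assms(1) this] network_len[OF assms(1) this]
  show "j \<in> Inc N (start_ix N j)" "j \<in> Inc N (end_ix N j)"
    by (auto simp: Inc_def edge_set_def)
qed

lemma Inc_edges: "j \<in> Inc N i \<Longrightarrow> j \<in> edges N"
  by (simp add: Inc_def)

lemma Inc_finite: "network N \<Longrightarrow> finite (Inc N i)"
  using network_finite(2)[of N] by (simp add: Inc_def)

lemma Inc_card_pos: "network N \<Longrightarrow> i \<in> verts N \<Longrightarrow> 0 < card (Inc N i)"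
  using Inc_finite[of N i] by (simp add: card_gt_0_iff) (simp add: network_def)

lemma out_start: "network N \<Longrightarrow> j \<in> edges N \<Longrightarrow> out N (start_ix N j) j s = s"
  by (simp add: out_def network_ends)

lemma out_end: "network N \<Longrightarrow> j \<in> edges N \<Longrightarrow> out N (end_ix N j) j s = len N j - s"
  using network_ends_neq(1)[of N j] by (simp add: out_def network_ends)

lemma orient_start: "network N \<Longrightarrow> j \<in> edges N \<Longrightarrow> orient N (start_ix N j) j = 1"
  using network_len[of N j] by (auto simp: orient_def network_ends edge_set_def)

lemma orient_end: "network N \<Longrightarrow> j \<in> edges N \<Longrightarrow> orient N (end_ix N j) j = -1"
  using network_ends_neq(1)[of N j] network_len[of N j] by (auto simp: orient_def network_ends edge_set_def)

text \<open>
An injective arc has two different end points, so an edge incident to \<open>i\<close> has exactly one of its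
ends there, and \<open>orient\<close> is the sign of \<open>out\<close>.
\<close>

lemma Inc_cases:
  assumes "network N" "i \<in> verts N" "j \<in> Inc N i"
  obtains "j \<in> edges N" "i = start_ix N j" "\<And>s. out N i j s = s" "orient N i j = 1"
    | "j \<in> edges N" "i = end_ix N j" "\<And>s. out N i j s = len N j - s" "orient N i j = -1"
  using assms Inc_iff[OF assms(1,2), of j] out_start out_end orient_start orient_end
  by metis

lemma param_out:
  assumes "network N" "i \<in> verts N" "j \<in> Inc N i"
  shows "param N j (out N i j 0) = vertex N i" "out N i j 0 \<in> {0..len N j}"
proof -
  have "param N j (out N i j 0) = vertex N i \<and> out N i j 0 \<in> {0..len N j}"
    using assms
  proof (cases rule: Inc_cases)
    case 1
    then show ?thesis using network_ends[OF assms(1) 1(1)] network_len[OF assms(1) 1(1)] by simp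
  next
    case 2
    then show ?thesis using network_ends[OF assms(1) 2(1)] network_len[OF assms(1) 2(1)] by simp
  qed
  then show "param N j (out N i j 0) = vertex N i" "out N i j 0 \<in> {0..len N j}" by auto
qed

lemma the_inv_param:
  assumes "network N" "i \<in> verts N" "j \<in> Inc N i"
  shows "the_inv_into {0..len N j} (param N j) (vertex N i) = out N i j 0"
  using the_inv_into_f_f[OF network_inj[OF assms(1) Inc_edges[OF assms(3)]] param_out(2)[OF assms]]
  by (simp add: param_out(1)[OF assms])

lemma points_edges:
  assumes "network N"
  shows "points N = (\<Union>j\<in>edges N. edge_set N j)"
proof -
  have "vertex N i \<in> (\<Union>j\<in>edges N. edge_set N j)" if "i \<in> verts N" for i
  proof -
    from Inc_card_pos[OF assms that] obtain j where "j \<in> Inc N i" by (metis card.empty ex_in_conv less_irrefl)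
    then show ?thesis by (auto simp: Inc_def)
  qed
  then show ?thesis unfolding points_def by auto
qed

lemma param_in_points: "network N \<Longrightarrow> j \<in> edges N \<Longrightarrow> y \<in> {0..len N j} \<Longrightarrow> param N j y \<in> points N"
  unfolding points_edges edge_set_def by blast

lemma pointsE:
  assumes "network N" "x \<in> points N"
  obtains j y where "j \<in> edges N" "y \<in> {0..len N j}" "x = param N j y"
  using assms by (auto simp: points_edges edge_set_def)

lemma vertex_in_points: "i \<in> verts N \<Longrightarrow> vertex N i \<in> points N"
  by (auto simp: points_def)

lemma compact_edge_set: "network N \<Longrightarrow> j \<in> edges N \<Longrightarrow> compact (edge_set N j)"
  unfolding edge_set_def by (intro compact_continuous_image network_continuous) auto

lemma compact_points: "network N \<Longrightarrow> compact (points N)"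
  unfolding points_edges using network_finite(2) compact_edge_set by (metis compact_UN)

text \<open>
The identifications made by the parametrizations: two edges only share vertices.
\<close>

lemma same_point:
  assumes N: "network N" and j: "j \<in> edges N" "y \<in> {0..len N j}" and j': "j' \<in> edges N" "y' \<in> {0..len N j'}"
    and eq: "param N j y = param N j' y'"
  obtains "j = j'" "y = y'" | i where "i \<in> verts N" "j \<in> Inc N i" "j' \<in> Inc N i" "y = out N i j 0" "y' = out N i j' 0"
proof (cases "j = j'")
  case True
  with eq j j' inj_onD[OF network_inj[OF N j(1)], of y y'] have "y = y'" by simp
  with True that show ?thesis by blast
next
  case False
  have "param N j y \<in> edge_set N j" "param N j' y' \<in> edge_set N j'"
    unfolding edge_set_def using j j' by (auto intro: imageI)
  then have "param N j y \<in> edge_set N j" "param N j y \<in> edge_set N j'" by (simp_all only: eq)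
  with False N j j' have "param N j y \<in> vertex N ` verts N" unfolding network_def by blast
  then obtain i where i: "i \<in> verts N" "param N j y = vertex N i" by auto
  have *: "k \<in> Inc N i \<and> z = out N i k 0" if "k \<in> edges N" "z \<in> {0..len N k}" "param N k z = vertex N i" for k z
  proof
    from that show k: "k \<in> Inc N i" unfolding Inc_def edge_set_def by force
    show "z = out N i k 0"
      using that param_out[OF N i(1) k] network_inj[OF N that(1)] by (metis inj_onD)
  qed
  from *[OF j i(2)] *[OF j'] eq i that show ?thesis by metis
qed

text \<open>
Each edge is counted once at either end.  This turns boundary terms of edge integrals into vertex
sums.
\<close>

lemma sum_vertices_eq_sum_edges:
  assumes N: "network N"
  shows "(\<Sum>i\<in>verts N. \<Sum>j\<in>Inc N i. h i j) = (\<Sum>j\<in>edges N. h (start_ix N j) j + h (end_ix N j) j)"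
proof -
  have "(\<Sum>i\<in>verts N. \<Sum>j\<in>Inc N i. h i j) = (\<Sum>i\<in>verts N. \<Sum>j | j \<in> edges N \<and> j \<in> Inc N i. h i j)"
    by (intro sum.cong refl) (auto simp: Inc_def)
  also have "\<dots> = (\<Sum>j\<in>edges N. \<Sum>i | i \<in> verts N \<and> j \<in> Inc N i. h i j)"
    using network_finite[OF N] by (rule sum.swap_restrict)
  also have "\<dots> = (\<Sum>j\<in>edges N. h (start_ix N j) j + h (end_ix N j) j)"
  proof (rule sum.cong[OF refl])
    fix j assume j: "j \<in> edges N"
    have "{i. i \<in> verts N \<and> j \<in> Inc N i} = {start_ix N j, end_ix N j}"
      using Inc_iff[OF N] j network_ends[OF N j] by auto
    then show "(\<Sum>i | i \<in> verts N \<and> j \<in> Inc N i. h i j) = h (start_ix N j) j + h (end_ix N j) j"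
      using network_ends_neq(2)[OF N j] by simp
  qed
  finally show ?thesis .
qed

text \<open>
Functions on the network are built edge by edge.  The choice of the representing parameter is
immaterial for families that agree at the vertices, as \<open>glue_param\<close> shows.
\<close>

definition glue :: "('i, 'j, 'n::finite) net \<Rightarrow> ('j \<Rightarrow> real \<Rightarrow> 'a) \<Rightarrow> real ^ 'n \<Rightarrow> 'a" where
  "glue N U x = (case (SOME (j, y). j \<in> edges N \<and> y \<in> {0..len N j} \<and> param N j y = x) of (j, y) \<Rightarrow> U j y)"

definition consistent :: "('i, 'j, 'n::finite) net \<Rightarrow> ('j \<Rightarrow> real \<Rightarrow> 'a) \<Rightarrow> bool" where
  "consistent N U \<longleftrightarrow> (\<forall>i\<in>verts N. \<exists>h. \<forall>j\<in>Inc N i. U j (out N i j 0) = h)"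

lemma glue_param:
  assumes N: "network N" and U: "consistent N U" and j: "j \<in> edges N" "y \<in> {0..len N j}"
  shows "glue N U (param N j y) = U j y"
proof -
  define P where "P = (\<lambda>(j', y'). j' \<in> edges N \<and> y' \<in> {0..len N j'} \<and> param N j' y' = param N j y)"
  obtain j' y' where jy: "(SOME p. P p) = (j', y')" by fastforce
  have "P (SOME p. P p)" by (rule someI[of P "(j, y)"]) (use j in \<open>auto simp: P_def\<close>)
  then have P: "j' \<in> edges N" "y' \<in> {0..len N j'}" "param N j' y' = param N j y"
    unfolding jy by (auto simp: P_def)
  have "glue N U (param N j y) = U j' y'"
    using jy unfolding glue_def P_def by simp
  also have "\<dots> = U j y"
    using same_point[OF N P(1,2) j P(3)]
  proof cases
    case (2 i)
    then show ?thesis using U unfolding consistent_def by metis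
  qed simp
  finally show ?thesis .
qed

text \<open>
The parametrized edges are finitely many compact pieces, and each parametrization is a
homeomorphism onto its piece.
\<close>

lemma continuous_on_points:
  fixes u :: "real ^ 'n::finite \<Rightarrow> 'b::metric_space \<Rightarrow> 'c::metric_space"
  assumes N: "network N" and S: "closed S"
    and cont: "\<And>j. j \<in> edges N \<Longrightarrow> continuous_on ({0..len N j} \<times> S) (\<lambda>(y, s). u (param N j y) s)"
  shows "continuous_on (points N \<times> S) (\<lambda>(x, s). u x s)"
proof -
  have "continuous_on (edge_set N j \<times> S) (\<lambda>(x, s). u x s)" if j: "j \<in> edges N" for j
  proof -
    define g where "g = the_inv_into {0..len N j} (param N j)"
    have g: "g (param N j y) = y" if "y \<in> {0..len N j}" for y
      unfolding g_def using the_inv_into_f_f[OF network_inj[OF N j] that] .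
    have contg: "continuous_on (edge_set N j) g"
      unfolding edge_set_def by (rule continuous_on_inv[OF network_continuous[OF N j]]) (auto simp: g)
    have "continuous_on (edge_set N j \<times> S) (\<lambda>p. (g (fst p), snd p))"
      by (intro continuous_intros continuous_on_compose2[OF contg]) auto
    moreover have "(\<lambda>p. (g (fst p), snd p)) ` (edge_set N j \<times> S) \<subseteq> {0..len N j} \<times> S"
      by (auto simp: edge_set_def g)
    ultimately have "continuous_on (edge_set N j \<times> S) (\<lambda>p. u (param N j (g (fst p))) (snd p))"
      using continuous_on_compose2[OF cont[OF j], of "edge_set N j \<times> S" "\<lambda>p. (g (fst p), snd p)"] by simp
    then show ?thesis
      by (rule continuous_on_eq) (auto simp: edge_set_def g)
  qed
  moreover have "points N \<times> S = (\<Union>j\<in>edges N. edge_set N j \<times> S)"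
    by (auto simp: points_edges[OF N])
  moreover have "closed (edge_set N j \<times> S)" if "j \<in> edges N" for j
    by (intro closed_Times compact_imp_closed compact_edge_set N that S)
  ultimately show ?thesis
    using network_finite(2)[OF N] by (simp add: continuous_on_closed_Union)
qed

lemma continuous_on_edge:
  assumes N: "network N" and j: "j \<in> edges N" and u: "continuous_on (points N \<times> S) (\<lambda>(x, s). u x s)"
  shows "continuous_on ({0..len N j} \<times> S) (\<lambda>(y, s). u (param N j y) s)"
proof -
  have "continuous_on ({0..len N j} \<times> S) (\<lambda>p. (param N j (fst p), snd p))"
    by (intro continuous_intros continuous_on_compose2[OF network_continuous[OF N j]]) auto
  moreover have "(\<lambda>p. (param N j (fst p), snd p)) ` ({0..len N j} \<times> S) \<subseteq> points N \<times> S"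
    using param_in_points[OF N j] by auto
  ultimately show ?thesis
    using continuous_on_compose2[OF u, of "{0..len N j} \<times> S" "\<lambda>p. (param N j (fst p), snd p)"]
    by (simp add: case_prod_beta)
qed

section \<open>The heat equation on a network and the maximum principle\<close>

text \<open>
A classical solution of \<open>\<partial>\<^sub>t u = \<epsilon> \<partial>\<^sub>x\<^sup>2 u\<close> with its space derivatives named explicitly, so that
they can be computed with directly.  The two signs \<open>\<epsilon> = 1\<close> and \<open>\<epsilon> = - 1\<close> are the forward and the
backward equation.  In contrast to the interior equation of the system, the equation is
demanded up to the ends of each edge; the maximum principle uses it there.
\<close>

definition heat_on ::
    "real \<Rightarrow> ('i, 'j, 'n::finite) net \<Rightarrow> real \<Rightarrow> (real ^ 'n \<Rightarrow> real \<Rightarrow> real) \<Rightarrow>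
     ('j \<Rightarrow> real \<Rightarrow> real \<Rightarrow> real) \<Rightarrow> ('j \<Rightarrow> real \<Rightarrow> real \<Rightarrow> real) \<Rightarrow> bool" where
  "heat_on \<epsilon> N Tm u ux uxx \<longleftrightarrow>
     continuous_on (points N \<times> {0..Tm}) (\<lambda>(x, s). u x s) \<and>
     (\<forall>j\<in>edges N.
        continuous_on ({0..len N j} \<times> {0<..<Tm}) (\<lambda>(y, s). ux j y s) \<and>
        continuous_on ({0..len N j} \<times> {0<..<Tm}) (\<lambda>(y, s). uxx j y s) \<and>
        (\<forall>s\<in>{0<..<Tm}. \<forall>y\<in>{0..len N j}.
           ((\<lambda>z. u (param N j z) s) has_real_derivative ux j y s) (at y within {0..len N j}) \<and>
           ((\<lambda>z. ux j z s) has_real_derivative uxx j y s) (at y within {0..len N j}) \<and>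
           ((\<lambda>r. u (param N j y) r) has_real_derivative \<epsilon> * uxx j y s) (at s))) \<and>
     (\<forall>i\<in>trans_ix N. \<forall>s\<in>{0<..<Tm}. (\<Sum>j\<in>Inc N i. orient N i j * ux j (out N i j 0) s) = 0)"

lemma iter_deriv_simps:
  "iter_deriv S 0 u = u"
  "iter_deriv S (Suc k) u = (\<lambda>x. vector_derivative (iter_deriv S k u) (at x within S))"
  by (simp_all add: iter_deriv_def)

lemma edge_deriv_simps:
  "edge_deriv N 0 j u = (\<lambda>z. u (param N j z))"
  "edge_deriv N (Suc k) j u = (\<lambda>y. vector_derivative (edge_deriv N k j u) (at y within {0..len N j}))"
  by (auto simp: edge_deriv_def[abs_def] iter_deriv_simps)

lemma trans_ix_verts: "i \<in> trans_ix N \<Longrightarrow> i \<in> verts N"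
  by (simp add: trans_ix_def)

text \<open>
The equation extends from the open edge to its end points since all derivatives in it are
continuous up to the ends.
\<close>

lemma classical_imp_heat_on:
  assumes N: "network N" and cl: "classical N Tm u" and ki: "kirchhoff N Tm u"
    and eq: "\<And>j y s. j \<in> edges N \<Longrightarrow> y \<in> {0<..<len N j} \<Longrightarrow> s \<in> {0<..<Tm} \<Longrightarrow>
      time_deriv N j u y s = \<epsilon> * edge_deriv N 2 j (\<lambda>x. u x s) y"
  shows "heat_on \<epsilon> N Tm u (\<lambda>j y s. edge_deriv N 1 j (\<lambda>x. u x s) y) (\<lambda>j y s. edge_deriv N 2 j (\<lambda>x. u x s) y)"
  unfolding heat_on_def
proof (intro conjI ballI)
  show "continuous_on (points N \<times> {0..Tm}) (\<lambda>(x, s). u x s)" using cl unfolding classical_def by blast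
next
  fix j assume j: "j \<in> edges N"
  show "continuous_on ({0..len N j} \<times> {0<..<Tm}) (\<lambda>(y, s). edge_deriv N 1 j (\<lambda>x. u x s) y)"
    "continuous_on ({0..len N j} \<times> {0<..<Tm}) (\<lambda>(y, s). edge_deriv N 2 j (\<lambda>x. u x s) y)"
    using cl j unfolding classical_def by blast+
next
  fix j s y assume j: "j \<in> edges N" and s: "s \<in> {0<..<Tm}" and y: "y \<in> {0..len N j}"
  have diff: "edge_deriv N k j (\<lambda>x. u x s) differentiable (at y within {0..len N j})" if "k < 2" for k
    using cl j s y that unfolding classical_def by blast
  show "((\<lambda>z. u (param N j z) s) has_real_derivative edge_deriv N 1 j (\<lambda>x. u x s) y) (at y within {0..len N j})"
    using diff[of 0]
    by (simp add: vector_derivative_works has_real_derivative_iff_has_vector_derivative edge_deriv_simps)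
  show "(edge_deriv N 1 j (\<lambda>x. u x s) has_real_derivative edge_deriv N 2 j (\<lambda>x. u x s) y) (at y within {0..len N j})"
    using diff[of 1]
    by (simp add: vector_derivative_works has_real_derivative_iff_has_vector_derivative edge_deriv_simps(2)[of N 1, unfolded Suc_1])
  have fd: "(\<lambda>r. u (param N j y) r) field_differentiable (at s)"
    using cl j s y unfolding classical_def by blast
  have ct: "continuous_on ({0..len N j} \<times> {0<..<Tm}) (\<lambda>(y, s). time_deriv N j u y s)"
    and cx: "continuous_on ({0..len N j} \<times> {0<..<Tm}) (\<lambda>(y, s). edge_deriv N 2 j (\<lambda>x. u x s) y)"
    using cl j unfolding classical_def by blast+
  have sec: "continuous_on {0..len N j} (\<lambda>y. f (y, s))" if "continuous_on ({0..len N j} \<times> {0<..<Tm}) f" for f :: "real \<times> real \<Rightarrow> real"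
    by (rule continuous_on_compose2[OF that]) (use s in \<open>auto intro!: continuous_intros\<close>)
  have cl: "closure {0<..<len N j} = {0..len N j}" using network_len[OF N j] by (simp add: closure_greaterThanLessThan)
  have "time_deriv N j u y s - \<epsilon> * edge_deriv N 2 j (\<lambda>x. u x s) y = 0"
  proof (rule continuous_constant_on_closure[where S = "{0<..<len N j}" and x = y
        and f = "\<lambda>y. time_deriv N j u y s - \<epsilon> * edge_deriv N 2 j (\<lambda>x. u x s) y"])
    show "continuous_on (closure {0<..<len N j}) (\<lambda>y. time_deriv N j u y s - \<epsilon> * edge_deriv N 2 j (\<lambda>x. u x s) y)"
      unfolding cl using sec[OF ct] sec[OF cx] by (auto intro!: continuous_intros)
  qed (use eq[OF j _ s] cl y in auto)
  with fd show "((\<lambda>r. u (param N j y) r) has_real_derivative \<epsilon> * edge_deriv N 2 j (\<lambda>x. u x s) y) (at s)"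
    by (simp add: time_deriv_def DERIV_deriv_iff_field_differentiable[symmetric])
next
  fix i s assume i: "i \<in> trans_ix N" and s: "s \<in> {0<..<Tm}"
  have "(\<Sum>j\<in>Inc N i. orient N i j * vertex_deriv N j (\<lambda>x. u x s) i) = 0"
    using ki i s unfolding kirchhoff_def by blast
  then show "(\<Sum>j\<in>Inc N i. orient N i j * edge_deriv N 1 j (\<lambda>x. u x s) (out N i j 0)) = 0"
    using the_inv_param[OF N trans_ix_verts[OF i]] by (simp add: vertex_deriv_def cong: sum.cong)
qed

lemma heat_onD:
  assumes "heat_on \<epsilon> N Tm u ux uxx"
  shows "continuous_on (points N \<times> {0..Tm}) (\<lambda>(x, s). u x s)"
    and "j \<in> edges N \<Longrightarrow> continuous_on ({0..len N j} \<times> {0<..<Tm}) (\<lambda>(y, s). ux j y s)"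
    and "j \<in> edges N \<Longrightarrow> continuous_on ({0..len N j} \<times> {0<..<Tm}) (\<lambda>(y, s). uxx j y s)"
    and "j \<in> edges N \<Longrightarrow> s \<in> {0<..<Tm} \<Longrightarrow> y \<in> {0..len N j} \<Longrightarrow>
      ((\<lambda>z. u (param N j z) s) has_real_derivative ux j y s) (at y within {0..len N j})"
    and "j \<in> edges N \<Longrightarrow> s \<in> {0<..<Tm} \<Longrightarrow> y \<in> {0..len N j} \<Longrightarrow>
      ((\<lambda>z. ux j z s) has_real_derivative uxx j y s) (at y within {0..len N j})"
    and "j \<in> edges N \<Longrightarrow> s \<in> {0<..<Tm} \<Longrightarrow> y \<in> {0..len N j} \<Longrightarrow>
      ((\<lambda>r. u (param N j y) r) has_real_derivative \<epsilon> * uxx j y s) (at s)"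
    and "i \<in> trans_ix N \<Longrightarrow> s \<in> {0<..<Tm} \<Longrightarrow> (\<Sum>j\<in>Inc N i. orient N i j * ux j (out N i j 0) s) = 0"
  using assms unfolding heat_on_def by blast+

lemma vector_derivative_edge:
  fixes f :: "real \<Rightarrow> real"
  assumes "0 < l" "y \<in> {0..l}" "(g has_real_derivative d) (at y within {0..l})" "\<And>z. z \<in> {0..l} \<Longrightarrow> f z = g z"
  shows "vector_derivative f (at y within {0..l}) = d" "f differentiable (at y within {0..l})"
proof -
  have "(f has_vector_derivative d) (at y within {0..l})"
    using assms by (auto simp: has_real_derivative_iff_has_vector_derivative intro: has_vector_derivative_transform)
  then show "vector_derivative f (at y within {0..l}) = d" "f differentiable (at y within {0..l})"
    using assms by (auto simp: vector_derivative_within_closed_interval intro: differentiableI_vector)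
qed

lemma heat_on_edge_deriv:
  assumes N: "network N" and u: "heat_on \<epsilon> N Tm u ux uxx"
    and j: "j \<in> edges N" and s: "s \<in> {0<..<Tm}" and y: "y \<in> {0..len N j}"
  shows "edge_deriv N 1 j (\<lambda>x. u x s) y = ux j y s"
    and "edge_deriv N 2 j (\<lambda>x. u x s) y = uxx j y s"
    and "k < 2 \<Longrightarrow> edge_deriv N k j (\<lambda>x. u x s) differentiable (at y within {0..len N j})"
proof -
  note l = network_len[OF N j]
  note d = heat_onD(4,5)[OF u j s]
  have 1: "edge_deriv N 1 j (\<lambda>x. u x s) z = ux j z s" if "z \<in> {0..len N j}" for z
    using vector_derivative_edge(1)[OF l that d(1)[OF that]] by (simp add: edge_deriv_simps)
  then show "edge_deriv N 1 j (\<lambda>x. u x s) y = ux j y s" using y .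
  note 2 = vector_derivative_edge[OF l y d(2)[OF y] 1]
  show "edge_deriv N 2 j (\<lambda>x. u x s) y = uxx j y s"
    using 2(1) by (simp add: edge_deriv_simps(2)[of N 1, unfolded Suc_1])
  assume "k < 2"
  then consider "k = 0" | "k = 1" by linarith
  then show "edge_deriv N k j (\<lambda>x. u x s) differentiable (at y within {0..len N j})"
  proof cases
    case 1
    then show ?thesis using vector_derivative_edge(2)[OF l y d(1)[OF y]] by (simp add: edge_deriv_simps)
  qed (use 2(2) in simp)
qed

lemma heat_on_imp_classical:
  assumes N: "network N" and u: "heat_on \<epsilon> N Tm u ux uxx"
  shows "classical N Tm u" "kirchhoff N Tm u"
    and "j \<in> edges N \<Longrightarrow> y \<in> {0..len N j} \<Longrightarrow> s \<in> {0<..<Tm} \<Longrightarrow>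
      time_deriv N j u y s = \<epsilon> * edge_deriv N 2 j (\<lambda>x. u x s) y"
proof -
  have t: "time_deriv N j u y s = \<epsilon> * edge_deriv N 2 j (\<lambda>x. u x s) y"
    if "j \<in> edges N" "y \<in> {0..len N j}" "s \<in> {0<..<Tm}" for j y s
    using DERIV_imp_deriv[OF heat_onD(6)[OF u that(1,3,2)]] heat_on_edge_deriv(2)[OF N u that(1,3,2)]
    by (simp add: time_deriv_def)
  then show "j \<in> edges N \<Longrightarrow> y \<in> {0..len N j} \<Longrightarrow> s \<in> {0<..<Tm} \<Longrightarrow>
      time_deriv N j u y s = \<epsilon> * edge_deriv N 2 j (\<lambda>x. u x s) y" .
  show "kirchhoff N Tm u"
    unfolding kirchhoff_def
  proof (intro ballI)
    fix i s assume i: "i \<in> trans_ix N" and s: "s \<in> {0<..<Tm}"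
    note iv = trans_ix_verts[OF i]
    have "vertex_deriv N j (\<lambda>x. u x s) i = ux j (out N i j 0) s" if "j \<in> Inc N i" for j
      unfolding vertex_deriv_def the_inv_param[OF N iv that]
      using heat_on_edge_deriv(1)[OF N u Inc_edges[OF that] s param_out(2)[OF N iv that]] .
    then show "(\<Sum>j\<in>Inc N i. orient N i j * vertex_deriv N j (\<lambda>x. u x s) i) = 0"
      using heat_onD(7)[OF u i s] by simp
  qed
  show "classical N Tm u"
    unfolding classical_def
  proof (intro conjI ballI allI impI)
    show "continuous_on (points N \<times> {0..Tm}) (\<lambda>(x, s). u x s)" by (rule heat_onD(1)[OF u])
  next
    fix j s y assume j: "j \<in> edges N" and s: "s \<in> {0<..<Tm}" and y: "y \<in> {0..len N j}"
    fix k :: nat assume "k < 2"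
    then show "edge_deriv N k j (\<lambda>x. u x s) differentiable (at y within {0..len N j})"
      by (rule heat_on_edge_deriv(3)[OF N u j s y])
  next
    fix j s y assume j: "j \<in> edges N" and s: "s \<in> {0<..<Tm}" and y: "y \<in> {0..len N j}"
    show "(\<lambda>r. u (param N j y) r) field_differentiable (at s)"
      using heat_onD(6)[OF u j s y] unfolding field_differentiable_def by blast
  next
    fix j and k :: nat assume j: "j \<in> edges N" and k: "k \<in> {1, 2}"
    have "continuous_on ({0..len N j} \<times> {0<..<Tm}) (\<lambda>(y, s). edge_deriv N 1 j (\<lambda>x. u x s) y)"
      by (rule continuous_on_eq[OF heat_onD(2)[OF u j]]) (use heat_on_edge_deriv(1)[OF N u j] in auto)
    moreover have "continuous_on ({0..len N j} \<times> {0<..<Tm}) (\<lambda>(y, s). edge_deriv N 2 j (\<lambda>x. u x s) y)"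
      by (rule continuous_on_eq[OF heat_onD(3)[OF u j]]) (use heat_on_edge_deriv(2)[OF N u j] in auto)
    ultimately show "continuous_on ({0..len N j} \<times> {0<..<Tm}) (\<lambda>(y, s). edge_deriv N k j (\<lambda>x. u x s) y)"
      using k by auto
  next
    fix j assume j: "j \<in> edges N"
    have "continuous_on ({0..len N j} \<times> {0<..<Tm}) (\<lambda>p. \<epsilon> * (\<lambda>(y, s). uxx j y s) p)"
      by (intro continuous_intros heat_onD(3)[OF u j])
    then show "continuous_on ({0..len N j} \<times> {0<..<Tm}) (\<lambda>(y, s). time_deriv N j u y s)"
      by (rule continuous_on_eq) (use t[OF j] heat_on_edge_deriv(2)[OF N u j] in auto)
  qed
qed

lemma heat_on_vertex_deriv:
  assumes N: "network N" and u: "heat_on \<epsilon> N Tm u ux uxx"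
    and i: "i \<in> verts N" "j \<in> Inc N i" and s: "s \<in> {0<..<Tm}"
  shows "vertex_deriv N j (\<lambda>x. u x s) i = ux j (out N i j 0) s"
  unfolding vertex_deriv_def the_inv_param[OF N i]
  using heat_on_edge_deriv(1)[OF N u Inc_edges[OF i(2)] s param_out(2)[OF N i]] .

lemma heat_on_lincomb:
  assumes u: "heat_on \<epsilon> N Tm u ux uxx" and v: "heat_on \<epsilon> N Tm v vx vxx"
  shows "heat_on \<epsilon> N Tm (\<lambda>x s. a * u x s + b * v x s) (\<lambda>j y s. a * ux j y s + b * vx j y s)
           (\<lambda>j y s. a * uxx j y s + b * vxx j y s)"
  unfolding heat_on_def
proof (intro conjI ballI)
  have lin: "continuous_on S (\<lambda>(x, s). a * f x s + b * g x s)"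
    if "continuous_on S (\<lambda>(x, s). f x s)" "continuous_on S (\<lambda>(x, s). g x s)"
    for S :: "('z::topological_space \<times> real) set" and f g :: "'z \<Rightarrow> real \<Rightarrow> real"
    using that unfolding case_prod_beta by (intro continuous_intros)
  show "continuous_on (points N \<times> {0..Tm}) (\<lambda>(x, s). a * u x s + b * v x s)"
    by (intro lin heat_onD(1)[OF u] heat_onD(1)[OF v])
  fix j assume j: "j \<in> edges N"
  show "continuous_on ({0..len N j} \<times> {0<..<Tm}) (\<lambda>(y, s). a * ux j y s + b * vx j y s)"
    by (intro lin heat_onD(2)[OF u j] heat_onD(2)[OF v j])
  show "continuous_on ({0..len N j} \<times> {0<..<Tm}) (\<lambda>(y, s). a * uxx j y s + b * vxx j y s)"
    by (intro lin heat_onD(3)[OF u j] heat_onD(3)[OF v j])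
  fix s y assume s: "s \<in> {0<..<Tm}" and y: "y \<in> {0..len N j}"
  show "((\<lambda>z. a * u (param N j z) s + b * v (param N j z) s) has_real_derivative a * ux j y s + b * vx j y s) (at y within {0..len N j})"
    by (intro DERIV_add DERIV_cmult heat_onD(4)[OF u j s y] heat_onD(4)[OF v j s y])
  show "((\<lambda>z. a * ux j z s + b * vx j z s) has_real_derivative a * uxx j y s + b * vxx j y s) (at y within {0..len N j})"
    by (intro DERIV_add DERIV_cmult heat_onD(5)[OF u j s y] heat_onD(5)[OF v j s y])
  have "((\<lambda>r. a * u (param N j y) r + b * v (param N j y) r) has_real_derivative a * (\<epsilon> * uxx j y s) + b * (\<epsilon> * vxx j y s)) (at s)"
    by (intro DERIV_add DERIV_cmult heat_onD(6)[OF u j s y] heat_onD(6)[OF v j s y])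
  then show "((\<lambda>r. a * u (param N j y) r + b * v (param N j y) r) has_real_derivative \<epsilon> * (a * uxx j y s + b * vxx j y s)) (at s)"
    by (simp add: algebra_simps)
next
  fix i s assume i: "i \<in> trans_ix N" and s: "s \<in> {0<..<Tm}"
  have "(\<Sum>j\<in>Inc N i. orient N i j * (a * ux j (out N i j 0) s + b * vx j (out N i j 0) s))
      = a * (\<Sum>j\<in>Inc N i. orient N i j * ux j (out N i j 0) s) + b * (\<Sum>j\<in>Inc N i. orient N i j * vx j (out N i j 0) s)"
    by (simp add: sum_distrib_left sum.distrib[symmetric] algebra_simps)
  then show "(\<Sum>j\<in>Inc N i. orient N i j * (a * ux j (out N i j 0) s + b * vx j (out N i j 0) s)) = 0"
    using heat_onD(7)[OF u i s] heat_onD(7)[OF v i s] by simp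
qed

lemma heat_on_reverse:
  assumes u: "heat_on \<epsilon> N Tm u ux uxx"
  shows "heat_on (- \<epsilon>) N Tm (\<lambda>x s. u x (Tm - s)) (\<lambda>j y s. ux j y (Tm - s)) (\<lambda>j y s. uxx j y (Tm - s))"
  unfolding heat_on_def
proof (intro conjI ballI)
  have rev: "continuous_on (A \<times> S) (\<lambda>(x, s). f x (Tm - s))"
    if "continuous_on (A \<times> S) (\<lambda>(x, s). f x s)" "\<And>s. s \<in> S \<Longrightarrow> Tm - s \<in> S"
    for A :: "'z::topological_space set" and S and f :: "'z \<Rightarrow> real \<Rightarrow> real"
    using continuous_on_compose2[OF that(1), of "A \<times> S" "\<lambda>p. (fst p, Tm - snd p)"] that(2)
    by (force simp: case_prod_beta intro!: continuous_intros)
  show "continuous_on (points N \<times> {0..Tm}) (\<lambda>(x, s). u x (Tm - s))"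
    by (rule rev[OF heat_onD(1)[OF u]]) auto
  fix j assume j: "j \<in> edges N"
  show "continuous_on ({0..len N j} \<times> {0<..<Tm}) (\<lambda>(y, s). ux j y (Tm - s))"
    by (rule rev[OF heat_onD(2)[OF u j]]) auto
  show "continuous_on ({0..len N j} \<times> {0<..<Tm}) (\<lambda>(y, s). uxx j y (Tm - s))"
    by (rule rev[OF heat_onD(3)[OF u j]]) auto
  fix s y assume s: "s \<in> {0<..<Tm}" and y: "y \<in> {0..len N j}"
  have s': "Tm - s \<in> {0<..<Tm}" using s by auto
  show "((\<lambda>z. u (param N j z) (Tm - s)) has_real_derivative ux j y (Tm - s)) (at y within {0..len N j})"
    by (rule heat_onD(4)[OF u j s' y])
  show "((\<lambda>z. ux j z (Tm - s)) has_real_derivative uxx j y (Tm - s)) (at y within {0..len N j})"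
    by (rule heat_onD(5)[OF u j s' y])
  have "((\<lambda>r. u (param N j y) (Tm - r)) has_real_derivative (\<epsilon> * uxx j y (Tm - s)) * (- 1)) (at s)"
    by (rule DERIV_chain2[where g = "\<lambda>r. Tm - r", OF heat_onD(6)[OF u j s' y]]) (auto intro!: derivative_eq_intros)
  then show "((\<lambda>r. u (param N j y) (Tm - r)) has_real_derivative - \<epsilon> * uxx j y (Tm - s)) (at s)"
    by simp
next
  fix i s assume "i \<in> trans_ix N" "s \<in> {0<..<Tm}"
  then show "(\<Sum>j\<in>Inc N i. orient N i j * ux j (out N i j 0) (Tm - s)) = 0"
    by (intro heat_onD(7)[OF u]) auto
qed

text \<open>
The one-sided first-order conditions at a maximum; at an end point only one of them applies.
\<close>

lemma deriv_at_interval_max: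
  fixes f :: "real \<Rightarrow> real"
  assumes y: "y \<in> {0..l}" and max: "\<And>z. z \<in> {0..l} \<Longrightarrow> f z \<le> f y"
    and deriv: "(f has_real_derivative d) (at y within {0..l})"
  shows "y < l \<Longrightarrow> d \<le> 0" "0 < y \<Longrightarrow> 0 \<le> d"
proof -
  assume l: "y < l"
  show "d \<le> 0"
  proof (rule ccontr)
    assume "\<not> d \<le> 0"
    then obtain e where e: "0 < e" "\<And>h. 0 < h \<Longrightarrow> y + h \<in> {0..l} \<Longrightarrow> h < e \<Longrightarrow> f y < f (y + h)"
      using has_real_derivative_pos_inc_right[OF deriv] by auto
    define h where "h = min (e / 2) (l - y)"
    have "0 < h" "h < e" "y + h \<in> {0..l}" using e l y by (auto simp: h_def)
    with e(2) max show False by fastforce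
  qed
next
  assume l: "0 < y"
  show "0 \<le> d"
  proof (rule ccontr)
    assume "\<not> 0 \<le> d"
    then obtain e where e: "0 < e" "\<And>h. 0 < h \<Longrightarrow> y - h \<in> {0..l} \<Longrightarrow> h < e \<Longrightarrow> f y < f (y - h)"
      using has_real_derivative_neg_dec_left[OF deriv] by auto
    define h where "h = min (e / 2) y"
    have "0 < h" "h < e" "y - h \<in> {0..l}" using e l y by (auto simp: h_def)
    with e(2) max show False by fastforce
  qed
qed

text \<open>
A vanishing first derivative makes the second-order condition valid even when the maximum is at
an end point: otherwise \<open>f\<close> would increase away from \<open>y\<close>.
\<close>

lemma second_deriv_at_interval_max:
  fixes f f' :: "real \<Rightarrow> real"
  assumes l: "0 < l" and y: "y \<in> {0..l}" and max: "\<And>z. z \<in> {0..l} \<Longrightarrow> f z \<le> f y"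
    and deriv: "\<And>z. z \<in> {0..l} \<Longrightarrow> (f has_real_derivative f' z) (at z within {0..l})"
    and deriv2: "(f' has_real_derivative d) (at y within {0..l})" and zero: "f' y = 0"
  shows "d \<le> 0"
proof (rule ccontr)
  assume d: "\<not> d \<le> 0"
  have mvt: "\<exists>z. a < z \<and> z < b \<and> f b - f a = f' z * (b - a)" if "a < b" "{a..b} \<subseteq> {0..l}" for a b
  proof -
    have "(f has_derivative (*) (f' z)) (at z within {a..b})" if "a \<le> z" "z \<le> b" for z
      using deriv[of z] that \<open>{a..b} \<subseteq> {0..l}\<close>
      by (auto simp: has_field_derivative_def intro: has_derivative_subset)
    from mvt_simple[OF \<open>a < b\<close> this] show ?thesis by auto
  qed
  show False
  proof (cases "y < l")
    case True
    obtain e where e: "0 < e" "\<And>h. 0 < h \<Longrightarrow> y + h \<in> {0..l} \<Longrightarrow> h < e \<Longrightarrow> f' y < f' (y + h)"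
      using has_real_derivative_pos_inc_right[OF deriv2] d by auto
    \<comment> \<open>To the right of \<open>y\<close> the derivative is positive, so \<open>f\<close> exceeds its maximum.\<close>
    define h where "h = min (e / 2) (l - y)"
    have h: "0 < h" "h < e" "{y..y + h} \<subseteq> {0..l}" using e True y by (auto simp: h_def)
    obtain z where z: "y < z" "z < y + h" "f (y + h) - f y = f' z * h"
      using mvt[of y "y + h"] h by auto
    have "z \<in> {y..y+h}" using z by simp
    then have "f' y < f' z" using e(2)[of "z - y"] z h by (auto dest: subsetD)
    then have "f y < f (y + h)" using z(3) zero h by (smt (verit) mult_pos_pos)
    with max[of "y + h"] h show False by auto
  next
    case False
    obtain e where e: "0 < e" "\<And>h. 0 < h \<Longrightarrow> y - h \<in> {0..l} \<Longrightarrow> h < e \<Longrightarrow> f' (y - h) < f' y"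
      using has_real_derivative_pos_inc_left[OF deriv2] d by auto
    define h where "h = min (e / 2) y"
    have h: "0 < h" "h < e" "{y - h..y} \<subseteq> {0..l}" using e False l y by (auto simp: h_def)
    obtain z where z: "y - h < z" "z < y" "f y - f (y - h) = f' z * h"
      using mvt[of "y - h" y] h by auto
    have "z \<in> {y-h..y}" using z by simp
    then have "f' z < f' y" using e(2)[of "y - z"] z h by (auto dest: subsetD)
    then have "f y < f (y - h)" using z(3) zero h by (smt (verit) mult_neg_pos)
    with max[of "y - h"] h show False by auto
  qed
qed

text \<open>
If \<open>w\<close> exceeded \<open>M\<close>, so would \<open>w - \<epsilon> * s\<close> for a small \<open>\<epsilon>\<close>.  At the maximum of the latter, \<open>w\<close> is
maximal in space, hence its time derivative is not positive, whereas maximality in time forces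
it to be at least \<open>\<epsilon>\<close>.  Formulating the equation as a property of spatial maxima allows the
same argument on the network and on an interval.
\<close>

lemma parabolic_maximum_principle:
  fixes w :: "'a::metric_space \<Rightarrow> real \<Rightarrow> real"
  assumes K: "compact K" and Tm: "0 < Tm"
    and cont: "continuous_on (K \<times> {0..Tm}) (\<lambda>(x, s). w x s)"
    and init: "\<And>x. x \<in> K \<Longrightarrow> w x 0 \<le> M"
    and step: "\<And>x s. x \<in> K \<Longrightarrow> 0 < s \<Longrightarrow> s < Tm \<Longrightarrow> M < w x s \<Longrightarrow> (\<And>z. z \<in> K \<Longrightarrow> w z s \<le> w x s) \<Longrightarrow>
      \<exists>d\<le>0. (w x has_real_derivative d) (at s)"
    and x: "x \<in> K" and s: "s \<in> {0..Tm}"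
  shows "w x s \<le> M"
proof -
  have open_case: "w x s \<le> M" if s: "s \<in> {0..<Tm}" for s
  proof (rule ccontr)
    assume "\<not> w x s \<le> M"
    then have M: "M < w x s" by simp
    with init[OF x] s have "0 < s" by (cases "s = 0") auto
    \<comment> \<open>This choice keeps half of the excess of \<open>w\<close> over \<open>M\<close> at time \<open>s\<close>.\<close>
    define \<epsilon> where "\<epsilon> = (w x s - M) / (2 * s)"
    have \<epsilon>: "0 < \<epsilon>" "M < w x s - \<epsilon> * s" using M \<open>0 < s\<close> by (auto simp: \<epsilon>_def field_simps)
    have "continuous_on (K \<times> {0..s}) (\<lambda>p. (\<lambda>(x, s). w x s) p - \<epsilon> * snd p)"
      by (intro continuous_intros continuous_on_subset[OF cont]) (use s in auto)
    then have "\<exists>p\<in>K \<times> {0..s}. \<forall>q\<in>K \<times> {0..s}.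
        (\<lambda>(x, s). w x s) q - \<epsilon> * snd q \<le> (\<lambda>(x, s). w x s) p - \<epsilon> * snd p"
      by (rule continuous_attains_sup[rotated 2]) (use K x \<open>0 < s\<close> in \<open>auto simp: compact_Times\<close>)
    then obtain p where p: "p \<in> K \<times> {0..s}"
      and pmax: "\<And>q. q \<in> K \<times> {0..s} \<Longrightarrow> (\<lambda>(x, s). w x s) q - \<epsilon> * snd q \<le> (\<lambda>(x, s). w x s) p - \<epsilon> * snd p"
      by blast
    obtain x1 s1 where p1: "p = (x1, s1)" by fastforce
    have x1: "x1 \<in> K" "0 \<le> s1" "s1 \<le> s" using p p1 by auto
    have max: "w z r - \<epsilon> * r \<le> w x1 s1 - \<epsilon> * s1" if "z \<in> K" "0 \<le> r" "r \<le> s" for z r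
      using pmax[of "(z, r)"] p1 that by simp
    have gt: "M < w x1 s1 - \<epsilon> * s1" using max[OF x, of s] \<epsilon> \<open>0 < s\<close> by simp
    with init[OF x1(1)] x1 have s1: "0 < s1" by (cases "s1 = 0") auto
    have "M < w x1 s1" using gt mult_nonneg_nonneg[of \<epsilon> s1] \<epsilon> s1 by linarith
    with step[OF x1(1) s1] x1 s max[of _ s1] obtain d where d: "d \<le> 0" "(w x1 has_real_derivative d) (at s1)"
      by force
    have "((\<lambda>r. w x1 r - \<epsilon> * r) has_real_derivative d - \<epsilon>) (at s1)"
      using d(2) by (auto intro!: derivative_eq_intros)
    from DERIV_neg_dec_left[OF this] d(1) \<epsilon>(1) obtain e where e: "0 < e"
      "\<And>h. 0 < h \<Longrightarrow> h < e \<Longrightarrow> w x1 s1 - \<epsilon> * s1 < w x1 (s1 - h) - \<epsilon> * (s1 - h)" by auto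
    define h where "h = min (e / 2) s1"
    have h: "0 < h" "h < e" "h \<le> s1" using e s1 by (auto simp: h_def)
    from e(2)[OF h(1,2)] max[OF x1(1), of "s1 - h"] h x1 show False by simp
  qed
  have "continuous_on {0..Tm} (w x)"
  proof -
    have "continuous_on {0..Tm} (\<lambda>s. (\<lambda>(x, s). w x s) (x, s))"
      by (rule continuous_on_compose2[OF cont]) (use x in \<open>auto intro!: continuous_intros\<close>)
    then show ?thesis by simp
  qed
  then have "continuous_on (closure {0..<Tm}) (w x)" using Tm by simp
  then show ?thesis
    by (rule continuous_le_on_closure) (use open_case s Tm in auto)
qed

text \<open>
At a maximum in a transition vertex all outward derivatives are at most zero, and they sum to zero
by the Kirchhoff condition.  So they vanish, and the second derivative along any incident edge
is at most zero, exactly as at an interior point.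
\<close>

lemma heat_on_maximum:
  assumes N: "network N" and Tm: "0 < Tm" and u: "heat_on 1 N Tm u ux uxx"
    and init: "\<And>x. x \<in> points N \<Longrightarrow> u x 0 \<le> M"
    and bdry: "\<And>i s. i \<in> bdry_ix N \<Longrightarrow> s \<in> {0..Tm} \<Longrightarrow> u (vertex N i) s \<le> M"
    and x: "x \<in> points N" and s: "s \<in> {0..Tm}"
  shows "u x s \<le> M"
proof (rule parabolic_maximum_principle[OF compact_points[OF N] Tm heat_onD(1)[OF u] init _ x s])
  fix x s
  assume x: "x \<in> points N" and s0: "0 < s" "s < Tm" and gt: "M < u x s"
    and max: "\<And>z. z \<in> points N \<Longrightarrow> u z s \<le> u x s"
  have s: "s \<in> {0<..<Tm}" using s0 by simp
  have key: "\<exists>d\<le>0. (u x has_real_derivative d) (at s)"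
    if j: "j \<in> edges N" "y \<in> {0..len N j}" "x = param N j y" "ux j y s = 0" for j y
  proof -
    have "uxx j y s \<le> 0"
      by (rule second_deriv_at_interval_max[OF network_len[OF N j(1)] j(2) _ heat_onD(4)[OF u j(1) s] heat_onD(5)[OF u j(1) s j(2)] j(4)])
         (use max param_in_points[OF N j(1)] j(3) in auto)
    then show ?thesis using heat_onD(6)[OF u j(1) s j(2)] j(3) by auto
  qed
  show "\<exists>d\<le>0. (u x has_real_derivative d) (at s)"
  proof (cases "x \<in> vertex N ` verts N")
    case True
    then obtain i where i: "i \<in> verts N" "x = vertex N i" by auto
    with bdry[of i s] gt s have "i \<notin> bdry_ix N" by auto
    with i have it: "i \<in> trans_ix N" by (simp add: trans_ix_def)
    have le: "orient N i j * ux j (out N i j 0) s \<le> 0" if j: "j \<in> Inc N i" for j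
    proof -
      note po = param_out[OF N i(1) j]
      have je: "j \<in> edges N" using j by (simp add: Inc_def)
      have m: "\<And>z. z \<in> {0..len N j} \<Longrightarrow> u (param N j z) s \<le> u (param N j (out N i j 0)) s"
        using max param_in_points[OF N je] i po by simp
      note dm = deriv_at_interval_max[OF po(2) m heat_onD(4)[OF u je s po(2)]]
      from N i(1) j show ?thesis
        by (cases rule: Inc_cases) (use dm network_len[OF N je] in auto)
    qed
    have "\<forall>j\<in>Inc N i. orient N i j * ux j (out N i j 0) s = 0"
      using sum_nonneg_eq_0_iff[OF Inc_finite[OF N], of i "\<lambda>j. - (orient N i j * ux j (out N i j 0) s)"] le
        heat_onD(7)[OF u it s] by (simp add: sum_negf)
    moreover obtain j where j: "j \<in> Inc N i"
      using Inc_card_pos[OF N i(1)] by (metis card.empty ex_in_conv less_irrefl)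
    moreover have "orient N i j \<noteq> 0" using N i(1) j by (cases rule: Inc_cases) auto
    ultimately show ?thesis
      using key[OF Inc_edges[OF j] param_out(2)[OF N i(1) j]] param_out(1)[OF N i(1) j] i by auto
  next
    case False
    from N x obtain j y where j: "j \<in> edges N" "y \<in> {0..len N j}" "x = param N j y" by (rule pointsE)
    have "param N j 0 \<in> vertex N ` verts N" "param N j (len N j) \<in> vertex N ` verts N"
      using N j(1) unfolding network_def by blast+
    with False j have y: "0 < y" "y < len N j" by (auto simp: less_le)
    have "\<And>z. z \<in> {0..len N j} \<Longrightarrow> u (param N j z) s \<le> u (param N j y) s"
      using max param_in_points[OF N j(1)] j by simp
    from deriv_at_interval_max[OF j(2) this heat_onD(4)[OF u j(1) s j(2)]] y
    have "ux j y s = 0" by force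
    then show ?thesis by (rule key[OF j])
  qed
qed

section \<open>Unfolding a network into its images\<close>

text \<open>
The even part of the extensions at vertex \<open>i\<close>: their mean over the incident edges, or the
prescribed function \<open>\<beta>\<close> at the vertex \<open>i0\<close>.
\<close>

definition vmean :: "('i, 'j, 'n::finite) net \<Rightarrow> 'i \<Rightarrow> (real \<Rightarrow> real) \<Rightarrow> ('j \<Rightarrow> real \<Rightarrow> real) \<Rightarrow> 'i \<Rightarrow> real \<Rightarrow> real" where
  "vmean N i0 \<beta> F i s = (if i = i0 then \<beta> s else (\<Sum>j\<in>Inc N i. F j (out N i j s)) / card (Inc N i))"

text \<open>
A system of extensions \<open>F j\<close> of the function \<open>f\<close> from the edges to the line that obeys the
reflection law at every end of every edge.
\<close>

definition images :: "('i, 'j, 'n::finite) net \<Rightarrow> 'i \<Rightarrow> (real \<Rightarrow> real) \<Rightarrow> (real ^ 'n \<Rightarrow> real) \<Rightarrow> ('j \<Rightarrow> real \<Rightarrow> real) \<Rightarrow> bool" where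
  "images N i0 \<beta> f F \<longleftrightarrow>
     (\<forall>j\<in>edges N. tame (F j)) \<and>
     (\<forall>j\<in>edges N. \<forall>y\<in>{0..len N j}. F j y = f (param N j y)) \<and>
     (\<forall>i\<in>verts N. \<forall>j\<in>Inc N i. \<forall>s\<ge>0. F j (out N i j (- s)) = 2 * vmean N i0 \<beta> F i s - F j (out N i j s))"

text \<open>
The compatibility \<open>\<beta> 0 = f (vertex N i0)\<close> makes the extensions continuous at \<open>i0\<close>; at the other
vertices the continuity of \<open>f\<close> does.
\<close>

definition image_data :: "('i, 'j, 'n::finite) net \<Rightarrow> 'i \<Rightarrow> (real \<Rightarrow> real) \<Rightarrow> (real ^ 'n \<Rightarrow> real) \<Rightarrow> bool" where
  "image_data N i0 \<beta> f \<longleftrightarrow> network N \<and> i0 \<in> verts N \<and> continuous_on (points N) f \<and>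
     continuous_on UNIV \<beta> \<and> \<beta> 0 = f (vertex N i0)"

text \<open>
Stage \<open>n\<close> is correct up to distance \<open>n * L\<close> from the edge, where \<open>L\<close> bounds the edge lengths from
below.  The next stage applies the reflection law at both ends.  Writing it as a sum with
truncated arguments, in which the brackets vanish where they do not apply, makes continuity
immediate.
\<close>

primrec unfolding_stage ::
    "('i, 'j, 'n::finite) net \<Rightarrow> 'i \<Rightarrow> (real \<Rightarrow> real) \<Rightarrow> (real ^ 'n \<Rightarrow> real) \<Rightarrow> nat \<Rightarrow> 'j \<Rightarrow> real \<Rightarrow> real" where
  "unfolding_stage N i0 \<beta> f 0 = (\<lambda>j s. f (param N j (max 0 (min s (len N j)))))"
| "unfolding_stage N i0 \<beta> f (Suc n) = (\<lambda>j s. let G = unfolding_stage N i0 \<beta> f n in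
     G j (max 0 (min s (len N j)))
     + (2 * vmean N i0 \<beta> G (start_ix N j) (max 0 (- s)) - G j (max 0 (- s)) - G j 0)
     + (2 * vmean N i0 \<beta> G (end_ix N j) (max 0 (s - len N j)) - G j (len N j - max 0 (s - len N j)) - G j (len N j)))"

lemma vmean_cong:
  "(\<And>j. j \<in> Inc N i \<Longrightarrow> F j (out N i j s) = G j (out N i j s)) \<Longrightarrow> vmean N i0 \<beta> F i s = vmean N i0 \<beta> G i s"
  by (simp add: vmean_def)

lemma vmean_0:
  assumes D: "image_data N i0 \<beta> f" and i: "i \<in> verts N"
    and F: "\<And>j y. j \<in> edges N \<Longrightarrow> y \<in> {0..len N j} \<Longrightarrow> F j y = f (param N j y)"
  shows "vmean N i0 \<beta> F i 0 = f (vertex N i)"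
proof -
  have N: "network N" using D by (simp add: image_data_def)
  have "F j (out N i j 0) = f (vertex N i)" if "j \<in> Inc N i" for j
    using F[OF Inc_edges[OF that] param_out(2)[OF N i that]] param_out(1)[OF N i that] by simp
  then show ?thesis
    using D Inc_card_pos[OF N i] by (simp add: vmean_def image_data_def)
qed

lemma unfolding_stage_inside:
  assumes D: "image_data N i0 \<beta> f" and j: "j \<in> edges N" "y \<in> {0..len N j}"
  shows "unfolding_stage N i0 \<beta> f n j y = f (param N j y)"
  using j
proof (induction n arbitrary: j y)
  case (Suc n)
  have N: "network N" using D by (simp add: image_data_def)
  note e = network_ends[OF N Suc.prems(1)]
  have vm: "vmean N i0 \<beta> (unfolding_stage N i0 \<beta> f n) i 0 = f (vertex N i)" if "i \<in> verts N" for i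
    using vmean_0[OF D that Suc.IH] by simp
  have "0 < len N j" using network_len[OF N Suc.prems(1)] .
  then show ?case
    using Suc.prems Suc.IH[OF Suc.prems(1), of 0] Suc.IH[OF Suc.prems(1), of "len N j"] Suc.IH[OF Suc.prems]
    by (simp add: Let_def vm[OF e(1)] vm[OF e(3)] e(2,4))
qed simp

lemma unfolding_stage_reflect:
  assumes D: "image_data N i0 \<beta> f" and i: "i \<in> verts N" "j \<in> Inc N i" and s: "0 \<le> s"
  shows "unfolding_stage N i0 \<beta> f (Suc n) j (out N i j (- s))
     = 2 * vmean N i0 \<beta> (unfolding_stage N i0 \<beta> f n) i s - unfolding_stage N i0 \<beta> f n j (out N i j s)"
proof -
  have N: "network N" using D by (simp add: image_data_def)
  have je: "j \<in> edges N" using i by (simp add: Inc_def)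
  note l = network_len[OF N je] and e = network_ends[OF N je]
  note ins = unfolding_stage_inside[OF D je]
  have vm: "vmean N i0 \<beta> (unfolding_stage N i0 \<beta> f n) i 0 = f (vertex N i)" if "i \<in> verts N" for i
    using vmean_0[OF D that unfolding_stage_inside[OF D]] by simp
  from N i show ?thesis
  proof (cases rule: Inc_cases)
    case 1
    then show ?thesis using s l ins[of 0 n] ins[of "len N j" n]
      by (simp add: Let_def vm[OF e(1)] vm[OF e(3)] e(2,4) min_def max_def)
  next
    case 2
    then show ?thesis using s l ins[of 0 n] ins[of "len N j" n]
      by (simp add: Let_def vm[OF e(1)] vm[OF e(3)] e(2,4) min_def max_def)
  qed
qed

lemma continuous_on_vmean:
  assumes F: "\<And>j. j \<in> edges N \<Longrightarrow> continuous_on UNIV (F j)" and \<beta>: "continuous_on UNIV \<beta>" and g: "continuous_on S g"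
  shows "continuous_on S (\<lambda>s. vmean N i0 \<beta> F i (g s))"
proof (cases "i = i0")
  case True
  then show ?thesis using continuous_on_compose2[OF \<beta> g] by (simp add: vmean_def)
next
  case False
  have out: "continuous_on S (\<lambda>s. out N i j (g s))" for j
    by (cases "param N j 0 = vertex N i"; simp add: out_def continuous_on_diff g)
  have "continuous_on S (\<lambda>s. F j (out N i j (g s)))" if "j \<in> Inc N i" for j
    by (rule continuous_on_compose2[OF F[OF Inc_edges[OF that]] out]) simp
  then show ?thesis using False by (auto simp: vmean_def divide_inverse intro!: continuous_intros)
qed

lemma continuous_on_unfolding_stage:
  assumes D: "image_data N i0 \<beta> f" and j: "j \<in> edges N"
  shows "continuous_on UNIV (unfolding_stage N i0 \<beta> f n j)"
  using j
proof (induction n arbitrary: j)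
  case 0
  have N: "network N" using D by (simp add: image_data_def)
  have "continuous_on UNIV (\<lambda>s. f (param N j (max 0 (min s (len N j)))))"
  proof (rule continuous_on_compose2[of "points N" f])
    show "continuous_on UNIV (\<lambda>s. param N j (max 0 (min s (len N j))))"
      by (rule continuous_on_compose2[OF network_continuous[OF N 0]])
         (use network_len[OF N 0] in \<open>auto intro!: continuous_intros\<close>)
    show "range (\<lambda>s. param N j (max 0 (min s (len N j)))) \<subseteq> points N"
      using param_in_points[OF N 0] network_len[OF N 0] by auto
  qed (use D in \<open>simp add: image_data_def\<close>)
  then show ?case by simp
next
  case (Suc n)
  have \<beta>: "continuous_on UNIV \<beta>" using D by (simp add: image_data_def)
  have c: "continuous_on UNIV (\<lambda>s. unfolding_stage N i0 \<beta> f n j (g s))" if "continuous_on UNIV g" for g :: "real \<Rightarrow> real"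
    by (rule continuous_on_compose2[OF Suc.IH[OF Suc.prems] that]) simp
  show ?case
    unfolding unfolding_stage.simps Let_def
    by (intro continuous_intros c continuous_on_vmean Suc.IH \<beta>)
qed

text \<open>
Each stage combines nine terms: values of the previous stage, at points that are farther out by at
most the longest edge, or means of such values, or values of \<open>\<beta>\<close>.
\<close>

lemma unfolding_stage_bound:
  assumes D: "image_data N i0 \<beta> f" and \<beta>: "\<And>s. 0 \<le> s \<Longrightarrow> \<bar>\<beta> s\<bar> \<le> M * exp s"
    and f: "\<And>x. x \<in> points N \<Longrightarrow> \<bar>f x\<bar> \<le> M"
    and \<Lambda>: "\<And>j. j \<in> edges N \<Longrightarrow> len N j \<le> \<Lambda>" and j: "j \<in> edges N"
  shows "\<bar>unfolding_stage N i0 \<beta> f n j s\<bar> \<le> (9 * exp \<Lambda>) ^ n * (M * exp \<bar>s\<bar>)"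
  using j
proof (induction n arbitrary: j s)
  have N: "network N" using D by (simp add: image_data_def)
  case 0
  have "param N j (max 0 (min s (len N j))) \<in> points N"
    using param_in_points[OF N 0] network_len[OF N 0] by auto
  from f[OF this] have *: "\<bar>f (param N j (max 0 (min s (len N j))))\<bar> \<le> M" .
  then have "0 \<le> M" by linarith
  then have "M * 1 \<le> M * exp \<bar>s\<bar>" by (intro mult_left_mono) auto
  with * show ?case by simp
next
  case (Suc n)
  have N: "network N" using D by (simp add: image_data_def)
  define G where "G = unfolding_stage N i0 \<beta> f n"
  define K where "K = (9 * exp \<Lambda>) ^ n * (M * exp (\<Lambda> + \<bar>s\<bar>))"
  have l: "0 < len N j" "len N j \<le> \<Lambda>" using network_len[OF N Suc.prems] \<Lambda>[OF Suc.prems] by auto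
  have M: "0 \<le> M" using \<beta>[of 0] by simp
  have G: "\<bar>G k x\<bar> \<le> K" if "k \<in> edges N" "\<bar>x\<bar> \<le> \<Lambda> + \<bar>s\<bar>" for k x
  proof -
    have "\<bar>G k x\<bar> \<le> (9 * exp \<Lambda>) ^ n * (M * exp \<bar>x\<bar>)" unfolding G_def by (rule Suc.IH[OF that(1)])
    also have "\<dots> \<le> K" unfolding K_def using that M by (intro mult_left_mono) auto
    finally show ?thesis .
  qed
  have vm: "\<bar>vmean N i0 \<beta> G i r\<bar> \<le> K" if i: "i \<in> verts N" and r: "0 \<le> r" "r \<le> \<bar>s\<bar>" for i r
  proof (cases "i = i0")
    case True
    have "\<bar>\<beta> r\<bar> \<le> 1 * (M * exp (\<Lambda> + \<bar>s\<bar>))"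
    proof -
      have "M * exp r \<le> M * exp (\<Lambda> + \<bar>s\<bar>)" using r l M by (intro mult_left_mono) auto
      with \<beta>[OF r(1)] show ?thesis by simp
    qed
    also have "\<dots> \<le> K" unfolding K_def
    proof (intro mult_right_mono one_le_power)
      have "1 \<le> exp \<Lambda>" using l by simp
      then show "1 \<le> 9 * exp \<Lambda>" by linarith
    qed (use M in simp)
    finally show ?thesis using True by (simp add: vmean_def)
  next
    case False
    have "\<bar>G k (out N i k r)\<bar> \<le> K" if "k \<in> Inc N i" for k
    proof (rule G[OF Inc_edges[OF that]])
      have "0 < len N k" "len N k \<le> \<Lambda>" using network_len[OF N Inc_edges[OF that]] \<Lambda>[OF Inc_edges[OF that]] by auto
      then show "\<bar>out N i k r\<bar> \<le> \<Lambda> + \<bar>s\<bar>" using r by (auto simp: out_def)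
    qed
    then have "(\<Sum>k\<in>Inc N i. \<bar>G k (out N i k r)\<bar>) \<le> card (Inc N i) * K"
      by (rule sum_bounded_above)
    then have "\<bar>\<Sum>k\<in>Inc N i. G k (out N i k r)\<bar> \<le> card (Inc N i) * K"
      using sum_abs[of "\<lambda>k. G k (out N i k r)" "Inc N i"] by linarith
    then show ?thesis using False Inc_card_pos[OF N i] by (simp add: vmean_def field_simps)
  qed
  note e = network_ends[OF N Suc.prems]
  have "\<bar>G j (max 0 (min s (len N j)))\<bar> \<le> K" "\<bar>G j (max 0 (- s))\<bar> \<le> K" "\<bar>G j 0\<bar> \<le> K"
    "\<bar>G j (len N j - max 0 (s - len N j))\<bar> \<le> K" "\<bar>G j (len N j)\<bar> \<le> K"
    using l by (auto intro!: G Suc.prems)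
  moreover have "\<bar>vmean N i0 \<beta> G (start_ix N j) (max 0 (- s))\<bar> \<le> K"
    "\<bar>vmean N i0 \<beta> G (end_ix N j) (max 0 (s - len N j))\<bar> \<le> K"
    using l e by (auto intro!: vm)
  ultimately have "\<bar>unfolding_stage N i0 \<beta> f (Suc n) j s\<bar> \<le> 9 * K"
    unfolding unfolding_stage.simps Let_def G_def[symmetric] abs_le_iff by linarith
  also have "9 * K = (9 * exp \<Lambda>) ^ Suc n * (M * exp \<bar>s\<bar>)" by (simp add: K_def exp_add)
  finally show ?case .
qed

text \<open>
The reflection law at the point at distance \<open>r > 0\<close> behind a vertex refers to the points at distance
\<open>r\<close> in the directions of the incident edges, which lie beyond these edges by at most \<open>r - L\<close>.
\<close>

lemma unfolding_stage_stable:
  assumes D: "image_data N i0 \<beta> f" and L: "\<And>j. j \<in> edges N \<Longrightarrow> L \<le> len N j" "0 \<le> L" and j: "j \<in> edges N"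
    and s: "- s \<le> n * L" "s - len N j \<le> n * L"
  shows "unfolding_stage N i0 \<beta> f (Suc n) j s = unfolding_stage N i0 \<beta> f n j s"
  using j s
proof (induction n arbitrary: j s)
  case 0
  then have "s \<in> {0..len N j}" by simp
  then show ?case by (simp only: unfolding_stage_inside[OF D 0(1)])
next
  case (Suc n)
  have N: "network N" using D by (simp add: image_data_def)
  note e = network_ends[OF N Suc.prems(1)]
  have n: "real (Suc n) * L = n * L + L" by (simp add: algebra_simps)
  have key: "unfolding_stage N i0 \<beta> f (Suc (Suc n)) j (out N i j (- r)) = unfolding_stage N i0 \<beta> f (Suc n) j (out N i j (- r))"
    if i: "i \<in> verts N" "j \<in> Inc N i" and r: "0 \<le> r" "r \<le> Suc n * L" for i r
  proof -
    have *: "unfolding_stage N i0 \<beta> f (Suc n) k (out N i k r) = unfolding_stage N i0 \<beta> f n k (out N i k r)"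
      if k: "k \<in> Inc N i" for k
    proof (rule Suc.IH[OF Inc_edges[OF k]])
      have "L \<le> len N k" "0 \<le> n * L" using L k by (auto simp: Inc_def)
      then show "- out N i k r \<le> n * L" "out N i k r - len N k \<le> n * L"
        using r n by (auto simp: out_def)
    qed
    have "vmean N i0 \<beta> (unfolding_stage N i0 \<beta> f (Suc n)) i r = vmean N i0 \<beta> (unfolding_stage N i0 \<beta> f n) i r"
      by (rule vmean_cong) (rule *)
    then show ?thesis
      by (simp only: unfolding_stage_reflect[OF D i r(1)] *[OF i(2)])
  qed
  consider "s < 0" | "s \<in> {0..len N j}" | "len N j < s" by fastforce
  then show ?case
  proof cases
    case 1
    have "j \<in> Inc N (start_ix N j)" using Inc_iff[OF N e(1)] Suc.prems(1) by simp
    moreover have "0 \<le> - s" using 1 by simp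
    ultimately show ?thesis
      using key[OF e(1) _ _ Suc.prems(2)] by (simp only: out_start[OF N Suc.prems(1)] minus_minus)
  next
    case 2
    then show ?thesis by (simp only: unfolding_stage_inside[OF D Suc.prems(1)])
  next
    case 3
    have "j \<in> Inc N (end_ix N j)" using Inc_iff[OF N e(3)] Suc.prems(1) by simp
    moreover have "0 \<le> s - len N j" using 3 by simp
    ultimately have "unfolding_stage N i0 \<beta> f (Suc (Suc n)) j (len N j - - (s - len N j))
        = unfolding_stage N i0 \<beta> f (Suc n) j (len N j - - (s - len N j))"
      using key[OF e(3) _ _ Suc.prems(3)] by (simp only: out_end[OF N Suc.prems(1)])
    moreover have "len N j - - (s - len N j) = s" by simp
    ultimately show ?thesis by (simp only:)
  qed
qed

lemma network_len_bounds:
  assumes N: "network N"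
  obtains L \<Lambda> where "0 < L" "\<And>j. j \<in> edges N \<Longrightarrow> L \<le> len N j" "\<And>j. j \<in> edges N \<Longrightarrow> len N j \<le> \<Lambda>" "0 \<le> \<Lambda>"
proof (rule that)
  define A where "A = insert 1 (len N ` edges N)"
  have A: "finite A" "1 \<in> A" using network_finite[OF N] by (auto simp: A_def)
  show "0 < Min A" using A network_len[OF N] by (auto simp: A_def)
  show "Min A \<le> len N j" if "j \<in> edges N" for j using A that by (intro Min_le) (auto simp: A_def)
  show "len N j \<le> Max A" if "j \<in> edges N" for j using A that by (intro Max_ge) (auto simp: A_def)
  show "0 \<le> Max A" using A Max_ge[of A 1] by linarith
qed

text \<open>
The stages stabilize on every bounded set.  About \<open>\<bar>s\<bar> / L\<close> stages are needed at \<open>s\<close>, so the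
geometric growth of the stages becomes exponential growth in \<open>s\<close>.
\<close>

lemma images_exist:
  assumes D: "image_data N i0 \<beta> f" and \<beta>: "\<And>s. 0 \<le> s \<Longrightarrow> \<bar>\<beta> s\<bar> \<le> B * exp s"
  obtains F where "images N i0 \<beta> f F"
proof -
  have N: "network N" using D by (simp add: image_data_def)
  obtain L \<Lambda> where L: "0 < L" "\<And>j. j \<in> edges N \<Longrightarrow> L \<le> len N j"
    and \<Lambda>: "\<And>j. j \<in> edges N \<Longrightarrow> len N j \<le> \<Lambda>" "0 \<le> \<Lambda>"
    using network_len_bounds[OF N] by blast
  have "compact (f ` points N)"
    using D compact_points[OF N] by (intro compact_continuous_image) (auto simp: image_data_def)
  then obtain M0 where M0: "\<And>x. x \<in> points N \<Longrightarrow> \<bar>f x\<bar> \<le> M0"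
    using compact_imp_bounded[of "f ` points N"] unfolding bounded_iff by (metis imageI real_norm_def)
  define M where "M = max B M0"
  have \<beta>M: "\<bar>\<beta> s\<bar> \<le> M * exp s" if "0 \<le> s" for s
  proof -
    have "B * exp s \<le> M * exp s" by (rule mult_right_mono) (auto simp: M_def)
    with \<beta>[OF that] show ?thesis by linarith
  qed
  have fM: "\<bar>f x\<bar> \<le> M" if "x \<in> points N" for x using M0[OF that] by (simp add: M_def)
  have M: "0 \<le> M" using \<beta>M[of 0] by simp
  define G where "G = unfolding_stage N i0 \<beta> f"
  define F where "F j s = G (nat \<lceil>\<bar>s\<bar> / L\<rceil>) j s" for j s
  have stable: "G m j s = G n j s" if "j \<in> edges N" "\<bar>s\<bar> \<le> n * L" "n \<le> m" for j s n m
    using that(3)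
  proof (induction m rule: dec_induct)
    case (step m)
    have "n * L \<le> m * L" using step L by (intro mult_right_mono) auto
    then have "- s \<le> m * L" "s - len N j \<le> m * L" using that(2) network_len[OF N that(1)] by linarith+
    then show ?case
      using unfolding_stage_stable[OF D L(2) _ that(1)] L(1) step unfolding G_def by simp
  qed simp
  have F: "F j s = G n j s" if "j \<in> edges N" "\<bar>s\<bar> \<le> n * L" for j s n
  proof -
    have "\<bar>s\<bar> / L \<le> n" using that L by (simp add: field_simps)
    then have "nat \<lceil>\<bar>s\<bar> / L\<rceil> \<le> n" by (simp add: ceiling_le_iff nat_le_iff)
    moreover have "\<bar>s\<bar> \<le> nat \<lceil>\<bar>s\<bar> / L\<rceil> * L"
    proof -
      have "\<bar>s\<bar> / L \<le> nat \<lceil>\<bar>s\<bar> / L\<rceil>" by linarith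
      from mult_right_mono[OF this, of L] show ?thesis using L(1) by simp
    qed
    ultimately show ?thesis using stable[OF that(1)] unfolding F_def by metis
  qed
  have ex: "\<exists>n::nat. r \<le> n * L" for r
    using reals_Archimedean3[OF L(1)] less_imp_le by blast
  have cont: "continuous_on UNIV (F j)" if j: "j \<in> edges N" for j
    unfolding continuous_on_eq_continuous_at[OF open_UNIV]
  proof
    fix s :: real
    obtain n :: nat where n: "\<bar>s\<bar> + 1 \<le> n * L" using ex by blast
    have "isCont (G n j) s"
      using continuous_on_unfolding_stage[OF D j, of n] by (simp add: G_def continuous_on_eq_continuous_at)
    moreover have "\<forall>\<^sub>F x in nhds s. F j x = G n j x"
      unfolding eventually_nhds
    proof (intro exI[of _ "ball s 1"] conjI ballI)
      fix x assume "x \<in> ball s 1"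
      then have "\<bar>x\<bar> \<le> n * L" using n by (auto simp: dist_real_def)
      then show "F j x = G n j x" by (rule F[OF j])
    qed auto
    ultimately show "isCont (F j) s" by (simp add: isCont_cong)
  qed
  \<comment> \<open>The factor by which a stage may exceed the previous one.\<close>
  define q where "q = 9 * exp \<Lambda>"
  have "1 \<le> exp \<Lambda>" using \<Lambda>(2) by simp
  then have q: "1 \<le> q" unfolding q_def by linarith
  have bound: "\<bar>F j s\<bar> \<le> (M * q) * exp ((1 + ln q / L) * \<bar>s\<bar>)" if j: "j \<in> edges N" for j s
  proof -
    define n where "n = nat \<lceil>\<bar>s\<bar> / L\<rceil>"
    have n: "real n \<le> \<bar>s\<bar> / L + 1" using L unfolding n_def by (simp add: nat_0_le)
    have "q ^ n = exp (n * ln q)" using q by (simp add: exp_of_nat_mult)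
    also have "\<dots> \<le> exp ((\<bar>s\<bar> / L + 1) * ln q)" using n q by (simp add: mult_right_mono)
    also have "(\<bar>s\<bar> / L + 1) * ln q = ln q + ln q / L * \<bar>s\<bar>" by (simp add: distrib_right)
    also have "exp (ln q + ln q / L * \<bar>s\<bar>) = q * exp (ln q / L * \<bar>s\<bar>)" using q by (simp add: exp_add)
    finally have qn: "q ^ n \<le> q * exp (ln q / L * \<bar>s\<bar>)" .
    have "\<bar>F j s\<bar> \<le> q ^ n * (M * exp \<bar>s\<bar>)"
      unfolding F_def G_def n_def[symmetric] q_def by (rule unfolding_stage_bound[OF D \<beta>M fM \<Lambda>(1) j])
    also have "\<dots> \<le> (q * exp (ln q / L * \<bar>s\<bar>)) * (M * exp \<bar>s\<bar>)"
      using qn M by (intro mult_right_mono) auto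
    also have "\<dots> = (M * q) * exp ((1 + ln q / L) * \<bar>s\<bar>)"
      by (simp add: distrib_right exp_add)
    finally show ?thesis .
  qed
  have "images N i0 \<beta> f F"
    unfolding images_def
  proof (intro conjI ballI allI impI)
    fix j assume j: "j \<in> edges N"
    show "tame (F j)"
      unfolding tame_def using cont[OF j] bound[OF j] M q L(1)
      by (intro conjI exI[of _ "M * q"] exI[of _ "1 + ln q / L"]) auto
    fix y assume y: "y \<in> {0..len N j}"
    show "F j y = f (param N j y)"
      unfolding F_def G_def by (rule unfolding_stage_inside[OF D j y])
  next
    fix i j and s :: real assume i: "i \<in> verts N" "j \<in> Inc N i" and s: "0 \<le> s"
    obtain n :: nat where n: "\<Lambda> + s \<le> n * L" using ex by blast
    have out: "\<bar>out N i k r\<bar> \<le> n * L" if "k \<in> Inc N i" "\<bar>r\<bar> = s" for k r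
      using n that \<Lambda> network_len[OF N Inc_edges[OF that(1)]] \<Lambda>(1)[OF Inc_edges[OF that(1)]]
      by (auto simp: out_def)
    have "F j (out N i j (- s)) = G (Suc n) j (out N i j (- s))"
      using out[OF i(2), of "- s"] s L(1) by (intro F Inc_edges[OF i(2)]) (simp add: algebra_simps)
    also have "\<dots> = 2 * vmean N i0 \<beta> (G n) i s - G n j (out N i j s)"
      unfolding G_def by (rule unfolding_stage_reflect[OF D i s])
    also have "G n j (out N i j s) = F j (out N i j s)"
      using F[OF Inc_edges[OF i(2)] out[OF i(2)]] s by simp
    also have "vmean N i0 \<beta> (G n) i s = vmean N i0 \<beta> F i s"
      by (rule vmean_cong) (use F[OF Inc_edges out] s in simp)
    finally show "F j (out N i j (- s)) = 2 * vmean N i0 \<beta> F i s - F j (out N i j s)" .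
  qed
  then show thesis by (rule that)
qed

section \<open>Heat flow of an image system\<close>

definition image_flow :: "('i, 'j, 'n::finite) net \<Rightarrow> ('j \<Rightarrow> real \<Rightarrow> real) \<Rightarrow> real ^ 'n \<Rightarrow> real \<Rightarrow> real" where
  "image_flow N F x t = glue N (\<lambda>j y. gavg gauss (F j) y t) x"

lemma DERIV_transform_on:
  assumes "x \<in> S" "\<And>z. z \<in> S \<Longrightarrow> g z = f z" "(f has_field_derivative d) (at x within S)"
  shows "(g has_field_derivative d) (at x within S)"
  unfolding has_field_derivative_def
  by (rule has_derivative_transform[where f = f]) (use assms in \<open>auto simp: has_field_derivative_def\<close>)

lemma imagesD:
  assumes "images N i0 \<beta> f F"
  shows "j \<in> edges N \<Longrightarrow> tame (F j)"
    and "j \<in> edges N \<Longrightarrow> y \<in> {0..len N j} \<Longrightarrow> F j y = f (param N j y)"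
    and "i \<in> verts N \<Longrightarrow> j \<in> Inc N i \<Longrightarrow> 0 \<le> s \<Longrightarrow>
      F j (out N i j (- s)) = 2 * vmean N i0 \<beta> F i s - F j (out N i j s)"
  using assms unfolding images_def by blast+

lemma tame_out: "tame F \<Longrightarrow> tame (\<lambda>s. F (out N i j s))"
  by (cases "param N j 0 = vertex N i"; simp add: out_def tame_reflect)

lemma tame_vmean:
  assumes F: "\<And>j. j \<in> edges N \<Longrightarrow> tame (F j)" and \<beta>: "tame (\<lambda>s. \<beta> \<bar>s\<bar>)"
  shows "tame (\<lambda>s. vmean N i0 \<beta> F i \<bar>s\<bar>)"
proof (cases "i = i0")
  case True
  then show ?thesis using \<beta> by (simp add: vmean_def)
next
  case False
  have "tame (\<lambda>s. (1 / card (Inc N i)) * (\<Sum>j\<in>Inc N i. F j (out N i j s)))"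
    by (intro tame_cmult tame_sum tame_out F) (rule Inc_edges)
  from tame_abs[OF this] show ?thesis using False by (simp add: vmean_def)
qed

text \<open>
In the outward coordinate both ends of an edge look alike, since the kernel is even and its
derivative odd.
\<close>

lemma gavg_out:
  assumes "network N" "i \<in> verts N" "j \<in> Inc N i"
  shows "gavg gauss F (out N i j 0) t = gavg gauss (\<lambda>s. F (out N i j s)) 0 t"
    and "orient N i j * gavg gauss1 F (out N i j 0) t = gavg gauss1 (\<lambda>s. F (out N i j s)) 0 t"
proof -
  have "gavg gauss F (out N i j 0) t = gavg gauss (\<lambda>s. F (out N i j s)) 0 t \<and>
    orient N i j * gavg gauss1 F (out N i j 0) t = gavg gauss1 (\<lambda>s. F (out N i j s)) 0 t"
    using assms by (cases rule: Inc_cases) (simp_all add: gavg_reflect gavg_reflect1)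
  then show "gavg gauss F (out N i j 0) t = gavg gauss (\<lambda>s. F (out N i j s)) 0 t"
    and "orient N i j * gavg gauss1 F (out N i j 0) t = gavg gauss1 (\<lambda>s. F (out N i j s)) 0 t"
    by auto
qed

text \<open>
The right-hand side does not depend on the edge: this is continuity at the vertex.
\<close>

lemma image_vertex_value:
  assumes N: "network N" and F: "images N i0 \<beta> f F" and \<beta>: "tame (\<lambda>s. \<beta> \<bar>s\<bar>)"
    and i: "i \<in> verts N" "j \<in> Inc N i"
  shows "gavg gauss (F j) (out N i j 0) t = gavg gauss (\<lambda>s. vmean N i0 \<beta> F i \<bar>s\<bar>) 0 t"
  unfolding gavg_out(1)[OF N i]
  by (rule gavg_even_part[OF tame_out[OF imagesD(1)[OF F Inc_edges[OF i(2)]]] tame_vmean[OF imagesD(1)[OF F] \<beta>] imagesD(3)[OF F i]])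

lemma image_flow_consistent:
  assumes "network N" "images N i0 \<beta> f F" "tame (\<lambda>s. \<beta> \<bar>s\<bar>)"
  shows "consistent N (\<lambda>j y. gavg gauss (F j) y t)"
  unfolding consistent_def using image_vertex_value[OF assms] by blast

lemma image_flow_param:
  assumes "network N" "images N i0 \<beta> f F" "tame (\<lambda>s. \<beta> \<bar>s\<bar>)" "j \<in> edges N" "y \<in> {0..len N j}"
  shows "image_flow N F (param N j y) t = gavg gauss (F j) y t"
  unfolding image_flow_def using glue_param[OF assms(1) image_flow_consistent[OF assms(1-3)] assms(4,5)] .

lemma image_flow_initial:
  assumes N: "network N" and F: "images N i0 \<beta> f F" and \<beta>: "tame (\<lambda>s. \<beta> \<bar>s\<bar>)" and x: "x \<in> points N"
  shows "image_flow N F x 0 = f x"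
proof -
  from N x obtain j y where j: "j \<in> edges N" "y \<in> {0..len N j}" "x = param N j y" by (rule pointsE)
  then show ?thesis using image_flow_param[OF N F \<beta> j(1,2)] imagesD(2)[OF F j(1,2)] by simp
qed

lemma image_flow_boundary:
  assumes N: "network N" and F: "images N i0 \<beta> f F" and \<beta>: "tame (\<lambda>s. \<beta> \<bar>s\<bar>)" and i0: "i0 \<in> verts N"
  shows "image_flow N F (vertex N i0) t = gavg gauss (\<lambda>s. \<beta> \<bar>s\<bar>) 0 t"
proof -
  obtain j where j: "j \<in> Inc N i0" using Inc_card_pos[OF N i0] by (metis card.empty ex_in_conv less_irrefl)
  have "image_flow N F (vertex N i0) t = gavg gauss (F j) (out N i0 j 0) t"
    using image_flow_param[OF N F \<beta> Inc_edges[OF j] param_out(2)[OF N i0 j]] param_out(1)[OF N i0 j] by simp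
  also have "\<dots> = gavg gauss (\<lambda>s. vmean N i0 \<beta> F i0 \<bar>s\<bar>) 0 t"
    by (rule image_vertex_value[OF N F \<beta> i0 j])
  finally show ?thesis by (simp add: vmean_def)
qed

lemma image_flow_continuous:
  assumes N: "network N" and F: "images N i0 \<beta> f F" and \<beta>: "tame (\<lambda>s. \<beta> \<bar>s\<bar>)" and S: "closed S"
  shows "continuous_on (points N \<times> S) (\<lambda>(x, s). image_flow N F x s)"
proof (rule continuous_on_points[OF N S])
  fix j assume j: "j \<in> edges N"
  have "continuous_on ({0..len N j} \<times> S) (\<lambda>p. gavg gauss (F j) (fst p) (snd p))"
    by (intro continuous_on_gavg' gaussian_weight_gauss imagesD(1)[OF F j] continuous_intros)
  then show "continuous_on ({0..len N j} \<times> S) (\<lambda>(y, s). image_flow N F (param N j y) s)"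
    by (rule continuous_on_eq) (auto simp: image_flow_param[OF N F \<beta> j])
qed

text \<open>
By the reflection law the sum of the extensions in outward coordinates is even, and the weight
\<open>gauss1\<close> annihilates even functions.
\<close>

lemma image_kirchhoff:
  assumes N: "network N" and F: "images N i0 \<beta> f F" and i: "i \<in> verts N" "i \<noteq> i0"
  shows "(\<Sum>j\<in>Inc N i. orient N i j * gavg gauss1 (F j) (out N i j 0) t) = 0"
proof -
  define S where "S s = (\<Sum>j\<in>Inc N i. F j (out N i j s))" for s
  have pos: "S (- s) = S s" if "0 \<le> s" for s
  proof -
    have "S (- s) = (\<Sum>j\<in>Inc N i. 2 * vmean N i0 \<beta> F i s - F j (out N i j s))"
      unfolding S_def using imagesD(3)[OF F i(1) _ that] by (intro sum.cong) auto
    also have "\<dots> = card (Inc N i) * (2 * vmean N i0 \<beta> F i s) - S s"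
      by (simp add: sum_subtractf S_def)
    also have "\<dots> = S s" using i Inc_card_pos[OF N i(1)] by (simp add: vmean_def S_def)
    finally show ?thesis .
  qed
  have S: "S (- s) = S s" for s using pos[of s] pos[of "- s"] by (cases "0 \<le> s") auto
  have "(\<Sum>j\<in>Inc N i. orient N i j * gavg gauss1 (F j) (out N i j 0) t)
      = (\<Sum>j\<in>Inc N i. gavg gauss1 (\<lambda>s. F j (out N i j s)) 0 t)"
    using gavg_out(2)[OF N i(1)] by simp
  also have "\<dots> = gavg gauss1 S 0 t"
    unfolding S_def[abs_def]
    by (rule gavg_sum[symmetric, OF gaussian_weight_gauss1 tame_out[OF imagesD(1)[OF F Inc_edges]]])
  also have "\<dots> = 0" by (rule gavg_gauss1_even) (rule S)
  finally show ?thesis .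
qed

lemma image_flow_heat:
  assumes N: "network N" and F: "images N i0 \<beta> f F" and \<beta>: "tame (\<lambda>s. \<beta> \<bar>s\<bar>)" and i0: "bdry_ix N = {i0}"
  shows "heat_on 1 N Tm (image_flow N F) (\<lambda>j y t. gavg gauss1 (F j) y t / sqrt (2 * t)) (\<lambda>j y t. gavg gauss2 (F j) y t / (2 * t))"
  unfolding heat_on_def
proof (intro conjI ballI)
  show "continuous_on (points N \<times> {0..Tm}) (\<lambda>(x, s). image_flow N F x s)"
    by (rule image_flow_continuous[OF N F \<beta>]) simp
  fix j assume j: "j \<in> edges N"
  note t = imagesD(1)[OF F j]
  show "continuous_on ({0..len N j} \<times> {0<..<Tm}) (\<lambda>(y, t). gavg gauss1 (F j) y t / sqrt (2 * t))"
    unfolding case_prod_beta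
    by (intro continuous_intros continuous_on_gavg' gaussian_weight_gauss1 t) auto
  show "continuous_on ({0..len N j} \<times> {0<..<Tm}) (\<lambda>(y, t). gavg gauss2 (F j) y t / (2 * t))"
    unfolding case_prod_beta
    by (intro continuous_intros continuous_on_gavg' gaussian_weight_gauss2 t) auto
  fix s y assume s: "s \<in> {0<..<Tm}" and y: "y \<in> {0..len N j}"
  have s0: "0 < s" using s by simp
  have "((\<lambda>z. gavg gauss (F j) z s) has_real_derivative gavg gauss1 (F j) y s / sqrt (2 * s)) (at y within {0..len N j})"
    by (rule has_field_derivative_at_within[OF DERIV_gavg_space[OF gaussian_weight_gauss gaussian_weight_gauss1 DERIV_gauss t s0]])
  then show "((\<lambda>z. image_flow N F (param N j z) s) has_real_derivative gavg gauss1 (F j) y s / sqrt (2 * s)) (at y within {0..len N j})"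
    by (rule DERIV_transform_on[OF y, rotated]) (simp add: image_flow_param[OF N F \<beta> j])
  have "((\<lambda>z. gavg gauss1 (F j) z s / sqrt (2 * s)) has_real_derivative gavg gauss2 (F j) y s / sqrt (2 * s) / sqrt (2 * s)) (at y within {0..len N j})"
    by (intro DERIV_cdivide has_field_derivative_at_within[OF DERIV_gavg_space[OF gaussian_weight_gauss1 gaussian_weight_gauss2 DERIV_gauss1 t s0]])
  then show "((\<lambda>z. gavg gauss1 (F j) z s / sqrt (2 * s)) has_real_derivative gavg gauss2 (F j) y s / (2 * s)) (at y within {0..len N j})"
    using s0 by simp
  show "((\<lambda>r. image_flow N F (param N j y) r) has_real_derivative 1 * (gavg gauss2 (F j) y s / (2 * s))) (at s)"
    using DERIV_gavg_time[OF t s0] unfolding image_flow_param[OF N F \<beta> j y] by simp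
next
  fix i s assume i: "i \<in> trans_ix N" and s: "s \<in> {0<..<Tm}"
  then have "i \<noteq> i0" using i0 by (auto simp: trans_ix_def)
  from image_kirchhoff[OF N F trans_ix_verts[OF i] this]
  show "(\<Sum>j\<in>Inc N i. orient N i j * (gavg gauss1 (F j) (out N i j 0) s / sqrt (2 * s))) = 0"
    by (simp add: sum_divide_distrib[symmetric])
qed

lemma zero_of_zero_derivative:
  fixes f :: "real \<Rightarrow> real"
  assumes "convex S" "0 \<in> S" "f 0 = 0" "\<And>x. x \<in> S \<Longrightarrow> (f has_real_derivative 0) (at x within S)" "x \<in> S"
  shows "f x = 0"
  using has_field_derivative_zero_constant[OF assms(1,4)] assms(2,3,5) by metis

lemma tame_half_square: "tame (\<lambda>s. s\<^sup>2 / 2)"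
  unfolding tame_def
proof (intro conjI exI[of _ 1] allI)
  fix s :: real
  have "1 + \<bar>s\<bar> + \<bar>s\<bar>\<^sup>2 / 2 \<le> exp \<bar>s\<bar>" by (rule exp_lower_Taylor_quadratic) simp
  then have "\<bar>s\<bar>\<^sup>2 / 2 \<le> exp \<bar>s\<bar>" by linarith
  then show "\<bar>s\<^sup>2 / 2\<bar> \<le> 1 * exp (1 * \<bar>s\<bar>)" by simp
qed (auto intro!: continuous_intros)

text \<open>
Second antiderivatives of an image system with zero initial values.  Both sides of the reflection
law for \<open>F2\<close> have the same second derivative by the law for \<open>F1\<close>, and they vanish to first order
at \<open>s = 0\<close> because \<open>F2\<close> and \<open>G\<close> vanish on the edges.
\<close>

lemma images_integrate_twice:
  assumes N: "network N" and F1: "images N i0 \<beta> (\<lambda>_. 0) F1"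
    and G: "\<And>j s. j \<in> edges N \<Longrightarrow> (G j has_real_derivative F1 j s) (at s)" "\<And>j. j \<in> edges N \<Longrightarrow> G j 0 = 0"
    and F2: "\<And>j s. j \<in> edges N \<Longrightarrow> (F2 j has_real_derivative G j s) (at s)" "\<And>j. j \<in> edges N \<Longrightarrow> F2 j 0 = 0"
    and \<beta>: "\<And>s. (\<gamma> has_real_derivative \<beta> s) (at s)" "\<gamma> 0 = 0"
    and \<beta>2: "\<And>s. (\<beta>2 has_real_derivative \<gamma> s) (at s)" "\<beta>2 0 = 0"
  shows "images N i0 \<beta>2 (\<lambda>_. 0) F2" and "\<And>j y. j \<in> edges N \<Longrightarrow> y \<in> {0..len N j} \<Longrightarrow> G j y = 0"
proof -
  show G0: "G j y = 0" if j: "j \<in> edges N" and y: "y \<in> {0..len N j}" for j y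
    by (rule zero_of_zero_derivative[of "{0..len N j}" "G j"])
       (use G[OF j] imagesD(2)[OF F1 j] y in \<open>auto intro: has_field_derivative_at_within\<close>, metis atLeastAtMost_iff G(1)[OF j] has_field_derivative_at_within)
  have F20: "F2 j y = 0" if j: "j \<in> edges N" and y: "y \<in> {0..len N j}" for j y
  proof (rule zero_of_zero_derivative[of "{0..len N j}" "F2 j"])
    fix x assume "x \<in> {0..len N j}"
    with G0[OF j this] F2(1)[OF j, of x] show "(F2 j has_real_derivative 0) (at x within {0..len N j})"
      by (auto intro: has_field_derivative_at_within)
  qed (use F2(2)[OF j] y in auto)
  show "images N i0 \<beta>2 (\<lambda>_. 0) F2"
    unfolding images_def
  proof (intro conjI ballI allI impI)
    fix j assume j: "j \<in> edges N"
    have "tame (G j)" by (rule tame_antiderivative[OF imagesD(1)[OF F1 j] G(1)[OF j]])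
    then show "tame (F2 j)" by (rule tame_antiderivative[OF _ F2(1)[OF j]])
    fix y assume "y \<in> {0..len N j}"
    with F20[OF j] show "F2 j y = 0" .
  next
    fix i j and s :: real assume i: "i \<in> verts N" "j \<in> Inc N i" and s: "0 \<le> s"
    have d2: "((\<lambda>s. F2 k (out N i k (a * s))) has_real_derivative orient N i k * a * G k (out N i k (a * s))) (at s)"
      and d1: "((\<lambda>s. orient N i k * a * G k (out N i k (a * s))) has_real_derivative a * a * F1 k (out N i k (a * s))) (at s)"
      if k: "k \<in> Inc N i" for k a s
    proof -
      have ke: "k \<in> edges N" using k by (simp add: Inc_def)
      have o: "((\<lambda>s. out N i k (a * s)) has_real_derivative orient N i k * a) (at s)" "orient N i k * orient N i k = 1"
        using N i(1) k by (atomize(full), cases rule: Inc_cases) (auto intro!: derivative_eq_intros)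
      show "((\<lambda>s. F2 k (out N i k (a * s))) has_real_derivative orient N i k * a * G k (out N i k (a * s))) (at s)"
        using DERIV_chain2[OF F2(1)[OF ke] o(1)] by (simp add: mult.commute)
      have "((\<lambda>s. orient N i k * a * G k (out N i k (a * s))) has_real_derivative
          (orient N i k * a) * (F1 k (out N i k (a * s)) * (orient N i k * a))) (at s)"
        by (intro DERIV_cmult DERIV_chain2[OF G(1)[OF ke] o(1)])
      also have "(orient N i k * a) * (F1 k (out N i k (a * s)) * (orient N i k * a))
          = (orient N i k * orient N i k) * (a * a * F1 k (out N i k (a * s)))" by simp
      finally show "((\<lambda>s. orient N i k * a * G k (out N i k (a * s))) has_real_derivative a * a * F1 k (out N i k (a * s))) (at s)"
        unfolding o(2) by simp
    qed
    \<comment> \<open>The derivative of the mean value in the law for \<open>F2\<close>.\<close>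
    define V where "V s = (if i = i0 then \<gamma> s else (\<Sum>k\<in>Inc N i. orient N i k * 1 * G k (out N i k (1 * s))) / card (Inc N i))" for s
    have V2: "((\<lambda>s. vmean N i0 \<beta>2 F2 i s) has_real_derivative V s) (at s)" for s
    proof (cases "i = i0")
      case True then show ?thesis using \<beta>2(1) by (simp add: vmean_def V_def)
    next
      case False
      have "((\<lambda>s. (\<Sum>k\<in>Inc N i. F2 k (out N i k (1 * s))) / card (Inc N i)) has_real_derivative
        (\<Sum>k\<in>Inc N i. orient N i k * 1 * G k (out N i k (1 * s))) / card (Inc N i)) (at s)"
        by (intro DERIV_cdivide DERIV_sum d2)
      then show ?thesis using False by (simp add: vmean_def V_def)
    qed
    have V1: "(V has_real_derivative vmean N i0 \<beta> F1 i s) (at s)" for s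
    proof (cases "i = i0")
      case True then show ?thesis using \<beta>(1) by (simp add: vmean_def V_def[abs_def])
    next
      case False
      have "((\<lambda>s. (\<Sum>k\<in>Inc N i. orient N i k * 1 * G k (out N i k (1 * s))) / card (Inc N i)) has_real_derivative
        (\<Sum>k\<in>Inc N i. 1 * 1 * F1 k (out N i k (1 * s))) / card (Inc N i)) (at s)"
        by (intro DERIV_cdivide DERIV_sum d1)
      then show ?thesis using False by (simp add: vmean_def V_def[abs_def])
    qed
    have F2v: "F2 k (out N i k 0) = 0" "G k (out N i k 0) = 0" if "k \<in> Inc N i" for k
      using F20[OF Inc_edges[OF that] param_out(2)[OF N i(1) that]] G0[OF Inc_edges[OF that] param_out(2)[OF N i(1) that]] by auto
    have V0: "V 0 = 0" "vmean N i0 \<beta>2 F2 i 0 = 0" using \<beta>(2) \<beta>2(2) F2v by (auto simp: V_def vmean_def)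
    define D where "D s = F2 j (out N i j (-1 * s)) + F2 j (out N i j (1 * s)) - 2 * vmean N i0 \<beta>2 F2 i s" for s
    define D' where "D' s = orient N i j * -1 * G j (out N i j (-1 * s)) + orient N i j * 1 * G j (out N i j (1 * s)) - 2 * V s" for s
    have D: "(D has_real_derivative D' s) (at s)" for s
      unfolding D_def[abs_def] D'_def by (intro DERIV_diff DERIV_add DERIV_cmult d2 i V2)
    have D': "(D' has_real_derivative 0) (at s)" if "0 \<le> s" for s
    proof -
      have "(D' has_real_derivative -1 * -1 * F1 j (out N i j (-1 * s)) + 1 * 1 * F1 j (out N i j (1 * s)) - 2 * vmean N i0 \<beta> F1 i s) (at s)"
        unfolding D'_def[abs_def] by (intro DERIV_diff DERIV_add DERIV_cmult d1 i V1)
      then show ?thesis using imagesD(3)[OF F1 i that] by simp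
    qed
    have "D' s = 0" if "0 \<le> s" for s
    proof (rule zero_of_zero_derivative[of "{0..}" D'])
      show "D' 0 = 0" using F2v[OF i(2)] V0 by (simp add: D'_def)
    qed (use D' that in \<open>auto intro: has_field_derivative_at_within\<close>)
    then have Dd: "(D has_real_derivative 0) (at s)" if "0 \<le> s" for s using D[of s] that by simp
    have "D s = 0"
    proof (rule zero_of_zero_derivative[of "{0..}" D])
      show "D 0 = 0" using F2v[OF i(2)] V0 by (simp add: D_def)
    qed (use Dd s in \<open>auto intro: has_field_derivative_at_within\<close>)
    then show "F2 j (out N i j (- s)) = 2 * vmean N i0 \<beta>2 F2 i s - F2 j (out N i j s)"
      by (simp add: D_def)
  qed
qed

lemma gavg_quartic:
  assumes "0 \<le> t"
  shows "gavg gauss (\<lambda>s. s ^ 4 / 24) 0 t = t\<^sup>2 / 2"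
proof -
  have "sqrt (2 * t) ^ 4 = (2 * t)\<^sup>2" using assms
    by (metis mult_2 numeral_Bit0 power2_eq_square power_add power_mult_distrib real_sqrt_pow2 zero_le_mult_iff zero_le_numeral)
  then have "gauss z * ((0 + sqrt (2 * t) * z) ^ 4 / 24) = (t\<^sup>2 / 6) * (gauss z * z ^ (2 * 2))" for z
    by (simp add: power_mult_distrib)
  then have "gavg gauss (\<lambda>s. s ^ 4 / 24) 0 t = (t\<^sup>2 / 6) * (\<integral>z. gauss z * z ^ (2 * 2) \<partial>lborel)"
    unfolding gavg_def by (simp only: integral_mult_right_zero)
  also have "\<dots> = t\<^sup>2 / 2"
    unfolding integral_std_normal_moment_even by (simp add: fact_numeral)
  finally show ?thesis .
qed

text \<open>
\<open>K1\<close> and \<open>K2\<close> are the flows with zero initial values and boundary values \<open>t\<close> and \<open>t\<^sup>2/2\<close>, and \<open>K1\<close> is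
the time derivative of \<open>K2\<close>.  Two integrations make the images of \<open>K2\<close> twice differentiable, so
that the derivatives of \<open>K2\<close> in the heat equation extend continuously to \<open>t = 0\<close>, even at the corner
\<open>(v\<^sub>0, 0)\<close>.  This is what allows superposing its time translates.
\<close>

lemma ramp_solutions:
  assumes N: "network N" and i0: "bdry_ix N = {i0}"
  obtains K1 K2 K1x K1xx K2x where
    "heat_on 1 N Tm K1 K1x K1xx" "heat_on 1 N Tm K2 K2x (\<lambda>j y t. K1 (param N j y) t)"
    "continuous_on (points N \<times> {0..}) (\<lambda>(x, t). K1 x t)" "continuous_on (points N \<times> {0..}) (\<lambda>(x, t). K2 x t)"
    "\<And>j. j \<in> edges N \<Longrightarrow> continuous_on ({0..len N j} \<times> {0..}) (\<lambda>(y, t). K2x j y t)"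
    "\<And>x. x \<in> points N \<Longrightarrow> K1 x 0 = 0" "\<And>x. x \<in> points N \<Longrightarrow> K2 x 0 = 0"
    "\<And>t. 0 \<le> t \<Longrightarrow> K1 (vertex N i0) t = t" "\<And>t. 0 \<le> t \<Longrightarrow> K2 (vertex N i0) t = t\<^sup>2 / 2"
    "\<And>j y t. j \<in> edges N \<Longrightarrow> y \<in> {0..len N j} \<Longrightarrow> 0 \<le> t \<Longrightarrow>
       ((\<lambda>z. K2 (param N j z) t) has_real_derivative K2x j y t) (at y within {0..len N j})"
    "\<And>j y t. j \<in> edges N \<Longrightarrow> y \<in> {0..len N j} \<Longrightarrow> 0 \<le> t \<Longrightarrow>
       ((\<lambda>z. K2x j z t) has_real_derivative K1 (param N j y) t) (at y within {0..len N j})"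
    "\<And>j y t. j \<in> edges N \<Longrightarrow> y \<in> {0..len N j} \<Longrightarrow> 0 < t \<Longrightarrow>
       ((\<lambda>r. K2 (param N j y) r) has_real_derivative K1 (param N j y) t) (at t)"
    "\<And>i t. i \<in> trans_ix N \<Longrightarrow> 0 \<le> t \<Longrightarrow> (\<Sum>j\<in>Inc N i. orient N i j * K2x j (out N i j 0) t) = 0"
proof -
  define \<beta> :: "real \<Rightarrow> real" where "\<beta> s = s\<^sup>2 / 2" for s
  define \<beta>2 :: "real \<Rightarrow> real" where "\<beta>2 s = s ^ 4 / 24" for s
  have i0v: "i0 \<in> verts N" using i0 by (auto simp: bdry_ix_def)
  have \<beta>abs: "(\<lambda>s. \<beta> \<bar>s\<bar>) = (\<lambda>s. s\<^sup>2 / 2)" "(\<lambda>s. \<beta>2 \<bar>s\<bar>) = (\<lambda>s. s ^ 4 / 24)"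
    by (auto simp: \<beta>_def \<beta>2_def)
  have t\<beta>: "tame \<beta>" using tame_half_square by (simp add: \<beta>_def[abs_def])
  have d\<beta>: "((\<lambda>s. s ^ 3 / 6) has_real_derivative \<beta> s) (at s)" for s
    unfolding \<beta>_def by (auto intro!: derivative_eq_intros)
  have d\<beta>2: "(\<beta>2 has_real_derivative s ^ 3 / 6) (at s)" for s
    unfolding \<beta>2_def[abs_def] by (auto intro!: derivative_eq_intros)
  have t\<beta>2: "tame \<beta>2" using tame_antiderivative[OF tame_antiderivative[OF t\<beta> d\<beta>] d\<beta>2] .
  have ta: "tame (\<lambda>s. \<beta> \<bar>s\<bar>)" "tame (\<lambda>s. \<beta>2 \<bar>s\<bar>)" using tame_abs[OF t\<beta>] tame_abs[OF t\<beta>2] by auto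
  have D: "image_data N i0 \<beta> (\<lambda>_. 0)" unfolding image_data_def
    using N i0v by (auto simp: \<beta>_def[abs_def] intro!: continuous_intros)
  have "\<bar>\<beta> s\<bar> \<le> 1 * exp s" if "0 \<le> s" for s
    using exp_lower_Taylor_quadratic[OF that] that by (simp add: \<beta>_def)
  from images_exist[OF D this] obtain F1 where F1: "images N i0 \<beta> (\<lambda>_. 0) F1" by blast
  have "\<exists>G. G 0 = 0 \<and> (\<forall>s. (G has_real_derivative F1 j s) (at s)) \<and> tame G" if "j \<in> edges N" for j
    using tame_has_antiderivative[OF imagesD(1)[OF F1 that]] by metis
  then obtain G where G: "\<And>j. j \<in> edges N \<Longrightarrow> G j 0 = 0" "\<And>j s. j \<in> edges N \<Longrightarrow> (G j has_real_derivative F1 j s) (at s)"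
    "\<And>j. j \<in> edges N \<Longrightarrow> tame (G j)" by metis
  have "\<exists>F. F 0 = 0 \<and> (\<forall>s. (F has_real_derivative G j s) (at s)) \<and> tame F" if "j \<in> edges N" for j
    using tame_has_antiderivative[OF G(3)[OF that]] by metis
  then obtain F2 where F2: "\<And>j. j \<in> edges N \<Longrightarrow> F2 j 0 = 0" "\<And>j s. j \<in> edges N \<Longrightarrow> (F2 j has_real_derivative G j s) (at s)"
    "\<And>j. j \<in> edges N \<Longrightarrow> tame (F2 j)" by metis
  note int2 = images_integrate_twice[OF N F1 G(2,1) F2(2,1) d\<beta> _ d\<beta>2]
  have I2: "images N i0 \<beta>2 (\<lambda>_. 0) F2" by (rule int2) (auto simp: \<beta>2_def)
  have G0: "G j y = 0" if "j \<in> edges N" "y \<in> {0..len N j}" for j y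
    by (rule int2(2)) (use that in \<open>auto simp: \<beta>2_def\<close>)
  define K1 where "K1 = image_flow N F1"
  define K2 where "K2 = image_flow N F2"
  define K2x where "K2x j y t = gavg gauss (G j) y t" for j y t
  note K1p = image_flow_param[OF N F1 ta(1), folded K1_def]
  note K2p = image_flow_param[OF N I2 ta(2), folded K2_def]
  have K2x0: "K2x j y 0 = 0" if "j \<in> edges N" "y \<in> {0..len N j}" for j y
    using G0[OF that] by (simp add: K2x_def)
  have c1: "continuous_on (points N \<times> S) (\<lambda>(x, t). K1 x t)" if "closed S" for S
    unfolding K1_def by (rule image_flow_continuous[OF N F1 ta(1) that])
  have c2: "continuous_on (points N \<times> S) (\<lambda>(x, t). K2 x t)" if "closed S" for S
    unfolding K2_def by (rule image_flow_continuous[OF N I2 ta(2) that])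
  have c3: "continuous_on ({0..len N j} \<times> S) (\<lambda>(y, t). K2x j y t)" if j: "j \<in> edges N" for j S
    unfolding K2x_def case_prod_beta
    by (intro continuous_on_gavg' gaussian_weight_gauss G(3) j continuous_intros)
  have d1: "((\<lambda>z. K2 (param N j z) t) has_real_derivative K2x j y t) (at y within {0..len N j})"
    if j: "j \<in> edges N" and y: "y \<in> {0..len N j}" for j y t
  proof (rule DERIV_transform_on[OF y])
    show "((\<lambda>z. gavg gauss (F2 j) z t) has_real_derivative K2x j y t) (at y within {0..len N j})"
      unfolding K2x_def
      by (rule has_field_derivative_at_within[OF DERIV_gavg_tame[OF F2(3)[OF j] G(3)[OF j] F2(2)[OF j]]])
  qed (simp add: K2p[OF j])
  have d2: "((\<lambda>z. K2x j z t) has_real_derivative K1 (param N j y) t) (at y within {0..len N j})"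
    if j: "j \<in> edges N" and y: "y \<in> {0..len N j}" for j y t
    unfolding K2x_def K1p[OF j y]
    by (rule has_field_derivative_at_within[OF DERIV_gavg_tame[OF G(3)[OF j] imagesD(1)[OF F1 j] G(2)[OF j]]])
  have d3: "((\<lambda>r. K2 (param N j y) r) has_real_derivative K1 (param N j y) t) (at t)"
    if j: "j \<in> edges N" and y: "y \<in> {0..len N j}" and t: "0 < t" for j y t
    using DERIV_gavg_time[OF F2(3)[OF j] t, of y]
    unfolding K1p[OF j y] K2p[OF j y] gavg_gauss2_tame(2)[OF F2(3)[OF j] G(3)[OF j] imagesD(1)[OF F1 j] t F2(2)[OF j] G(2)[OF j]] .
  have k: "(\<Sum>j\<in>Inc N i. orient N i j * K2x j (out N i j 0) t) = 0" if i: "i \<in> trans_ix N" and t: "0 \<le> t" for i t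
  proof (cases "t = 0")
    case True
    then show ?thesis using K2x0[OF Inc_edges param_out(2)[OF N trans_ix_verts[OF i]]] by simp
  next
    case False
    then have t0: "0 < t" using t by simp
    have "i \<noteq> i0" using i i0 by (auto simp: trans_ix_def)
    note ik = image_kirchhoff[OF N I2 trans_ix_verts[OF i] this, of t]
    have "(\<Sum>j\<in>Inc N i. orient N i j * K2x j (out N i j 0) t)
        = (\<Sum>j\<in>Inc N i. orient N i j * gavg gauss1 (F2 j) (out N i j 0) t / sqrt (2 * t))"
    proof (rule sum.cong[OF refl])
      fix j assume "j \<in> Inc N i"
      then have j: "j \<in> edges N" by (rule Inc_edges)
      show "orient N i j * K2x j (out N i j 0) t = orient N i j * gavg gauss1 (F2 j) (out N i j 0) t / sqrt (2 * t)"
        unfolding K2x_def gavg_gauss2_tame(1)[OF F2(3)[OF j] G(3)[OF j] imagesD(1)[OF F1 j] t0 F2(2)[OF j] G(2)[OF j], symmetric]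
        by simp
    qed
    also have "\<dots> = 0" by (simp add: sum_divide_distrib[symmetric] ik)
    finally show ?thesis .
  qed
  have h2: "heat_on 1 N Tm K2 K2x (\<lambda>j y t. K1 (param N j y) t)"
    unfolding heat_on_def
    using c2[of "{0..Tm}"] c3 continuous_on_subset[OF continuous_on_edge[OF N _ c1[of "{0..Tm}"]]]
    by (auto intro!: d1 d2 d3 k) (auto intro: continuous_on_subset[OF continuous_on_edge[OF N _ c1[of "{0..Tm}"]]])
  show thesis
  proof (rule that[of K1 _ _ K2 K2x])
    show "heat_on 1 N Tm K1 (\<lambda>j y t. gavg gauss1 (F1 j) y t / sqrt (2 * t)) (\<lambda>j y t. gavg gauss2 (F1 j) y t / (2 * t))"
      unfolding K1_def by (rule image_flow_heat[OF N F1 ta(1) i0])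
    show "K1 x 0 = 0" "K2 x 0 = 0" if "x \<in> points N" for x
      unfolding K1_def K2_def using image_flow_initial[OF N F1 ta(1) that] image_flow_initial[OF N I2 ta(2) that] by auto
    show "K1 (vertex N i0) t = t" "K2 (vertex N i0) t = t\<^sup>2 / 2" if "0 \<le> t" for t
      unfolding K1_def K2_def image_flow_boundary[OF N F1 ta(1) i0v] image_flow_boundary[OF N I2 ta(2) i0v] \<beta>abs
      using gavg_half_square[OF that] gavg_quartic[OF that] by auto
  qed (assumption | rule h2 c1 c2 c3 d1 d2 d3 k closed_atLeast)+
qed

section \<open>Prescribed initial and boundary values\<close>

text \<open>
Continuation of a solution to negative times by its value at time zero.  It turns integrals over
the variable range \<open>[0, s]\<close> into integrals over a fixed range, to which Leibniz' rule applies.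
\<close>

lemma DERIV_extend_by_constant:
  fixes h k :: "real \<Rightarrow> real"
  assumes h: "continuous_on {0..} h" and k: "continuous_on {0..} k" and k0: "k 0 = 0"
    and deriv: "\<And>t. 0 < t \<Longrightarrow> (h has_real_derivative k t) (at t)"
  shows "((\<lambda>t. h (max 0 t)) has_real_derivative k (max 0 t)) (at t)"
proof -
  consider "t < 0" | "t = 0" | "0 < t" by linarith
  then show ?thesis
  proof cases
    case 1
    have "((\<lambda>t. h (max 0 t)) has_real_derivative 0) (at t)"
      by (rule has_field_derivative_transform_within_open[of "\<lambda>_. h 0" _ _ "{..<0}"]) (use 1 in auto)
    then show ?thesis using 1 k0 by simp
  next
    case 3
    have "((\<lambda>t. h (max 0 t)) has_real_derivative k t) (at t)"
      by (rule has_field_derivative_transform_within_open[OF deriv[OF 3], of "{0<..}"]) (use 3 in auto)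
    then show ?thesis using 3 by simp
  next
    case 2
    have "((\<lambda>t. (h (max 0 t) - h 0) / t) \<longlongrightarrow> 0) (at 0)"
    proof (rule tendstoI)
      fix e :: real assume e: "0 < e"
      from k k0 e obtain d where d: "0 < d" "\<And>r. 0 \<le> r \<Longrightarrow> r < d \<Longrightarrow> \<bar>k r\<bar> < e"
        unfolding continuous_on_iff by (force simp: dist_real_def)
      show "\<forall>\<^sub>F x in at 0. dist ((h (max 0 x) - h 0) / x) 0 < e"
        unfolding eventually_at
      proof (intro exI[of _ d] conjI ballI impI d(1))
        fix x :: real assume "x \<noteq> 0 \<and> dist x 0 < d"
        then have x: "x \<noteq> 0" "\<bar>x\<bar> < d" by auto
        show "dist ((h (max 0 x) - h 0) / x) 0 < e"
        proof (cases "0 < x")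
          case True
          have cont: "continuous_on {0..x} h" by (rule continuous_on_subset[OF h]) auto
          have "\<exists>z. 0 < z \<and> z < x \<and> h x - h 0 = (x - 0) * k z"
          proof -
            obtain l z where z: "0 < z" "z < x" "(h has_real_derivative l) (at z)" "h x - h 0 = (x - 0) * l"
              using MVT[OF True cont] deriv by (metis real_differentiable_def)
            moreover have "l = k z" using DERIV_unique[OF z(3) deriv[OF z(1)]] .
            ultimately show ?thesis by blast
          qed
          then obtain z where z: "0 < z" "z < x" "h x - h 0 = x * k z" by auto
          then show ?thesis using d(2)[of z] True x by simp
        next
          case False
          then have "x < 0" using x by simp
          then show ?thesis using e by simp
        qed
      qed
    qed
    then show ?thesis using 2 k0 by (simp add: has_field_derivative_iff)
  qed
qed

lemma continuous_on_duhamel: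
  fixes g :: "'z::metric_space \<Rightarrow> real \<Rightarrow> real"
  assumes b: "continuous_on UNIV b" and g: "continuous_on (A \<times> {0..}) (\<lambda>(x, t). g x t)"
  shows "continuous_on (A \<times> S) (\<lambda>(x, s). integral {0..Tm} (\<lambda>r. b r * g x (max 0 (s - r))))"
    and "x \<in> A \<Longrightarrow> (\<lambda>r. b r * g x (max 0 (s - r))) integrable_on {0..Tm}"
    and "continuous_on (A \<times> UNIV) (\<lambda>(x, r). b r * g x (max 0 (s - r)))"
    and "x \<in> A \<Longrightarrow> continuous_on (UNIV \<times> UNIV) (\<lambda>(s, r). b r * g x (max 0 (s - r)))"
proof -
  have b': "continuous_on X (\<lambda>p. b (f p))" if "continuous_on X f" for X and f :: "'y::topological_space \<Rightarrow> real"
    by (rule continuous_on_compose2[OF b that]) simp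
  have g': "continuous_on X (\<lambda>p. g (f p) (h p))" if "continuous_on X f" "continuous_on X h" "\<And>p. p \<in> X \<Longrightarrow> f p \<in> A \<and> 0 \<le> h p"
    for X and f :: "'y::topological_space \<Rightarrow> 'z" and h
    using continuous_on_compose2[OF g continuous_on_Pair[OF that(1,2)]] that(3) by (auto simp: image_subset_iff)
  have "continuous_on ((A \<times> S) \<times> cbox 0 Tm) (\<lambda>(p, r). b r * g (fst p) (max 0 (snd p - r)))"
    unfolding case_prod_beta by (intro continuous_intros b' g') auto
  from integral_continuous_on_param[OF this]
  show "continuous_on (A \<times> S) (\<lambda>(x, s). integral {0..Tm} (\<lambda>r. b r * g x (max 0 (s - r))))"
    by (simp add: case_prod_beta)
  show "continuous_on (A \<times> UNIV) (\<lambda>(x, r). b r * g x (max 0 (s - r)))"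
    unfolding case_prod_beta by (intro continuous_intros b' g') auto
  assume x: "x \<in> A"
  show "(\<lambda>r. b r * g x (max 0 (s - r))) integrable_on {0..Tm}"
    by (intro integrable_continuous_real continuous_intros b' g') (use x in auto)
  show "continuous_on (UNIV \<times> UNIV) (\<lambda>(s, r). b r * g x (max 0 (s - r)))"
    unfolding case_prod_beta by (intro continuous_intros b' g') (use x in auto)
qed

lemma heat_on_const: "heat_on \<epsilon> N Tm (\<lambda>_ _. k) (\<lambda>_ _ _. 0) (\<lambda>_ _ _. 0)"
  unfolding heat_on_def by (auto simp: case_prod_beta)

text \<open>
Taylor's formula of order two with integral remainder.
\<close>

lemma taylor_integral:
  fixes b b1 b2 b3 :: "real \<Rightarrow> real"
  assumes b: "\<And>s. (b has_real_derivative b1 s) (at s)" "\<And>s. (b1 has_real_derivative b2 s) (at s)"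
    "\<And>s. (b2 has_real_derivative b3 s) (at s)" and b3: "continuous_on UNIV b3" and s: "s \<in> {0..Tm}"
  shows "integral {0..Tm} (\<lambda>r. b3 r * ((max 0 (s - r))\<^sup>2 / 2)) = b s - b 0 - b1 0 * s - b2 0 * (s\<^sup>2 / 2)"
proof -
  define f where "f r = b3 r * ((max 0 (s - r))\<^sup>2 / 2)" for r
  have "continuous_on UNIV f" unfolding f_def by (intro continuous_intros b3) auto
  then have int: "f integrable_on {0..Tm}" by (intro integrable_continuous_real) (rule continuous_on_subset, auto)
  define P where "P r = b2 r * ((s - r)\<^sup>2 / 2) + b1 r * (s - r) + b r" for r
  have P: "(P has_real_derivative b3 r * ((s - r)\<^sup>2 / 2)) (at r)" for r
    unfolding P_def[abs_def]
    by (rule derivative_eq_intros b refl | simp)+ (simp add: power2_eq_square field_simps)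
  have "(f has_integral P s - P 0) {0..s}"
  proof (rule fundamental_theorem_of_calculus)
    fix r assume r: "r \<in> {0..s}"
    then have "f r = b3 r * ((s - r)\<^sup>2 / 2)" by (simp add: f_def)
    with P[of r] have "(P has_real_derivative f r) (at r)" by (simp only:)
    then show "(P has_vector_derivative f r) (at r within {0..s})"
      by (simp add: has_real_derivative_iff_has_vector_derivative[symmetric] has_field_derivative_at_within)
  qed (use s in auto)
  moreover have "integral {s..Tm} f = integral {s..Tm} (\<lambda>_. 0)"
    by (rule integral_cong) (auto simp: f_def)
  moreover have "integral {0..s} f + integral {s..Tm} f = integral {0..Tm} f"
    by (rule Henstock_Kurzweil_Integration.integral_combine) (use s int in auto)
  ultimately have "integral {0..Tm} f = P s - P 0"
    by (simp add: integral_unique)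
  then show ?thesis unfolding f_def P_def by simp
qed

text \<open>
The solution is \<open>b 0 + b1 0 * K1 + b2 0 * K2 + W\<close>, where \<open>W\<close> superposes the flows \<open>K2\<close> started at
the times \<open>r\<close> with weight \<open>b3 r\<close>; on the boundary this is Taylor's formula for \<open>b\<close>.
\<close>

lemma boundary_value_solution:
  fixes b b1 b2 b3 :: "real \<Rightarrow> real"
    and N :: "('i, 'j, 'n::finite) net"
  assumes N: "network N" and i0: "bdry_ix N = {i0}" and Tm: "0 < Tm"
    and b: "\<And>s. (b has_real_derivative b1 s) (at s)" "\<And>s. (b1 has_real_derivative b2 s) (at s)"
      "\<And>s. (b2 has_real_derivative b3 s) (at s)" and b3: "continuous_on UNIV b3"
  obtains u ux uxx where "heat_on 1 N Tm u ux uxx" "\<And>x. x \<in> points N \<Longrightarrow> u x 0 = b 0"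
    "\<And>s. s \<in> {0..Tm} \<Longrightarrow> u (vertex N i0) s = b s"
proof -
  obtain K1 K2 K1x K1xx K2x where
    h1: "heat_on 1 N Tm K1 K1x K1xx" and h2: "heat_on 1 N Tm K2 K2x (\<lambda>j y t. K1 (param N j y) t)" and
    c1: "continuous_on (points N \<times> {0..}) (\<lambda>(x, t). K1 x t)" and c2: "continuous_on (points N \<times> {0..}) (\<lambda>(x, t). K2 x t)" and
    c3: "\<And>j. j \<in> edges N \<Longrightarrow> continuous_on ({0..len N j} \<times> {0..}) (\<lambda>(y, t). K2x j y t)" and
    z1: "\<And>x. x \<in> points N \<Longrightarrow> K1 x 0 = 0" and z2: "\<And>x. x \<in> points N \<Longrightarrow> K2 x 0 = 0" and
    v1: "\<And>t. 0 \<le> t \<Longrightarrow> K1 (vertex N i0) t = t" and v2: "\<And>t. 0 \<le> t \<Longrightarrow> K2 (vertex N i0) t = t\<^sup>2 / 2" and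
    d1: "\<And>j y t. j \<in> edges N \<Longrightarrow> y \<in> {0..len N j} \<Longrightarrow> 0 \<le> t \<Longrightarrow>
       ((\<lambda>z. K2 (param N j z) t) has_real_derivative K2x j y t) (at y within {0..len N j})" and
    d2: "\<And>j y t. j \<in> edges N \<Longrightarrow> y \<in> {0..len N j} \<Longrightarrow> 0 \<le> t \<Longrightarrow>
       ((\<lambda>z. K2x j z t) has_real_derivative K1 (param N j y) t) (at y within {0..len N j})" and
    d3: "\<And>j y t. j \<in> edges N \<Longrightarrow> y \<in> {0..len N j} \<Longrightarrow> 0 < t \<Longrightarrow>
       ((\<lambda>r. K2 (param N j y) r) has_real_derivative K1 (param N j y) t) (at t)" and
    k: "\<And>i t. i \<in> trans_ix N \<Longrightarrow> 0 \<le> t \<Longrightarrow> (\<Sum>j\<in>Inc N i. orient N i j * K2x j (out N i j 0) t) = 0"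
    by (rule ramp_solutions[OF N i0, of Tm]) (rule that, assumption+)
  define W where "W x s = integral {0..Tm} (\<lambda>r. b3 r * K2 x (max 0 (s - r)))" for x s
  define Wx where "Wx j y s = integral {0..Tm} (\<lambda>r. b3 r * K2x j y (max 0 (s - r)))" for j y s
  define Wxx where "Wxx j y s = integral {0..Tm} (\<lambda>r. b3 r * K1 (param N j y) (max 0 (s - r)))" for j y s
  note ce1 = continuous_on_edge[OF N _ c1] and ce2 = continuous_on_edge[OF N _ c2]
  have W: "heat_on 1 N Tm W Wx Wxx"
    unfolding heat_on_def
  proof (intro conjI ballI)
    show "continuous_on (points N \<times> {0..Tm}) (\<lambda>(x, s). W x s)"
      unfolding W_def by (rule continuous_on_duhamel(1)[OF b3 c2])
    fix j assume j: "j \<in> edges N"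
    show "continuous_on ({0..len N j} \<times> {0<..<Tm}) (\<lambda>(y, s). Wx j y s)"
      unfolding Wx_def by (rule continuous_on_duhamel(1)[OF b3 c3[OF j]])
    show "continuous_on ({0..len N j} \<times> {0<..<Tm}) (\<lambda>(y, s). Wxx j y s)"
      unfolding Wxx_def by (rule continuous_on_duhamel(1)[OF b3 ce1[OF j]])
    fix s y assume y: "y \<in> {0..len N j}"
    show "((\<lambda>z. W (param N j z) s) has_real_derivative Wx j y s) (at y within {0..len N j})"
      unfolding W_def Wx_def box_real(2)[symmetric]
    proof (rule leibniz_rule_field_derivative)
      fix z r assume z: "z \<in> cbox 0 (len N j)"
      then show "((\<lambda>z. b3 r * K2 (param N j z) (max 0 (s - r))) has_real_derivative b3 r * K2x j z (max 0 (s - r))) (at z within cbox 0 (len N j))"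
        using d1[OF j] by (intro DERIV_cmult) simp
      show "(\<lambda>r. b3 r * K2 (param N j z) (max 0 (s - r))) integrable_on cbox 0 Tm"
        using continuous_on_duhamel(2)[OF b3 ce2[OF j]] z by simp
    next
      show "continuous_on (cbox 0 (len N j) \<times> cbox 0 Tm) (\<lambda>(z, r). b3 r * K2x j z (max 0 (s - r)))"
        by (rule continuous_on_subset[OF continuous_on_duhamel(3)[OF b3 c3[OF j]]]) auto
    qed (use y in auto)
    show "((\<lambda>z. Wx j z s) has_real_derivative Wxx j y s) (at y within {0..len N j})"
      unfolding Wxx_def Wx_def box_real(2)[symmetric]
    proof (rule leibniz_rule_field_derivative)
      fix z r assume z: "z \<in> cbox 0 (len N j)"
      then show "((\<lambda>z. b3 r * K2x j z (max 0 (s - r))) has_real_derivative b3 r * K1 (param N j z) (max 0 (s - r))) (at z within cbox 0 (len N j))"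
        using d2[OF j] by (intro DERIV_cmult) simp
      show "(\<lambda>r. b3 r * K2x j z (max 0 (s - r))) integrable_on cbox 0 Tm"
        using continuous_on_duhamel(2)[OF b3 c3[OF j]] z by simp
    next
      show "continuous_on (cbox 0 (len N j) \<times> cbox 0 Tm) (\<lambda>(z, r). b3 r * K1 (param N j z) (max 0 (s - r)))"
        by (rule continuous_on_subset[OF continuous_on_duhamel(3)[OF b3 ce1[OF j]]]) auto
    qed (use y in auto)
    \<comment> \<open>The continuation of \<open>K2\<close> by zero is differentiable at \<open>t = 0\<close> as well, since \<open>K1\<close> starts at zero.\<close>
    have K2e: "((\<lambda>t. K2 (param N j y) (max 0 t)) has_real_derivative K1 (param N j y) (max 0 t)) (at t)" for t
    proof (rule DERIV_extend_by_constant)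
      have sec: "continuous_on {0..} (f (param N j y))" if "continuous_on (points N \<times> {0..}) (\<lambda>(x, t). f x t)" for f :: "real ^ 'n \<Rightarrow> real \<Rightarrow> real"
      proof -
        have "continuous_on {0..} (\<lambda>t. (\<lambda>(x, t). f x t) (param N j y, t))"
          by (rule continuous_on_compose2[OF that]) (use param_in_points[OF N j y] in \<open>auto intro!: continuous_intros\<close>)
        then show ?thesis by simp
      qed
      show "continuous_on {0..} (K2 (param N j y))" "continuous_on {0..} (K1 (param N j y))" by (rule sec[OF c2], rule sec[OF c1])
      show "K1 (param N j y) 0 = 0" by (rule z1[OF param_in_points[OF N j y]])
    qed (rule d3[OF j y])
    have "((\<lambda>s. integral (cbox 0 Tm) (\<lambda>r. b3 r * K2 (param N j y) (max 0 (s - r)))) has_real_derivative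
        integral (cbox 0 Tm) (\<lambda>r. b3 r * K1 (param N j y) (max 0 (s - r)))) (at s within UNIV)"
    proof (rule leibniz_rule_field_derivative)
      fix s r
      have "((\<lambda>s. K2 (param N j y) (max 0 (s - r))) has_real_derivative K1 (param N j y) (max 0 (s - r)) * 1) (at s)"
        by (rule DERIV_chain2[where g = "\<lambda>s. s - r", OF K2e]) (auto intro!: derivative_eq_intros)
      then show "((\<lambda>s. b3 r * K2 (param N j y) (max 0 (s - r))) has_real_derivative b3 r * K1 (param N j y) (max 0 (s - r))) (at s within UNIV)"
        by (intro DERIV_cmult) simp
      show "(\<lambda>r. b3 r * K2 (param N j y) (max 0 (s - r))) integrable_on cbox 0 Tm"
        using continuous_on_duhamel(2)[OF b3 ce2[OF j] y] by simp
    next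
      show "continuous_on (UNIV \<times> cbox 0 Tm) (\<lambda>(s, r). b3 r * K1 (param N j y) (max 0 (s - r)))"
        by (rule continuous_on_subset[OF continuous_on_duhamel(4)[OF b3 ce1[OF j] y]]) auto
    qed auto
    then show "((\<lambda>r. W (param N j y) r) has_real_derivative 1 * Wxx j y s) (at s)"
      unfolding W_def Wxx_def by simp
  next
    fix i s assume i: "i \<in> trans_ix N"
    have "(\<Sum>j\<in>Inc N i. orient N i j * Wx j (out N i j 0) s)
        = (\<Sum>j\<in>Inc N i. integral {0..Tm} (\<lambda>r. orient N i j * (b3 r * K2x j (out N i j 0) (max 0 (s - r)))))"
      unfolding Wx_def by simp
    also have "\<dots> = integral {0..Tm} (\<lambda>r. \<Sum>j\<in>Inc N i. orient N i j * (b3 r * K2x j (out N i j 0) (max 0 (s - r))))"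
    proof (rule integral_sum[symmetric, OF Inc_finite[OF N]])
      fix j assume j: "j \<in> Inc N i"
      show "(\<lambda>r. orient N i j * (b3 r * K2x j (out N i j 0) (max 0 (s - r)))) integrable_on {0..Tm}"
        using integrable_cmul[OF continuous_on_duhamel(2)[OF b3 c3[OF Inc_edges[OF j]] param_out(2)[OF N trans_ix_verts[OF i] j]],
            of "orient N i j" s] by simp
    qed
    also have "(\<lambda>r. \<Sum>j\<in>Inc N i. orient N i j * (b3 r * K2x j (out N i j 0) (max 0 (s - r)))) = (\<lambda>r. 0)"
    proof
      fix r
      have "(\<Sum>j\<in>Inc N i. orient N i j * (b3 r * K2x j (out N i j 0) (max 0 (s - r))))
          = b3 r * (\<Sum>j\<in>Inc N i. orient N i j * K2x j (out N i j 0) (max 0 (s - r)))"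
        by (simp add: sum_distrib_left mult.left_commute)
      then show "(\<Sum>j\<in>Inc N i. orient N i j * (b3 r * K2x j (out N i j 0) (max 0 (s - r)))) = 0"
        using k[OF i] by simp
    qed
    finally show "(\<Sum>j\<in>Inc N i. orient N i j * Wx j (out N i j 0) s) = 0" by simp
  qed
  note H = heat_on_lincomb[OF heat_on_lincomb[OF heat_on_const[of 1 N Tm "b 0"] h1, of 1 "b1 0"]
      heat_on_lincomb[OF h2 W, of "b2 0" 1], of 1 1]
  show thesis
  proof (rule that[OF H])
    fix x assume x: "x \<in> points N"
    have "W x 0 = integral {0..Tm} (\<lambda>_. 0)"
      unfolding W_def by (rule integral_cong) (use z2[OF x] in auto)
    then show "1 * (1 * b 0 + b1 0 * K1 x 0) + 1 * (b2 0 * K2 x 0 + 1 * W x 0) = b 0"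
      using z1[OF x] z2[OF x] by simp
  next
    fix s assume s: "s \<in> {0..Tm}"
    have "W (vertex N i0) s = integral {0..Tm} (\<lambda>r. b3 r * ((max 0 (s - r))\<^sup>2 / 2))"
      unfolding W_def by (rule integral_cong) (use v2 in \<open>simp only: max.cobounded1\<close>)
    also have "\<dots> = b s - b 0 - b1 0 * s - b2 0 * (s\<^sup>2 / 2)"
      by (rule taylor_integral[OF b b3 s])
    finally show "1 * (1 * b 0 + b1 0 * K1 (vertex N i0) s) + 1 * (b2 0 * K2 (vertex N i0) s + 1 * W (vertex N i0) s) = b s"
      using v1[of s] v2[of s] s by simp
  qed
qed

lemma initial_value_solution:
  assumes N: "network N" and i0: "bdry_ix N = {i0}" and f: "continuous_on (points N) f" "f (vertex N i0) = 0"
  obtains u ux uxx where "heat_on 1 N Tm u ux uxx" "\<And>x. x \<in> points N \<Longrightarrow> u x 0 = f x"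
    "\<And>s. u (vertex N i0) s = 0"
proof -
  have i0v: "i0 \<in> verts N" using i0 by (auto simp: bdry_ix_def)
  have D: "image_data N i0 (\<lambda>_. 0) f" using N i0v f by (simp add: image_data_def)
  obtain F where F: "images N i0 (\<lambda>_. 0) f F" using images_exist[OF D, of 0] by auto
  note t = tame_const[of 0]
  show thesis
  proof (rule that[OF image_flow_heat[OF N F t i0] image_flow_initial[OF N F t]])
    show "image_flow N F (vertex N i0) s = 0" for s
      unfolding image_flow_boundary[OF N F t i0v] by (simp add: gavg_def)
  qed
qed

section \<open>Balance of mass and positivity of the flux\<close>

lemma continuous_on_swap:
  assumes "continuous_on (A \<times> B) (\<lambda>(x, y). f x y)"
  shows "continuous_on (B \<times> A) (\<lambda>(y, x). f x y)"
proof -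
  have "continuous_on (B \<times> A) (\<lambda>p. (\<lambda>(x, y). f x y) (snd p, fst p))"
    by (rule continuous_on_compose2[OF assms]) (auto intro!: continuous_intros)
  then show ?thesis by (simp add: case_prod_beta)
qed

text \<open>
Differentiating under the integral, the two heat equations with opposite signs leave
\<open>\<phi> \<psi>\<^sub>x\<^sub>x - \<phi>\<^sub>x\<^sub>x \<psi>\<close>, the space derivative of \<open>g = \<phi> \<psi>\<^sub>x - \<phi>\<^sub>x \<psi>\<close>.  The end point values of \<open>g\<close> collect into
vertex sums, which vanish at transition vertices by the Kirchhoff conditions, since \<open>\<phi>\<close> and \<open>\<psi>\<close> take a single
value there.
\<close>

lemma mass_balance:
  assumes N: "network N" and i0: "bdry_ix N = {i0}" and j0: "Inc N i0 = {j0}" "param N j0 0 = vertex N i0"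
    and \<phi>: "heat_on (- 1) N Tm \<phi> \<phi>x \<phi>xx" and \<psi>: "heat_on 1 N Tm \<psi> \<psi>x \<psi>xx"
    and bdry: "\<And>s. s \<in> {0<..<Tm} \<Longrightarrow> \<psi> (vertex N i0) s = 0"
  defines "M \<equiv> \<lambda>s. net_integral N (\<lambda>x. \<phi> x s * \<psi> x s)"
  shows "continuous_on {0..Tm} M"
    and "\<And>s. s \<in> {0<..<Tm} \<Longrightarrow> (M has_real_derivative - (\<phi> (vertex N i0) s * \<psi>x j0 0 s)) (at s)"
proof -
  define \<rho> where "\<rho> j y s = \<phi> (param N j y) s * \<psi> (param N j y) s" for j y s
  define g where "g j y s = \<phi> (param N j y) s * \<psi>x j y s - \<phi>x j y s * \<psi> (param N j y) s" for j y s
  define h where "h j y s = \<phi> (param N j y) s * \<psi>xx j y s - \<phi>xx j y s * \<psi> (param N j y) s" for j y s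
  have M: "M = (\<lambda>s. \<Sum>j\<in>edges N. integral {0..len N j} (\<lambda>y. \<rho> j y s))"
    unfolding M_def net_integral_def \<rho>_def ..
  have c\<rho>: "continuous_on ({0..len N j} \<times> {0..Tm}) (\<lambda>(y, s). \<rho> j y s)" if j: "j \<in> edges N" for j
    using continuous_on_mult[OF continuous_on_edge[OF N j heat_onD(1)[OF \<phi>]] continuous_on_edge[OF N j heat_onD(1)[OF \<psi>]]]
    by (simp add: \<rho>_def case_prod_beta)
  show "continuous_on {0..Tm} M"
    unfolding M
  proof (rule continuous_on_sum)
    fix j assume j: "j \<in> edges N"
    from integral_continuous_on_param[of "{0..Tm}" 0 "len N j" "\<lambda>s y. \<rho> j y s"] continuous_on_swap[OF c\<rho>[OF j]]
    show "continuous_on {0..Tm} (\<lambda>s. integral {0..len N j} (\<lambda>y. \<rho> j y s))" by simp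
  qed
  fix s assume s: "s \<in> {0<..<Tm}"
  have d: "((\<lambda>s. integral {0..len N j} (\<lambda>y. \<rho> j y s)) has_real_derivative (g j (len N j) s - g j 0 s)) (at s)"
    if j: "j \<in> edges N" for j
  proof -
    have sub: "{0..len N j} \<times> {0<..<Tm} \<subseteq> {0..len N j} \<times> {0..Tm}" by auto
    have ch: "continuous_on ({0..len N j} \<times> {0<..<Tm}) (\<lambda>(y, s). h j y s)"
      using continuous_on_diff[OF
          continuous_on_mult[OF continuous_on_subset[OF continuous_on_edge[OF N j heat_onD(1)[OF \<phi>]] sub] heat_onD(3)[OF \<psi> j]]
          continuous_on_mult[OF heat_onD(3)[OF \<phi> j] continuous_on_subset[OF continuous_on_edge[OF N j heat_onD(1)[OF \<psi>]] sub]]]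
      by (simp add: h_def case_prod_beta)
    have "((\<lambda>s. integral (cbox 0 (len N j)) (\<lambda>y. \<rho> j y s)) has_real_derivative integral (cbox 0 (len N j)) (\<lambda>y. h j y s)) (at s within {0<..<Tm})"
    proof (rule leibniz_rule_field_derivative)
      fix r y assume r: "r \<in> {0<..<Tm}" and y: "y \<in> cbox 0 (len N j)"
      then have y': "y \<in> {0..len N j}" by simp
      have "((\<lambda>r. \<rho> j y r) has_real_derivative \<phi> (param N j y) r * (1 * \<psi>xx j y r) + (- 1 * \<phi>xx j y r) * \<psi> (param N j y) r) (at r)"
        unfolding \<rho>_def by (rule DERIV_mult'[OF heat_onD(6)[OF \<phi> j r y'] heat_onD(6)[OF \<psi> j r y']])
      then have "((\<lambda>r. \<rho> j y r) has_real_derivative h j y r) (at r)" by (simp add: h_def)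
      then show "((\<lambda>r. \<rho> j y r) has_real_derivative h j y r) (at r within {0<..<Tm})"
        by (rule has_field_derivative_at_within)
    next
      fix r assume r: "r \<in> {0<..<Tm}"
      have "continuous_on {0..len N j} (\<lambda>y. (\<lambda>(y, s). \<rho> j y s) (y, r))"
        by (rule continuous_on_compose2[OF c\<rho>[OF j]]) (use r in \<open>auto intro!: continuous_intros\<close>)
      then show "(\<lambda>y. \<rho> j y r) integrable_on cbox 0 (len N j)"
        by (simp add: integrable_continuous_real)
    next
      show "continuous_on ({0<..<Tm} \<times> cbox 0 (len N j)) (\<lambda>(s, y). h j y s)"
        using continuous_on_swap[OF ch] by simp
    qed (use s in auto)
    then have 1: "((\<lambda>s. integral {0..len N j} (\<lambda>y. \<rho> j y s)) has_real_derivative integral {0..len N j} (\<lambda>y. h j y s)) (at s)"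
      using s by (simp add: at_within_open[OF s])
    have "((\<lambda>y. h j y s) has_integral g j (len N j) s - g j 0 s) {0..len N j}"
    proof (rule fundamental_theorem_of_calculus)
      fix y assume y: "y \<in> {0..len N j}"
      have "((\<lambda>y. g j y s) has_real_derivative (\<phi> (param N j y) s * \<psi>xx j y s + \<phi>x j y s * \<psi>x j y s)
          - (\<phi>x j y s * \<psi>x j y s + \<phi>xx j y s * \<psi> (param N j y) s)) (at y within {0..len N j})"
        unfolding g_def
        by (intro DERIV_diff DERIV_mult' heat_onD(4)[OF \<phi> j s y] heat_onD(4)[OF \<psi> j s y] heat_onD(5)[OF \<phi> j s y] heat_onD(5)[OF \<psi> j s y])
      then show "((\<lambda>y. g j y s) has_vector_derivative h j y s) (at y within {0..len N j})"
        by (simp add: h_def has_real_derivative_iff_has_vector_derivative)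
    qed (use network_len[OF N j] in simp)
    with 1 show ?thesis by (simp add: integral_unique)
  qed
  have "(M has_real_derivative (\<Sum>j\<in>edges N. g j (len N j) s - g j 0 s)) (at s)"
    unfolding M by (intro DERIV_sum d)
  moreover have "(\<Sum>j\<in>edges N. g j (len N j) s - g j 0 s) = - (\<phi> (vertex N i0) s * \<psi>x j0 0 s)"
  proof -
    define e where "e i j = orient N i j * g j (out N i j 0) s" for i j
    have "(\<Sum>j\<in>edges N. g j (len N j) s - g j 0 s) = - (\<Sum>j\<in>edges N. e (start_ix N j) j + e (end_ix N j) j)"
      unfolding sum_negf[symmetric]
      by (rule sum.cong) (simp_all add: e_def orient_start[OF N] orient_end[OF N] out_start[OF N] out_end[OF N])
    also have "\<dots> = - (\<Sum>i\<in>verts N. \<Sum>j\<in>Inc N i. e i j)"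
      by (simp only: sum_vertices_eq_sum_edges[OF N])
    also have "verts N = insert i0 (trans_ix N)" using i0 by (auto simp: trans_ix_def bdry_ix_def)
    also have "(\<Sum>i\<in>insert i0 (trans_ix N). \<Sum>j\<in>Inc N i. e i j) = (\<Sum>j\<in>Inc N i0. e i0 j) + (\<Sum>i\<in>trans_ix N. \<Sum>j\<in>Inc N i. e i j)"
      using i0 network_finite[OF N] by (intro sum.insert) (auto simp: trans_ix_def)
    also have "(\<Sum>i\<in>trans_ix N. \<Sum>j\<in>Inc N i. e i j) = 0"
    proof (rule sum.neutral, rule ballI)
      fix i assume i: "i \<in> trans_ix N"
      have "(\<Sum>j\<in>Inc N i. e i j) = (\<Sum>j\<in>Inc N i. \<phi> (vertex N i) s * (orient N i j * \<psi>x j (out N i j 0) s)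
          - \<psi> (vertex N i) s * (orient N i j * \<phi>x j (out N i j 0) s))"
        by (rule sum.cong[OF refl])
           (simp add: e_def g_def param_out(1)[OF N trans_ix_verts[OF i]] algebra_simps)
      also have "\<dots> = \<phi> (vertex N i) s * (\<Sum>j\<in>Inc N i. orient N i j * \<psi>x j (out N i j 0) s)
          - \<psi> (vertex N i) s * (\<Sum>j\<in>Inc N i. orient N i j * \<phi>x j (out N i j 0) s)"
        by (simp add: sum_subtractf sum_distrib_left)
      also have "\<dots> = 0" using heat_onD(7)[OF \<phi> i s] heat_onD(7)[OF \<psi> i s] by simp
      finally show "(\<Sum>j\<in>Inc N i. e i j) = 0" .
    qed
    also have "(\<Sum>j\<in>Inc N i0. e i0 j) = \<phi> (vertex N i0) s * \<psi>x j0 0 s"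
    proof -
      have "vertex N i0 \<in> edge_set N j0" using j0(1) by (auto simp: Inc_def)
      then have "orient N i0 j0 = 1" "out N i0 j0 0 = 0" using j0(2) by (auto simp: orient_def out_def)
      then show ?thesis using j0 bdry[OF s] by (simp add: e_def g_def)
    qed
    finally show ?thesis by simp
  qed
  ultimately show "(M has_real_derivative - (\<phi> (vertex N i0) s * \<psi>x j0 0 s)) (at s)" by simp
qed

text \<open>
The barrier \<open>p y s = \<epsilon> * exp (- c\<^sup>2 * s) * sin (c * y)\<close> with \<open>c = pi / \<delta>\<close> solves the heat equation on
\<open>[0, \<delta>]\<close> with zero boundary values, and it starts below \<open>\<kappa> * y\<close>, as \<open>sin x \<le> x\<close>.  It therefore stays
below \<open>\<psi>\<close>, and since both vanish at \<open>0\<close> their slopes there compare.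
\<close>

lemma boundary_derivative_positive:
  assumes N: "network N" and \<psi>: "heat_on 1 N Tm \<psi> \<psi>x \<psi>xx" and j: "j \<in> edges N"
    and \<delta>: "0 < \<delta>" "\<delta> \<le> len N j" and \<kappa>: "0 < \<kappa>"
    and init: "\<And>y. y \<in> {0..\<delta>} \<Longrightarrow> \<kappa> * y \<le> \<psi> (param N j y) 0"
    and nonneg: "\<And>x s. x \<in> points N \<Longrightarrow> s \<in> {0..Tm} \<Longrightarrow> 0 \<le> \<psi> x s"
    and zero: "\<And>s. s \<in> {0..Tm} \<Longrightarrow> \<psi> (param N j 0) s = 0"
    and s: "s \<in> {0<..<Tm}"
  shows "0 < \<psi>x j 0 s"
proof -
  define c where "c = pi / \<delta>"
  \<comment> \<open>With this amplitude the barrier starts with slope \<open>\<kappa>\<close>.\<close>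
  define \<epsilon> where "\<epsilon> = \<kappa> / c"
  have c: "0 < c" and \<epsilon>: "0 < \<epsilon>" using \<delta> \<kappa> by (auto simp: c_def \<epsilon>_def)
  define p where "p y s = \<epsilon> * exp (- c\<^sup>2 * s) * sin (c * y)" for y s
  define w where "w y s = p y s - \<psi> (param N j y) s" for y s
  have sub: "{0..\<delta>} \<subseteq> {0..len N j}" using \<delta> by auto
  have py: "((\<lambda>y. p y s) has_real_derivative c * \<epsilon> * exp (- c\<^sup>2 * s) * cos (c * y)) (at y within S)" for y s S
    unfolding p_def by (auto intro!: derivative_eq_intros)
  have pyy: "((\<lambda>y. c * \<epsilon> * exp (- c\<^sup>2 * s) * cos (c * y)) has_real_derivative - c\<^sup>2 * p y s) (at y within S)" for y s S
    unfolding p_def by (auto intro!: derivative_eq_intros simp: power2_eq_square)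
  have pt: "((\<lambda>s. p y s) has_real_derivative - c\<^sup>2 * p y s) (at s)" for y s
    unfolding p_def by (auto intro!: derivative_eq_intros)
  have p\<delta>: "p \<delta> s = 0" "p 0 s = 0" for s using \<delta> by (auto simp: p_def c_def)
  have wy: "((\<lambda>y. w y r) has_real_derivative c * \<epsilon> * exp (- c\<^sup>2 * r) * cos (c * y) - \<psi>x j y r) (at y within {0..\<delta>})"
    and wyy: "((\<lambda>y. c * \<epsilon> * exp (- c\<^sup>2 * r) * cos (c * y) - \<psi>x j y r) has_real_derivative - c\<^sup>2 * p y r - \<psi>xx j y r) (at y within {0..\<delta>})"
    if r: "r \<in> {0<..<Tm}" and y: "y \<in> {0..\<delta>}" for y r
  proof -
    have y': "y \<in> {0..len N j}" using y sub by auto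
    show "((\<lambda>y. w y r) has_real_derivative c * \<epsilon> * exp (- c\<^sup>2 * r) * cos (c * y) - \<psi>x j y r) (at y within {0..\<delta>})"
      unfolding w_def by (rule DERIV_diff[OF py DERIV_subset[OF heat_onD(4)[OF \<psi> j r y'] sub]])
    show "((\<lambda>y. c * \<epsilon> * exp (- c\<^sup>2 * r) * cos (c * y) - \<psi>x j y r) has_real_derivative - c\<^sup>2 * p y r - \<psi>xx j y r) (at y within {0..\<delta>})"
      by (rule DERIV_diff[OF pyy DERIV_subset[OF heat_onD(5)[OF \<psi> j r y'] sub]])
  qed
  have Tm: "0 < Tm" using s by auto
  have w: "w y r \<le> 0" if "y \<in> {0..\<delta>}" "r \<in> {0..Tm}" for y r
  proof (rule parabolic_maximum_principle[of "{0..\<delta>}" Tm w 0 y r])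
    have "continuous_on ({0..\<delta>} \<times> {0..Tm}) (\<lambda>(y, s). \<psi> (param N j y) s)"
      by (rule continuous_on_subset[OF continuous_on_edge[OF N j heat_onD(1)[OF \<psi>]]]) (use sub in auto)
    then show "continuous_on ({0..\<delta>} \<times> {0..Tm}) (\<lambda>(y, s). w y s)"
      unfolding w_def p_def case_prod_beta by (intro continuous_intros)
  next
    fix y assume y: "y \<in> {0..\<delta>}"
    have "p y 0 \<le> \<epsilon> * (c * y)" unfolding p_def using \<epsilon> c y by (auto intro!: mult_left_mono sin_x_le_x)
    also have "\<dots> = \<kappa> * y" using c by (simp add: \<epsilon>_def)
    finally show "w y 0 \<le> 0" using init[OF y] by (simp add: w_def)
  next
    fix y r assume y: "y \<in> {0..\<delta>}" and r0: "0 < r" "r < Tm" and pos: "0 < w y r"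
      and max: "\<And>z. z \<in> {0..\<delta>} \<Longrightarrow> w z r \<le> w y r"
    have r: "r \<in> {0<..<Tm}" "r \<in> {0..Tm}" using r0 by auto
    have y': "y \<in> {0..len N j}" using y sub by auto
    have "\<psi> (param N j y) r \<ge> 0" by (rule nonneg[OF param_in_points[OF N j y'] r(2)])
    with pos p\<delta>[of r] have "y \<noteq> 0" "y \<noteq> \<delta>" by (auto simp: w_def)
    with y have yi: "0 < y" "y < \<delta>" by auto
    have "c * \<epsilon> * exp (- c\<^sup>2 * r) * cos (c * y) - \<psi>x j y r = 0"
      using deriv_at_interval_max[OF y max wy[OF r(1) y]] yi by force
    from second_deriv_at_interval_max[OF \<delta>(1) y max wy[OF r(1)] wyy[OF r(1) y] this]
    have "- c\<^sup>2 * p y r - \<psi>xx j y r \<le> 0" by simp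
    moreover have "((\<lambda>r. w y r) has_real_derivative - c\<^sup>2 * p y r - 1 * \<psi>xx j y r) (at r)"
      unfolding w_def by (rule DERIV_diff[OF pt heat_onD(6)[OF \<psi> j r(1) y']])
    ultimately show "\<exists>d\<le>0. (w y has_real_derivative d) (at r)"
      by (intro exI[of _ "- c\<^sup>2 * p y r - 1 * \<psi>xx j y r"]) simp
  qed (use that Tm in auto)
  have "w 0 s = 0" using zero[of s] s p\<delta>(2)[of s] by (simp add: w_def)
  then have "\<And>z. z \<in> {0..\<delta>} \<Longrightarrow> w z s \<le> w 0 s" using w s by simp
  from deriv_at_interval_max(1)[OF _ this wy[OF s]] \<delta>
  have "c * \<epsilon> * exp (- c\<^sup>2 * s) * cos (c * 0) - \<psi>x j 0 s \<le> 0" by simp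
  moreover have "0 < c * \<epsilon> * exp (- c\<^sup>2 * s) * cos (c * 0)" using c \<epsilon> by simp
  ultimately show ?thesis by linarith
qed

section \<open>The quorum rule\<close>

lemma quorum_time_range:
  assumes "t0 \<le> Tmax" shows "quorum_time t0 Tmax \<theta> F \<in> {t0..Tmax}"
proof -
  consider "quantile Tmax F \<theta> \<le> ereal t0" | "ereal t0 < quantile Tmax F \<theta>" "quantile Tmax F \<theta> < ereal Tmax"
    | "ereal Tmax \<le> quantile Tmax F \<theta>" by force
  then show ?thesis
  proof cases
    case 2
    then obtain r where "quantile Tmax F \<theta> = ereal r" by (cases "quantile Tmax F \<theta>") auto
    with 2 show ?thesis by (auto simp: quorum_time_def)
  qed (use assms in \<open>auto simp: quorum_time_def\<close>)
qed

lemma quorum_time_cong: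
  assumes "\<And>s. s \<in> {0..Tmax} \<Longrightarrow> F s = G s"
  shows "quorum_time t0 Tmax \<theta> F = quorum_time t0 Tmax \<theta> G"
proof -
  have "{s \<in> {0..Tmax}. F s \<ge> \<theta>} = {s \<in> {0..Tmax}. G s \<ge> \<theta>}" using assms by auto
  then show ?thesis unfolding quorum_time_def quantile_def by simp
qed

lemma quorum_time_early:
  assumes "0 \<le> t0" "t0 \<le> Tmax" "\<theta> \<le> F t0"
  shows "quorum_time t0 Tmax \<theta> F = t0"
proof -
  have "quantile Tmax F \<theta> \<le> ereal t0"
    unfolding quantile_def by (rule Inf_lower) (use assms in auto)
  then show ?thesis by (simp add: quorum_time_def)
qed

lemma quorum_time_never:
  assumes "t0 \<le> Tmax" "\<And>s. s \<in> {0..Tmax} \<Longrightarrow> F s < \<theta>"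
  shows "quorum_time t0 Tmax \<theta> F = Tmax"
proof -
  have "\<not> \<theta> \<le> F s" if "s \<in> {0..Tmax}" for s using assms(2)[OF that] by simp
  then have "{s \<in> {0..Tmax}. F s \<ge> \<theta>} = {}" by blast
  then have "quantile Tmax F \<theta> = \<infinity>" unfolding quantile_def by (simp only: image_empty Inf_empty top_ereal_def)
  then show ?thesis by (simp add: quorum_time_def)
qed

text \<open>
Strict monotonicity makes the point where \<open>F\<close> takes the value \<open>\<theta>\<close> the first one where it reaches
\<open>\<theta>\<close>.
\<close>

lemma quorum_time_attained:
  assumes T: "0 \<le> t0" "t0 \<le> T" "T \<le> Tmax" and F: "F T = \<theta>" and mono: "strict_mono_on {0..Tmax} F"
  shows "quorum_time t0 Tmax \<theta> F = T"
proof -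
  have "quantile Tmax F \<theta> = ereal T"
    unfolding quantile_def
  proof (rule antisym)
    show "Inf (ereal ` {s \<in> {0..Tmax}. \<theta> \<le> F s}) \<le> ereal T"
      by (rule Inf_lower) (use T F in auto)
    show "ereal T \<le> Inf (ereal ` {s \<in> {0..Tmax}. \<theta> \<le> F s})"
    proof (rule Inf_greatest, clarsimp)
      fix s assume s: "\<theta> \<le> F s" "0 \<le> s" "s \<le> Tmax"
      show "T \<le> s"
      proof (rule ccontr)
        assume "\<not> T \<le> s"
        with s T have "F s < F T" by (intro strict_mono_onD[OF mono]) auto
        with s F show False by simp
      qed
    qed
  qed
  then show ?thesis using T by (auto simp: quorum_time_def)
qed

section \<open>The coupled system\<close>

text \<open>
The regularity of the boundary values in time that \<open>boundary_value_solution\<close> asks for.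
\<close>

definition thrice_diff :: "(real \<Rightarrow> real) \<Rightarrow> bool" where
  "thrice_diff f \<longleftrightarrow> (\<exists>f1 f2 f3. (\<forall>s. (f has_real_derivative f1 s) (at s)) \<and> (\<forall>s. (f1 has_real_derivative f2 s) (at s)) \<and>
     (\<forall>s. (f2 has_real_derivative f3 s) (at s)) \<and> continuous_on UNIV f3)"

lemma smooth_on_DERIV:
  assumes "smooth_on UNIV (f :: real \<Rightarrow> real)"
  shows "(iter_deriv UNIV k f has_real_derivative iter_deriv UNIV (Suc k) f s) (at s)"
  using assms vector_derivative_works[of "iter_deriv UNIV k f" "at s"]
  by (simp add: smooth_on_def iter_deriv_simps has_real_derivative_iff_has_vector_derivative)

lemma smooth_on_continuous: "smooth_on UNIV (f :: real \<Rightarrow> real) \<Longrightarrow> continuous_on UNIV (iter_deriv UNIV k f)"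
  using smooth_on_DERIV by (meson DERIV_continuous_on has_field_derivative_at_within)

lemma thrice_diff_smooth:
  assumes "smooth_on UNIV (f :: real \<Rightarrow> real)" shows "thrice_diff f"
  unfolding thrice_diff_def
  using smooth_on_DERIV[OF assms, of 0] smooth_on_DERIV[OF assms, of 1] smooth_on_DERIV[OF assms, of 2]
    smooth_on_continuous[OF assms, of 3]
  by (intro exI[of _ "iter_deriv UNIV 1 f"] exI[of _ "iter_deriv UNIV 2 f"] exI[of _ "iter_deriv UNIV 3 f"])
     (simp add: iter_deriv_simps(1) numeral_2_eq_2 numeral_3_eq_3)

lemma thrice_diff_add:
  assumes "thrice_diff f" "thrice_diff g" shows "thrice_diff (\<lambda>s. f s + g s)"
proof -
  from assms(1) obtain f1 f2 f3 where f: "\<And>s. (f has_real_derivative f1 s) (at s)" "\<And>s. (f1 has_real_derivative f2 s) (at s)"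
     "\<And>s. (f2 has_real_derivative f3 s) (at s)" "continuous_on UNIV f3" unfolding thrice_diff_def by blast
  from assms(2) obtain g1 g2 g3 where g: "\<And>s. (g has_real_derivative g1 s) (at s)" "\<And>s. (g1 has_real_derivative g2 s) (at s)"
     "\<And>s. (g2 has_real_derivative g3 s) (at s)" "continuous_on UNIV g3" unfolding thrice_diff_def by blast
  show ?thesis unfolding thrice_diff_def
    by (intro exI[of _ "\<lambda>s. f1 s + g1 s"] exI[of _ "\<lambda>s. f2 s + g2 s"] exI[of _ "\<lambda>s. f3 s + g3 s"] conjI allI
        DERIV_add f g continuous_intros)
qed

lemma thrice_diff_affine:
  assumes "thrice_diff f" shows "thrice_diff (\<lambda>s. f (a + b * s))"
proof -
  from assms(1) obtain f1 f2 f3 where f: "\<And>s. (f has_real_derivative f1 s) (at s)" "\<And>s. (f1 has_real_derivative f2 s) (at s)"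
     "\<And>s. (f2 has_real_derivative f3 s) (at s)" "continuous_on UNIV f3" unfolding thrice_diff_def by blast
  have ch: "((\<lambda>s. k * g (a + b * s)) has_real_derivative (k * b) * g' (a + b * s)) (at s)"
    if "\<And>s. (g has_real_derivative g' s) (at s)" for g g' k s
  proof -
    have "((\<lambda>s. g (a + b * s)) has_real_derivative g' (a + b * s) * b) (at s)"
      by (rule DERIV_chain2[OF that]) (auto intro!: derivative_eq_intros)
    from DERIV_cmult[OF this, of k] show ?thesis by (simp add: mult_ac)
  qed
  have "continuous_on UNIV (\<lambda>s. (1 * b * b * b) * f3 (a + b * s))"
    by (intro continuous_intros continuous_on_compose2[OF f(4)]) auto
  then show ?thesis unfolding thrice_diff_def
    using ch[OF f(1), of 1] ch[OF f(2), of "1 * b"] ch[OF f(3), of "1 * b * b"]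
    by (intro exI[of _ "\<lambda>s. (1 * b) * f1 (a + b * s)"] exI[of _ "\<lambda>s. (1 * b * b) * f2 (a + b * s)"]
        exI[of _ "\<lambda>s. (1 * b * b * b) * f3 (a + b * s)"]) auto
qed

lemma thrice_diff_exp:
  assumes "thrice_diff f" shows "thrice_diff (\<lambda>s. exp (f s))"
proof -
  from assms(1) obtain f1 f2 f3 where f: "\<And>s. (f has_real_derivative f1 s) (at s)" "\<And>s. (f1 has_real_derivative f2 s) (at s)"
     "\<And>s. (f2 has_real_derivative f3 s) (at s)" "continuous_on UNIV f3" unfolding thrice_diff_def by blast
  have c: "continuous_on UNIV f" "continuous_on UNIV f1" "continuous_on UNIV f2"
    using f(1-3) by (meson DERIV_continuous_on has_field_derivative_at_within)+
  show ?thesis unfolding thrice_diff_def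
  proof (intro exI conjI allI)
    fix s
    show "((\<lambda>s. exp (f s)) has_real_derivative exp (f s) * f1 s) (at s)"
      by (auto intro!: derivative_eq_intros f(1))
    show "((\<lambda>s. exp (f s) * f1 s) has_real_derivative exp (f s) * (f2 s + (f1 s)\<^sup>2)) (at s)"
      by (auto intro!: derivative_eq_intros f(1,2) simp: power2_eq_square algebra_simps)
    show "((\<lambda>s. exp (f s) * (f2 s + (f1 s)\<^sup>2)) has_real_derivative exp (f s) * (f3 s + 3 * f1 s * f2 s + (f1 s)^3)) (at s)"
      by (auto intro!: derivative_eq_intros f(1-3) simp: power2_eq_square power3_eq_cube algebra_simps)
    show "continuous_on UNIV (\<lambda>s. exp (f s) * (f3 s + 3 * f1 s * f2 s + (f1 s)^3))"
      by (intro continuous_intros c f(4))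
  qed
qed

lemma thrice_diff_cost:
  assumes "\<forall>f\<in>{c1, c2, c3}. smooth_on UNIV f"
  shows "thrice_diff (\<lambda>s. cost c1 c2 c3 t0 T (Tm - s))"
proof -
  have "thrice_diff (\<lambda>s. c1 ((Tm - t0) + (-1) * s) + c2 ((Tm - T) + (-1) * s) + c3 ((T - Tm) + 1 * s))"
    using assms by (intro thrice_diff_add thrice_diff_affine thrice_diff_smooth) auto
  moreover have "(\<lambda>s. c1 ((Tm - t0) + (-1) * s) + c2 ((Tm - T) + (-1) * s) + c3 ((T - Tm) + 1 * s))
      = (\<lambda>s. cost c1 c2 c3 t0 T (Tm - s))"
    by (auto simp: cost_def algebra_simps)
  ultimately show ?thesis by simp
qed

lemma heat_on_abs_bound:
  assumes N: "network N" and i0: "bdry_ix N = {i0}" and Tm: "0 < Tm" and u: "heat_on 1 N Tm u ux uxx"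
    and init: "\<And>x. x \<in> points N \<Longrightarrow> \<bar>u x 0\<bar> \<le> M"
    and bdry: "\<And>s. s \<in> {0..Tm} \<Longrightarrow> \<bar>u (vertex N i0) s\<bar> \<le> M"
    and x: "x \<in> points N" and s: "s \<in> {0..Tm}"
  shows "\<bar>u x s\<bar> \<le> M"
proof (rule abs_leI)
  show "u x s \<le> M"
    by (rule heat_on_maximum[OF N Tm u _ _ x s]) (use init bdry i0 in \<open>force+\<close>)
  have "-1 * u x s + 0 * u x s \<le> M"
    by (rule heat_on_maximum[OF N Tm heat_on_lincomb[OF u u] _ _ x s]) (use init bdry i0 in \<open>force+\<close>)
  then show "- u x s \<le> M" by simp
qed

lemma heat_on_lower_bound:
  assumes N: "network N" and i0: "bdry_ix N = {i0}" and Tm: "0 < Tm" and u: "heat_on 1 N Tm u ux uxx"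
    and init: "\<And>x. x \<in> points N \<Longrightarrow> M \<le> u x 0"
    and bdry: "\<And>s. s \<in> {0..Tm} \<Longrightarrow> M \<le> u (vertex N i0) s"
    and x: "x \<in> points N" and s: "s \<in> {0..Tm}"
  shows "M \<le> u x s"
proof -
  have "-1 * u x s + 0 * u x s \<le> - M"
    by (rule heat_on_maximum[OF N Tm heat_on_lincomb[OF u u] _ _ x s]) (use init bdry i0 in \<open>force+\<close>)
  then show ?thesis by simp
qed

lemma is_solutionD:
  assumes "is_solution N i0 Tm m0 cT \<phi> \<psi>"
  shows "classical N Tm \<phi>" "classical N Tm \<psi>" "kirchhoff N Tm \<phi>" "kirchhoff N Tm \<psi>"
    and "x \<in> points N \<Longrightarrow> s \<in> {0..Tm} \<Longrightarrow> 0 < \<phi> x s"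
    and "j \<in> edges N \<Longrightarrow> y \<in> {0<..<len N j} \<Longrightarrow> s \<in> {0<..<Tm} \<Longrightarrow> time_deriv N j \<phi> y s = - 1 * edge_deriv N 2 j (\<lambda>x. \<phi> x s) y"
    and "j \<in> edges N \<Longrightarrow> y \<in> {0<..<len N j} \<Longrightarrow> s \<in> {0<..<Tm} \<Longrightarrow> time_deriv N j \<psi> y s = 1 * edge_deriv N 2 j (\<lambda>x. \<psi> x s) y"
    and "x \<in> points N \<Longrightarrow> \<psi> x 0 = m0 x / \<phi> x 0" "x \<in> points N \<Longrightarrow> \<phi> x Tm = exp (cT Tm)"
    and "s \<in> {0..Tm} \<Longrightarrow> \<psi> (vertex N i0) s = 0" "s \<in> {0..Tm} \<Longrightarrow> \<phi> (vertex N i0) s = exp (cT s)"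
proof -
  note sol = assms[unfolded is_solution_def]
  show "classical N Tm \<phi>" "classical N Tm \<psi>" "kirchhoff N Tm \<phi>" "kirchhoff N Tm \<psi>"
    and "x \<in> points N \<Longrightarrow> s \<in> {0..Tm} \<Longrightarrow> 0 < \<phi> x s"
    and "x \<in> points N \<Longrightarrow> \<psi> x 0 = m0 x / \<phi> x 0" "x \<in> points N \<Longrightarrow> \<phi> x Tm = exp (cT Tm)"
    and "s \<in> {0..Tm} \<Longrightarrow> \<psi> (vertex N i0) s = 0" "s \<in> {0..Tm} \<Longrightarrow> \<phi> (vertex N i0) s = exp (cT s)"
    using sol by blast+
  assume "j \<in> edges N" "y \<in> {0<..<len N j}" "s \<in> {0<..<Tm}"
  with sol have "- time_deriv N j \<phi> y s - edge_deriv N 2 j (\<lambda>x. \<phi> x s) y = 0 \<and>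
      time_deriv N j \<psi> y s - edge_deriv N 2 j (\<lambda>x. \<psi> x s) y = 0" by blast
  then show "time_deriv N j \<phi> y s = - 1 * edge_deriv N 2 j (\<lambda>x. \<phi> x s) y"
    "time_deriv N j \<psi> y s = 1 * edge_deriv N 2 j (\<lambda>x. \<psi> x s) y" by linarith+
qed

lemma is_solution_heat_on:
  assumes N: "network N" and sol: "is_solution N i0 Tm m0 cT \<phi> \<psi>"
  obtains \<phi>x \<phi>xx \<psi>x \<psi>xx where "heat_on (- 1) N Tm \<phi> \<phi>x \<phi>xx" "heat_on 1 N Tm \<psi> \<psi>x \<psi>xx"
  using classical_imp_heat_on[OF N is_solutionD(1,3,6)[OF sol]] classical_imp_heat_on[OF N is_solutionD(2,4,7)[OF sol]] that
  by blast

text \<open>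
The backward problem for \<open>\<phi>\<close> is the forward problem with the time-reversed boundary values
\<open>exp (cT (Tm - s))\<close>, whose initial value is constant on the network.  It stays above \<open>1\<close> by the
maximum principle, so that \<open>m0 / \<phi>\<close> is an admissible initial value for \<open>\<psi>\<close>.
\<close>

lemma solution_exists:
  assumes N: "network N" and i0: "bdry_ix N = {i0}" and Tm: "0 < Tm"
    and c: "thrice_diff (\<lambda>s. cT (Tm - s))" and m0: "continuous_on (points N) m0" "m0 (vertex N i0) = 0"
    and nonneg: "\<And>s. s \<in> {0..Tm} \<Longrightarrow> 0 \<le> cT s"
  obtains \<phi> \<psi> where "is_solution N i0 Tm m0 cT \<phi> \<psi>"
proof -
  from thrice_diff_exp[OF c] obtain b1 b2 b3 where
    b: "\<And>s. ((\<lambda>s. exp (cT (Tm - s))) has_real_derivative b1 s) (at s)" "\<And>s. (b1 has_real_derivative b2 s) (at s)"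
      "\<And>s. (b2 has_real_derivative b3 s) (at s)" "continuous_on UNIV b3" unfolding thrice_diff_def by blast
  obtain u ux uxx where u: "heat_on 1 N Tm u ux uxx" "\<And>x. x \<in> points N \<Longrightarrow> u x 0 = exp (cT (Tm - 0))"
    "\<And>s. s \<in> {0..Tm} \<Longrightarrow> u (vertex N i0) s = exp (cT (Tm - s))"
    by (rule boundary_value_solution[OF N i0 Tm b]) (rule that, assumption+)
  have u1: "1 \<le> u x s" if "x \<in> points N" "s \<in> {0..Tm}" for x s
    by (rule heat_on_lower_bound[OF N i0 Tm u(1) _ _ that]) (use u(2,3) nonneg Tm in auto)
  define \<phi> where "\<phi> x s = u x (Tm - s)" for x s
  have \<phi>: "heat_on (- 1) N Tm \<phi> (\<lambda>j y s. ux j y (Tm - s)) (\<lambda>j y s. uxx j y (Tm - s))"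
    unfolding \<phi>_def by (rule heat_on_reverse[OF u(1)])
  have \<phi>1: "1 \<le> \<phi> x s" if "x \<in> points N" "s \<in> {0..Tm}" for x s
    unfolding \<phi>_def using u1[OF that(1), of "Tm - s"] that(2) by auto
  have "continuous_on (points N) (\<lambda>x. (\<lambda>(x, s). \<phi> x s) (x, 0))"
    by (rule continuous_on_compose2[OF heat_onD(1)[OF \<phi>]]) (use Tm in \<open>auto intro!: continuous_intros\<close>)
  then have f: "continuous_on (points N) (\<lambda>x. m0 x / \<phi> x 0)"
    using \<phi>1[of _ 0] Tm by (intro continuous_intros m0) (auto, force)
  obtain \<psi> \<psi>x \<psi>xx where \<psi>: "heat_on 1 N Tm \<psi> \<psi>x \<psi>xx" "\<And>x. x \<in> points N \<Longrightarrow> \<psi> x 0 = m0 x / \<phi> x 0"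
    "\<And>s. \<psi> (vertex N i0) s = 0"
    by (rule initial_value_solution[OF N i0 f]) (use m0 in simp, rule that, assumption+)
  have "is_solution N i0 Tm m0 cT \<phi> \<psi>"
    unfolding is_solution_def
  proof (intro conjI ballI)
    fix x s assume "x \<in> points N" "s \<in> {0..Tm}"
    then show "0 < \<phi> x s" using \<phi>1 by force
  next
    fix j y s assume j: "j \<in> edges N" "y \<in> {0<..<len N j}" "s \<in> {0<..<Tm}"
    then have y: "y \<in> {0..len N j}" by auto
    show "- time_deriv N j \<phi> y s - edge_deriv N 2 j (\<lambda>x. \<phi> x s) y = 0"
      using heat_on_imp_classical(3)[OF N \<phi> j(1) y j(3)] by simp
    show "time_deriv N j \<psi> y s - edge_deriv N 2 j (\<lambda>x. \<psi> x s) y = 0"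
      using heat_on_imp_classical(3)[OF N \<psi>(1) j(1) y j(3)] by simp
  next
    fix x assume x: "x \<in> points N"
    show "\<psi> x 0 = m0 x / \<phi> x 0" by (rule \<psi>(2)[OF x])
    show "\<phi> x Tm = exp (cT Tm)" using u(2)[OF x] by (simp add: \<phi>_def)
  next
    fix s assume s: "s \<in> {0..Tm}"
    show "\<psi> (vertex N i0) s = 0" by (rule \<psi>(3))
    show "\<phi> (vertex N i0) s = exp (cT s)" using u(3)[of "Tm - s"] s by (simp add: \<phi>_def)
  qed (rule heat_on_imp_classical[OF N \<phi>] heat_on_imp_classical[OF N \<psi>(1)])+
  then show thesis by (rule that)
qed

lemma solution_bounds:
  assumes N: "network N" and i0: "bdry_ix N = {i0}" and Tm: "0 < Tm" and sol: "is_solution N i0 Tm m0 cT \<phi> \<psi>"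
    and nonneg: "\<And>s. s \<in> {0..Tm} \<Longrightarrow> 0 \<le> cT s" and m0: "\<And>x. x \<in> points N \<Longrightarrow> 0 \<le> m0 x \<and> m0 x \<le> m"
    and x: "x \<in> points N" and s: "s \<in> {0..Tm}"
  shows "1 \<le> \<phi> x s" "0 \<le> \<psi> x s" "\<psi> x s \<le> m"
proof -
  from is_solution_heat_on[OF N sol] obtain \<phi>x \<phi>xx \<psi>x \<psi>xx where
    \<phi>: "heat_on (- 1) N Tm \<phi> \<phi>x \<phi>xx" and \<psi>: "heat_on 1 N Tm \<psi> \<psi>x \<psi>xx" by blast
  note D = is_solutionD[OF sol]
  have m: "0 \<le> m" using m0[OF x] by linarith
  have rev: "heat_on 1 N Tm (\<lambda>x s. \<phi> x (Tm - s)) (\<lambda>j y s. \<phi>x j y (Tm - s)) (\<lambda>j y s. \<phi>xx j y (Tm - s))"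
    using heat_on_reverse[OF \<phi>] by simp
  have *: "1 \<le> \<phi> x (Tm - s)" if "x \<in> points N" "s \<in> {0..Tm}" for x s
    by (rule heat_on_lower_bound[OF N i0 Tm rev _ _ that]) (use D(9,11) nonneg Tm in auto)
  have \<phi>1: "1 \<le> \<phi> x s" if "x \<in> points N" "s \<in> {0..Tm}" for x s using *[OF that(1), of "Tm - s"] that(2) by simp
  then show "1 \<le> \<phi> x s" using x s by blast
  have init: "0 \<le> \<psi> x 0 \<and> \<psi> x 0 \<le> m" if x: "x \<in> points N" for x
  proof -
    have "1 \<le> \<phi> x 0" using \<phi>1[OF x] Tm by simp
    moreover from this have "m0 x / \<phi> x 0 \<le> m0 x" using m0[OF x] by (simp add: divide_le_eq mult_le_cancel_left1)
    ultimately show ?thesis using m0[OF x] D(8)[OF x] by auto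
  qed
  show "0 \<le> \<psi> x s"
    by (rule heat_on_lower_bound[OF N i0 Tm \<psi> _ _ x s]) (use init D(10) in auto)
  show "\<psi> x s \<le> m"
    by (rule heat_on_maximum[OF N Tm \<psi> _ _ x s]) (use init D(10) i0 m in auto)
qed

text \<open>
The difference of two solutions solves the same heat equation.  For \<open>\<phi>\<close> its data are the
differences of the exponentials; for \<open>\<psi>\<close> they are \<open>m0 / \<phi> - m0 / \<phi>'\<close> at time zero, where \<open>\<phi>\<close> and
\<open>\<phi>'\<close> are at least \<open>1\<close>.  With \<open>\<omega> = 0\<close> this is uniqueness.
\<close>

lemma solution_stability:
  assumes N: "network N" and i0: "bdry_ix N = {i0}" and Tm: "0 < Tm"
    and sol: "is_solution N i0 Tm m0 cT \<phi> \<psi>" and sol': "is_solution N i0 Tm m0 cT' \<phi>' \<psi>'"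
    and nonneg: "\<And>s. s \<in> {0..Tm} \<Longrightarrow> 0 \<le> cT s" "\<And>s. s \<in> {0..Tm} \<Longrightarrow> 0 \<le> cT' s"
    and m0: "\<And>x. x \<in> points N \<Longrightarrow> 0 \<le> m0 x \<and> m0 x \<le> m"
    and \<omega>: "\<And>s. s \<in> {0..Tm} \<Longrightarrow> \<bar>exp (cT s) - exp (cT' s)\<bar> \<le> \<omega>"
    and x: "x \<in> points N" and s: "s \<in> {0..Tm}"
  shows "\<bar>\<phi> x s - \<phi>' x s\<bar> \<le> \<omega>" "\<bar>\<psi> x s - \<psi>' x s\<bar> \<le> m * \<omega>"
proof -
  from is_solution_heat_on[OF N sol] obtain \<phi>x \<phi>xx \<psi>x \<psi>xx where
    \<phi>: "heat_on (- 1) N Tm \<phi> \<phi>x \<phi>xx" and \<psi>: "heat_on 1 N Tm \<psi> \<psi>x \<psi>xx" by blast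
  from is_solution_heat_on[OF N sol'] obtain \<phi>x' \<phi>xx' \<psi>x' \<psi>xx' where
    \<phi>': "heat_on (- 1) N Tm \<phi>' \<phi>x' \<phi>xx'" and \<psi>': "heat_on 1 N Tm \<psi>' \<psi>x' \<psi>xx'" by blast
  note D = is_solutionD[OF sol] and D' = is_solutionD[OF sol']
  note rev = heat_on_reverse[OF heat_on_lincomb[OF \<phi> \<phi>', of 1 "-1"], simplified]
  have *: "\<bar>\<phi> x (Tm - s) - \<phi>' x (Tm - s)\<bar> \<le> \<omega>" if "x \<in> points N" "s \<in> {0..Tm}" for x s
    by (rule heat_on_abs_bound[OF N i0 Tm rev _ _ that]) (use D(9,11) D'(9,11) \<omega> Tm in auto)
  have d: "\<bar>\<phi> x s - \<phi>' x s\<bar> \<le> \<omega>" if "x \<in> points N" "s \<in> {0..Tm}" for x s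
    using *[OF that(1), of "Tm - s"] that(2) by simp
  then show "\<bar>\<phi> x s - \<phi>' x s\<bar> \<le> \<omega>" using x s by blast
  have m: "0 \<le> m" using m0[OF x] by linarith
  have \<omega>0: "0 \<le> \<omega>" using \<omega>[OF s] by linarith
  have init: "\<bar>\<psi> x 0 - \<psi>' x 0\<bar> \<le> m * \<omega>" if x: "x \<in> points N" for x
  proof -
    have Tm0: "0 \<in> {0..Tm}" using Tm by simp
    define a b where "a = \<phi> x 0" and "b = \<phi>' x 0"
    have ab: "1 \<le> a" "1 \<le> b" "\<bar>a - b\<bar> \<le> \<omega>"
      using solution_bounds(1)[OF N i0 Tm sol nonneg(1) m0 x Tm0] solution_bounds(1)[OF N i0 Tm sol' nonneg(2) m0 x Tm0] d[OF x Tm0]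
      by (auto simp: a_def b_def)
    have "\<psi> x 0 - \<psi>' x 0 = m0 x / a - m0 x / b" using D(8)[OF x] D'(8)[OF x] by (simp add: a_def b_def)
    also have "\<dots> = m0 x * (b - a) / (a * b)" using ab by (simp add: field_simps)
    finally have "\<bar>\<psi> x 0 - \<psi>' x 0\<bar> = m0 x * \<bar>a - b\<bar> / (a * b)"
      using m0[OF x] ab by (simp add: abs_mult abs_minus_commute)
    also have "\<dots> \<le> m0 x * \<bar>a - b\<bar> / 1"
      using ab m0[OF x] mult_mono[of 1 a 1 b] by (intro divide_left_mono) auto
    also have "\<dots> \<le> m * \<omega>" using m0[OF x] ab m by (auto intro!: mult_mono)
    finally show ?thesis .
  qed
  note dif = heat_on_lincomb[OF \<psi> \<psi>', of 1 "-1", simplified]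
  show "\<bar>\<psi> x s - \<psi>' x s\<bar> \<le> m * \<omega>"
    by (rule heat_on_abs_bound[OF N i0 Tm dif _ _ x s]) (use init D(10) D'(10) m \<omega>0 in auto)
qed

text \<open>
The flux is what the total mass \<open>\<integral>\<phi>\<psi>\<close> loses.  The boundary derivative of \<open>\<psi>\<close> need not extend to
\<open>s = 0\<close>, but the mass is continuous there, which is enough for the fundamental theorem for
the Henstock-Kurzweil integral.
\<close>

lemma solution_flux:
  assumes N: "network N" and i0: "bdry_ix N = {i0}" and j0: "Inc N i0 = {j0}" "param N j0 0 = vertex N i0" and Tm: "0 < Tm"
    and sol: "is_solution N i0 Tm m0 cT \<phi> \<psi>"
  defines "M \<equiv> \<lambda>s. net_integral N (\<lambda>x. \<phi> x s * \<psi> x s)"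
  shows "s \<in> {0..Tm} \<Longrightarrow> flux N i0 j0 cT \<psi> s = net_integral N m0 - M s"
    and "continuous_on {0..Tm} M"
    and "s \<in> {0<..<Tm} \<Longrightarrow> (M has_real_derivative - (exp (cT s) * vertex_deriv N j0 (\<lambda>x. \<psi> x s) i0)) (at s)"
proof -
  from is_solution_heat_on[OF N sol] obtain \<phi>x \<phi>xx \<psi>x \<psi>xx where
    \<phi>: "heat_on (- 1) N Tm \<phi> \<phi>x \<phi>xx" and \<psi>: "heat_on 1 N Tm \<psi> \<psi>x \<psi>xx" by blast
  note D = is_solutionD[OF sol]
  have i0v: "i0 \<in> verts N" "j0 \<in> Inc N i0" using i0 j0 by (auto simp: bdry_ix_def)
  have out0: "out N i0 j0 0 = 0" using j0 by (simp add: out_def)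
  note mb = mass_balance[OF N i0 j0 \<phi> \<psi>, folded M_def]
  show cont: "continuous_on {0..Tm} M" by (rule mb(1)) (use D(10) in auto)
  show der: "(M has_real_derivative - (exp (cT s) * vertex_deriv N j0 (\<lambda>x. \<psi> x s) i0)) (at s)" if s: "s \<in> {0<..<Tm}" for s
    using mb(2)[OF _ s] D(10,11) s heat_on_vertex_deriv[OF N \<psi> i0v s] out0 by simp
  assume s: "s \<in> {0..Tm}"
  have "((\<lambda>r. exp (cT r) * vertex_deriv N j0 (\<lambda>x. \<psi> x r) i0) has_integral (- M s) - (- M 0)) {0..s}"
  proof (rule fundamental_theorem_of_calculus_interior)
    show "continuous_on {0..s} (\<lambda>s. - M s)"
      using s by (intro continuous_intros continuous_on_subset[OF cont]) auto
    fix r assume "r \<in> {0<..<s}"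
    then have "r \<in> {0<..<Tm}" using s by auto
    from DERIV_minus[OF der[OF this]]
    show "((\<lambda>s. - M s) has_vector_derivative exp (cT r) * vertex_deriv N j0 (\<lambda>x. \<psi> x r) i0) (at r)"
      by (simp add: has_real_derivative_iff_has_vector_derivative)
  qed (use s in simp)
  then have "flux N i0 j0 cT \<psi> s = M 0 - M s"
    unfolding flux_def by (simp add: integral_unique)
  moreover have "M 0 = net_integral N m0"
    unfolding M_def net_integral_def
  proof (intro sum.cong refl integral_cong)
    fix j y assume "j \<in> edges N" "y \<in> {0..len N j}"
    then have x: "param N j y \<in> points N" by (rule param_in_points[OF N])
    have "0 < \<phi> (param N j y) 0" using D(5)[OF x] Tm by simp
    then show "\<phi> (param N j y) 0 * \<psi> (param N j y) 0 = m0 (param N j y)" using D(8)[OF x] by simp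
  qed
  ultimately show "flux N i0 j0 cT \<psi> s = net_integral N m0 - M s" by simp
qed

text \<open>
The positive slope of \<open>m0\<close> at the boundary vertex survives the division by \<open>\<phi>\<close>, which is bounded,
and yields the lower bound on \<open>\<psi>\<close> from which the barrier starts.
\<close>

lemma solution_flux_strict_mono:
  assumes N: "network N" and i0: "bdry_ix N = {i0}" and j0: "Inc N i0 = {j0}" "param N j0 0 = vertex N i0" and Tm: "0 < Tm"
    and sol: "is_solution N i0 Tm m0 cT \<phi> \<psi>" and nonneg: "\<And>s. s \<in> {0..Tm} \<Longrightarrow> 0 \<le> cT s"
    and m0: "\<And>x. x \<in> points N \<Longrightarrow> 0 \<le> m0 x \<and> m0 x \<le> m"
    and m0v: "m0 (vertex N i0) = 0" and slope: "((\<lambda>y. m0 (param N j0 y)) has_real_derivative \<mu>) (at 0 within {0..len N j0})" "0 < \<mu>"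
  shows "strict_mono_on {0..Tm} (flux N i0 j0 cT \<psi>)"
proof -
  define M where "M s = net_integral N (\<lambda>x. \<phi> x s * \<psi> x s)" for s
  note F = solution_flux[OF N i0 j0 Tm sol, folded M_def]
  note D = is_solutionD[OF sol]
  from is_solution_heat_on[OF N sol] obtain \<phi>x \<phi>xx \<psi>x \<psi>xx where
    \<phi>: "heat_on (- 1) N Tm \<phi> \<phi>x \<phi>xx" and \<psi>: "heat_on 1 N Tm \<psi> \<psi>x \<psi>xx" by blast
  have i0v: "i0 \<in> verts N" "j0 \<in> Inc N i0" using i0 j0 by (auto simp: bdry_ix_def)
  have je: "j0 \<in> edges N" using i0v by (simp add: Inc_def)
  note l = network_len[OF N je]
  have out0: "out N i0 j0 0 = 0" using j0 by (simp add: out_def)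
  have Tm0: "0 \<in> {0..Tm}" using Tm by simp
  have "((\<lambda>y. m0 (param N j0 y) - \<mu> / 2 * y) has_real_derivative \<mu> - \<mu> / 2) (at 0 within {0..len N j0})"
    using slope(1) by (auto intro!: derivative_eq_intros)
  from has_real_derivative_pos_inc_right[OF this] slope(2) obtain d where d: "0 < d"
    "\<And>h. 0 < h \<Longrightarrow> h \<in> {0..len N j0} \<Longrightarrow> h < d \<Longrightarrow> m0 (param N j0 0) < m0 (param N j0 h) - \<mu> / 2 * h" by auto
  define \<delta> where "\<delta> = min (d / 2) (len N j0)"
  have \<delta>: "0 < \<delta>" "\<delta> \<le> len N j0" "\<delta> < d" using d l by (auto simp: \<delta>_def)
  have grow: "\<mu> / 2 * y \<le> m0 (param N j0 y)" if "y \<in> {0..\<delta>}" for y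
    using d(2)[of y] that \<delta> m0v j0 by (cases "y = 0") auto
  have "continuous_on (points N) (\<lambda>x. (\<lambda>(x, s). \<phi> x s) (x, 0))"
    by (rule continuous_on_compose2[OF heat_onD(1)[OF \<phi>]]) (use Tm in \<open>auto intro!: continuous_intros\<close>)
  then have "bounded ((\<lambda>x. \<phi> x 0) ` points N)"
    using compact_points[OF N] by (intro compact_imp_bounded compact_continuous_image) auto
  then obtain B where B: "\<And>x. x \<in> points N \<Longrightarrow> \<bar>\<phi> x 0\<bar> \<le> B" unfolding bounded_iff by (metis imageI real_norm_def)
  have \<phi>1: "1 \<le> \<phi> x 0" if "x \<in> points N" for x by (rule solution_bounds(1)[OF N i0 Tm sol nonneg m0 that Tm0])
  have B1: "1 \<le> B" using B[OF vertex_in_points[OF i0v(1)]] \<phi>1[OF vertex_in_points[OF i0v(1)]] by linarith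
  have init: "\<mu> / 2 / B * y \<le> \<psi> (param N j0 y) 0" if y: "y \<in> {0..\<delta>}" for y
  proof -
    have x: "param N j0 y \<in> points N" using param_in_points[OF N je] y \<delta> by auto
    have "\<mu> / 2 / B * y = (\<mu> / 2 * y) / B" by simp
    also have "\<dots> \<le> m0 (param N j0 y) / B" using grow[OF y] B1 by (intro divide_right_mono) auto
    also have "\<dots> \<le> m0 (param N j0 y) / \<phi> (param N j0 y) 0"
      using B[OF x] \<phi>1[OF x] m0[OF x] B1 by (intro divide_left_mono) auto
    finally show ?thesis using D(8)[OF x] by simp
  qed
  have pos: "0 < vertex_deriv N j0 (\<lambda>x. \<psi> x s) i0" if s: "s \<in> {0<..<Tm}" for s
  proof -
    have "0 < \<psi>x j0 0 s"
    proof (rule boundary_derivative_positive[OF N \<psi> je \<delta>(1,2) _ init _ _ s])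
      show "0 < \<mu> / 2 / B" using slope(2) B1 by simp
      show "0 \<le> \<psi> x r" if "x \<in> points N" "r \<in> {0..Tm}" for x r
        by (rule solution_bounds(2)[OF N i0 Tm sol nonneg m0 that])
      show "\<psi> (param N j0 0) r = 0" if "r \<in> {0..Tm}" for r using D(10)[OF that] j0 by simp
    qed
    then show ?thesis using heat_on_vertex_deriv[OF N \<psi> i0v s] out0 by simp
  qed
  show ?thesis
  proof (rule strict_mono_onI)
    fix r s assume rs: "r \<in> {0..Tm}" "s \<in> {0..Tm}" "r < s"
    have "- M r < - M s"
    proof (rule DERIV_pos_imp_increasing_open[OF rs(3)])
      fix x assume "r < x" "x < s"
      then have x: "x \<in> {0<..<Tm}" using rs by auto
      show "\<exists>y. ((\<lambda>s. - M s) has_real_derivative y) (at x) \<and> 0 < y"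
        using DERIV_minus[OF F(3)[OF x]] pos[OF x] by auto
    next
      show "continuous_on {r..s} (\<lambda>s. - M s)"
        using rs by (intro continuous_intros continuous_on_subset[OF F(2)]) auto
    qed
    then show "flux N i0 j0 cT \<psi> r < flux N i0 j0 cT \<psi> s"
      using F(1)[OF rs(1)] F(1)[OF rs(2)] by simp
  qed
qed

lemma net_integral_diff_bound:
  assumes N: "network N" and u: "continuous_on (points N) u" and v: "continuous_on (points N) v"
    and K: "\<And>x. x \<in> points N \<Longrightarrow> \<bar>u x - v x\<bar> \<le> K"
  shows "\<bar>net_integral N u - net_integral N v\<bar> \<le> (\<Sum>j\<in>edges N. len N j) * K"
proof -
  have e: "\<bar>integral {0..len N j} (\<lambda>y. u (param N j y)) - integral {0..len N j} (\<lambda>y. v (param N j y))\<bar> \<le> len N j * K"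
    if j: "j \<in> edges N" for j
  proof -
    have c: "continuous_on {0..len N j} (\<lambda>y. f (param N j y))" if "continuous_on (points N) f" for f :: "_ \<Rightarrow> real"
      by (rule continuous_on_compose2[OF that network_continuous[OF N j]]) (use param_in_points[OF N j] in auto)
    have "integral {0..len N j} (\<lambda>y. u (param N j y)) - integral {0..len N j} (\<lambda>y. v (param N j y))
        = integral {0..len N j} (\<lambda>y. u (param N j y) - v (param N j y))"
      by (intro Henstock_Kurzweil_Integration.integral_diff[symmetric] integrable_continuous_real c u v)
    also have "norm \<dots> \<le> K * (len N j - 0)"
    proof (rule integral_bound)
      show "continuous_on {0..len N j} (\<lambda>y. u (param N j y) - v (param N j y))" by (intro continuous_intros c u v)
      show "norm (u (param N j y) - v (param N j y)) \<le> K" if "y \<in> {0..len N j}" for y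
        using K[OF param_in_points[OF N j that]] by simp
    qed (use network_len[OF N j] in simp)
    finally show ?thesis by (simp add: mult.commute)
  qed
  have "\<bar>net_integral N u - net_integral N v\<bar>
      \<le> (\<Sum>j\<in>edges N. \<bar>integral {0..len N j} (\<lambda>y. u (param N j y)) - integral {0..len N j} (\<lambda>y. v (param N j y))\<bar>)"
    unfolding net_integral_def sum_subtractf[symmetric] by (rule sum_abs)
  also have "\<dots> \<le> (\<Sum>j\<in>edges N. len N j * K)" by (rule sum_mono[OF e])
  finally show ?thesis by (simp add: sum_distrib_right)
qed

section \<open>The fixed point\<close>

text \<open>
Two solutions agree on the network, and by \<open>solution_flux\<close> the flux only depends on their values
there.
\<close>

lemma Psi_eq_quorum_time:
  assumes N: "network N" and i0: "bdry_ix N = {i0}" and j0: "Inc N i0 = {j0}" "param N j0 0 = vertex N i0" and Tm: "0 < Tm"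
    and sol: "is_solution N i0 Tm m0 (c T) \<phi> \<psi>" and nonneg: "\<And>s. s \<in> {0..Tm} \<Longrightarrow> 0 \<le> c T s"
    and m0: "\<And>x. x \<in> points N \<Longrightarrow> 0 \<le> m0 x \<and> m0 x \<le> m"
  shows "Psi N i0 j0 t0 Tm \<theta> m0 c T = quorum_time t0 Tm \<theta> (flux N i0 j0 (c T) \<psi>)"
  unfolding Psi_def
proof (rule the_equality)
  show "\<exists>\<phi>' \<psi>'. is_solution N i0 Tm m0 (c T) \<phi>' \<psi>' \<and>
      quorum_time t0 Tm \<theta> (flux N i0 j0 (c T) \<psi>) = quorum_time t0 Tm \<theta> (flux N i0 j0 (c T) \<psi>')"
    using sol by blast
  fix Ts assume "\<exists>\<phi>' \<psi>'. is_solution N i0 Tm m0 (c T) \<phi>' \<psi>' \<and> Ts = quorum_time t0 Tm \<theta> (flux N i0 j0 (c T) \<psi>')"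
  then obtain \<phi>' \<psi>' where sol': "is_solution N i0 Tm m0 (c T) \<phi>' \<psi>'"
    and Ts: "Ts = quorum_time t0 Tm \<theta> (flux N i0 j0 (c T) \<psi>')" by blast
  have eq: "\<phi> x s = \<phi>' x s \<and> \<psi> x s = \<psi>' x s" if "x \<in> points N" "s \<in> {0..Tm}" for x s
    using solution_stability[OF N i0 Tm sol sol' nonneg nonneg m0 _ that, of 0] by simp
  show "Ts = quorum_time t0 Tm \<theta> (flux N i0 j0 (c T) \<psi>)"
    unfolding Ts
  proof (rule quorum_time_cong)
    fix s assume s: "s \<in> {0..Tm}"
    have "net_integral N (\<lambda>x. \<phi>' x s * \<psi>' x s) = net_integral N (\<lambda>x. \<phi> x s * \<psi> x s)"
      unfolding net_integral_def
      by (intro sum.cong refl integral_cong) (use eq[OF param_in_points[OF N] s] in simp)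
    then show "flux N i0 j0 (c T) \<psi>' s = flux N i0 j0 (c T) \<psi> s"
      using solution_flux(1)[OF N i0 j0 Tm sol s] solution_flux(1)[OF N i0 j0 Tm sol' s] by simp
  qed
qed

text \<open>
Changing the cost moves \<open>\<phi> \<psi>\<close> by little, uniformly on the network and in time; changing only the
time moves the mass by little because it is continuous for a fixed cost.
\<close>

lemma diagonal_flux_continuous:
  assumes N: "network N" and i0: "bdry_ix N = {i0}" and j0: "Inc N i0 = {j0}" "param N j0 0 = vertex N i0" and Tm: "0 < Tm"
    and sol: "\<And>T. T \<in> {0..Tm} \<Longrightarrow> is_solution N i0 Tm m0 (c T) (\<phi> T) (\<psi> T)"
    and nonneg: "\<And>T s. T \<in> {0..Tm} \<Longrightarrow> s \<in> {0..Tm} \<Longrightarrow> 0 \<le> c T s"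
    and cont: "continuous_on ({0..Tm} \<times> {0..Tm}) (\<lambda>(T, s). c T s)"
    and m0: "\<And>x. x \<in> points N \<Longrightarrow> 0 \<le> m0 x \<and> m0 x \<le> m"
  shows "continuous_on {0..Tm} (\<lambda>T. flux N i0 j0 (c T) (\<psi> T) T)"
proof -
  define M where "M T s = net_integral N (\<lambda>x. \<phi> T x s * \<psi> T x s)" for T s
  define \<Lambda> where "\<Lambda> = (\<Sum>j\<in>edges N. len N j)"
  have \<Lambda>: "0 \<le> \<Lambda>" unfolding \<Lambda>_def using network_len[OF N] by (intro sum_nonneg) (auto intro: less_imp_le)
  have i0v: "i0 \<in> verts N" using i0 by (auto simp: bdry_ix_def)
  have m: "0 \<le> m" using m0[OF vertex_in_points[OF i0v]] by linarith
  note F = solution_flux[OF N i0 j0 Tm sol, folded M_def]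
  have hc: "continuous_on (points N \<times> {0..Tm}) (\<lambda>(x, s). \<phi> T x s)" "continuous_on (points N \<times> {0..Tm}) (\<lambda>(x, s). \<psi> T x s)"
    if "T \<in> {0..Tm}" for T
    using is_solutionD(1,2)[OF sol[OF that]] unfolding classical_def by blast+
  have sec: "continuous_on (points N) (\<lambda>x. \<phi> T x s * \<psi> T x s)" if "T \<in> {0..Tm}" "s \<in> {0..Tm}" for T s
  proof -
    have "continuous_on (points N) (\<lambda>x. (\<lambda>(x, s). \<phi> T x s) (x, s))" "continuous_on (points N) (\<lambda>x. (\<lambda>(x, s). \<psi> T x s) (x, s))"
      by (rule continuous_on_compose2[OF hc(1)[OF that(1)]] continuous_on_compose2[OF hc(2)[OF that(1)]];
          use that in \<open>auto intro!: continuous_intros\<close>)+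
    then show ?thesis by (auto intro: continuous_on_mult)
  qed
  have unif: "uniformly_continuous_on ({0..Tm} \<times> {0..Tm}) (\<lambda>p. exp ((\<lambda>(T, s). c T s) p))"
    by (intro compact_uniformly_continuous continuous_intros cont compact_Times compact_Icc)
  have "continuous_on {0..Tm} (\<lambda>T. M T T)"
    unfolding continuous_on_iff
  proof (intro ballI allI impI)
    fix T' and \<epsilon> :: real assume T': "T' \<in> {0..Tm}" and \<epsilon>: "0 < \<epsilon>"
    have "bounded ((\<lambda>(x, s). \<phi> T' x s) ` (points N \<times> {0..Tm}))"
      by (intro compact_imp_bounded compact_continuous_image hc(1)[OF T'] compact_Times compact_points[OF N] compact_Icc)
    then obtain B where B: "\<And>x s. x \<in> points N \<Longrightarrow> s \<in> {0..Tm} \<Longrightarrow> \<bar>\<phi> T' x s\<bar> \<le> B"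
      unfolding bounded_iff by fastforce
    have B0: "0 \<le> B" using B[OF vertex_in_points[OF i0v], of 0] Tm by simp
    \<comment> \<open>The Lipschitz constant of the mass in the boundary data; the summand 1 keeps it positive.\<close>
    define K where "K = \<Lambda> * (m + B * m) + 1"
    have K: "0 < K" using \<Lambda> m B0 unfolding K_def by (intro add_nonneg_pos mult_nonneg_nonneg add_nonneg_nonneg) auto
    define \<omega> where "\<omega> = \<epsilon> / (2 * K)"
    have \<omega>: "0 < \<omega>" using \<epsilon> K by (simp add: \<omega>_def)
    obtain d1 where d1: "0 < d1" "\<And>p q. p \<in> {0..Tm} \<times> {0..Tm} \<Longrightarrow> q \<in> {0..Tm} \<times> {0..Tm} \<Longrightarrow> dist q p < d1 \<Longrightarrow>
        dist (exp ((\<lambda>(T, s). c T s) q)) (exp ((\<lambda>(T, s). c T s) p)) < \<omega>"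
      using unif \<omega> unfolding uniformly_continuous_on_def by blast
    obtain d2 where d2: "0 < d2" "\<And>s. s \<in> {0..Tm} \<Longrightarrow> dist s T' < d2 \<Longrightarrow> dist (M T' s) (M T' T') < \<epsilon> / 2"
      using F(2)[OF T'] T' half_gt_zero[OF \<epsilon>] unfolding continuous_on_iff by blast
    show "\<exists>d>0. \<forall>T\<in>{0..Tm}. dist T T' < d \<longrightarrow> dist (M T T) (M T' T') < \<epsilon>"
    proof (intro exI[of _ "min d1 d2"] conjI ballI impI)
      show "0 < min d1 d2" using d1 d2 by simp
      fix T assume T: "T \<in> {0..Tm}" and dist: "dist T T' < min d1 d2"
      have \<omega>s: "\<bar>exp (c T s) - exp (c T' s)\<bar> \<le> \<omega>" if "s \<in> {0..Tm}" for s
        using d1(2)[of "(T', s)" "(T, s)"] that T T' dist by (simp add: dist_Pair_Pair dist_real_def)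
      have st: "\<bar>\<phi> T x T - \<phi> T' x T\<bar> \<le> \<omega>" "\<bar>\<psi> T x T - \<psi> T' x T\<bar> \<le> m * \<omega>"
        if "x \<in> points N" for x
        by (rule solution_stability[OF N i0 Tm sol[OF T] sol[OF T']]; use nonneg T T' m0 \<omega>s that(1) in blast)+
      have sb: "0 \<le> \<psi> T x T" "\<psi> T x T \<le> m" if "x \<in> points N" for x
        by (rule solution_bounds[OF N i0 Tm sol[OF T]]; use nonneg T m0 that in blast)+
      have "\<bar>M T T - M T' T\<bar> \<le> \<Lambda> * ((m + B * m) * \<omega>)"
        unfolding M_def \<Lambda>_def
      proof (rule net_integral_diff_bound[OF N sec[OF T T] sec[OF T' T]])
        fix x assume x: "x \<in> points N"
        have "\<phi> T x T * \<psi> T x T - \<phi> T' x T * \<psi> T' x T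
            = (\<phi> T x T - \<phi> T' x T) * \<psi> T x T + \<phi> T' x T * (\<psi> T x T - \<psi> T' x T)" by (simp add: algebra_simps)
        then have "\<bar>\<phi> T x T * \<psi> T x T - \<phi> T' x T * \<psi> T' x T\<bar>
            \<le> \<bar>\<phi> T x T - \<phi> T' x T\<bar> * \<bar>\<psi> T x T\<bar> + \<bar>\<phi> T' x T\<bar> * \<bar>\<psi> T x T - \<psi> T' x T\<bar>"
          by (metis abs_mult abs_triangle_ineq)
        also have "\<dots> \<le> \<omega> * m + B * (m * \<omega>)"
          using st[OF x] B[OF x T] sb[OF x] \<omega> m B0
          by (intro add_mono mult_mono) auto
        finally show "\<bar>\<phi> T x T * \<psi> T x T - \<phi> T' x T * \<psi> T' x T\<bar> \<le> (m + B * m) * \<omega>"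
          by (simp add: algebra_simps)
      qed
      also have "\<Lambda> * ((m + B * m) * \<omega>) \<le> K * \<omega>" using \<omega> by (simp add: K_def distrib_right mult.assoc)
      also have "\<dots> = \<epsilon> / 2" using K by (simp add: \<omega>_def)
      finally have "\<bar>M T T - M T' T\<bar> \<le> \<epsilon> / 2" .
      moreover have "\<bar>M T' T - M T' T'\<bar> < \<epsilon> / 2" using d2(2)[OF T] dist by (simp add: dist_real_def)
      ultimately show "dist (M T T) (M T' T') < \<epsilon>" unfolding dist_real_def by linarith
    qed
  qed
  then have "continuous_on {0..Tm} (\<lambda>T. net_integral N m0 - M T T)" by (intro continuous_intros)
  then show ?thesis by (rule continuous_on_eq) (use F(1) in simp)
qed

theorem theorem4p1:
  fixes N :: "('i, 'j, 'n::finite) net"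
    and i0 :: 'i and j0 :: 'j
    and t0 Tmax \<theta> \<alpha> :: real
    and m0 :: "real ^ 'n \<Rightarrow> real"
    and c1 c2 c3 :: "real \<Rightarrow> real"
    and c :: "real \<Rightarrow> real \<Rightarrow> real"
  defines "c \<equiv> cost c1 c2 c3 t0"
  assumes "network N"
    and "bdry_ix N = {i0}"
    and "Inc N i0 = {j0}"
    and "param N j0 0 = vertex N i0"
    and "0 < t0" and "t0 < Tmax"
    and "0 < \<theta>" and "\<theta> < 1"
    and "\<forall>x\<in>points N. m0 x \<ge> 0"
    and "net_integral N m0 = 1"
    and "\<forall>f\<in>{c1, c2, c3}. smooth_on UNIV f \<and> (\<forall>s\<le>0. f s = 0) \<and> (\<forall>s>0. f s > 0)"
    and "0 < \<alpha>" and "\<alpha> < 1"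
    and "\<forall>T\<in>{0..Tmax}. c T \<in> holder_space 1 (\<alpha> / 2) 0 Tmax"
    and "\<forall>T\<in>{0..Tmax}. \<forall>s\<in>{0..Tmax}. c T s \<ge> 0"
    and "\<forall>T\<in>{0..Tmax}.
           ((\<lambda>T'. holder_norm 1 (\<alpha> / 2) 0 Tmax (\<lambda>s. c T' s - c T s)) \<longlongrightarrow> 0)
             (at T within {0..Tmax})"
    and "m0 \<in> net_holder_space N 2 \<alpha>"
    and "m0 (vertex N i0) = 0"
    and "vertex_deriv N j0 m0 i0 > 0"
  shows "Psi N i0 j0 t0 Tmax \<theta> m0 c \<in> {t0..Tmax} \<rightarrow> {t0..Tmax} \<and>
         (\<exists>T\<in>{t0..Tmax}. Psi N i0 j0 t0 Tmax \<theta> m0 c T = T)"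
proof -
  note N = assms(2) and i0 = assms(3) and j0 = assms(4,5)
  have Tm: "0 < Tmax" using assms by linarith
  have i0v: "i0 \<in> verts N" "j0 \<in> Inc N i0" using i0 j0 by (auto simp: bdry_ix_def)
  have je: "j0 \<in> edges N" using i0v by (simp add: Inc_def)
  have nonneg: "0 \<le> c T s" if "T \<in> {0..Tmax}" "s \<in> {0..Tmax}" for T s using assms(16) that by blast
  have smooth: "\<forall>f\<in>{c1, c2, c3}. smooth_on UNIV f" using assms(12) by blast
  have m0c: "continuous_on (points N) m0"
    and m0h: "(\<lambda>y. m0 (param N j0 y)) \<in> holder_space 2 \<alpha> 0 (len N j0)"
    using assms(18) je by (auto simp: net_holder_space_def)
  have "bounded (m0 ` points N)"
    by (intro compact_imp_bounded compact_continuous_image m0c compact_points[OF N])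
  then obtain m where m: "\<And>x. x \<in> points N \<Longrightarrow> \<bar>m0 x\<bar> \<le> m"
    unfolding bounded_iff by (metis imageI real_norm_def)
  have m0: "0 \<le> m0 x \<and> m0 x \<le> m" if "x \<in> points N" for x
    using assms(10) m[OF that] that by auto
  define \<mu> where "\<mu> = vertex_deriv N j0 m0 i0"
  have slope: "((\<lambda>y. m0 (param N j0 y)) has_real_derivative \<mu>) (at 0 within {0..len N j0})"
  proof -
    have l: "0 \<in> {0..len N j0}" using network_len[OF N je] by simp
    have "iter_deriv {0..len N j0} 0 (\<lambda>y. m0 (param N j0 y)) differentiable (at 0 within {0..len N j0})"
      using m0h l unfolding holder_space_def by fastforce
    moreover have "\<mu> = vector_derivative (\<lambda>y. m0 (param N j0 y)) (at 0 within {0..len N j0})"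
      unfolding \<mu>_def vertex_deriv_def the_inv_param[OF N i0v] using j0 by (simp add: edge_deriv_simps out_def)
    ultimately show ?thesis
      by (simp add: iter_deriv_simps vector_derivative_works has_real_derivative_iff_has_vector_derivative)
  qed
  have \<mu>: "0 < \<mu>" using assms(20) by (simp add: \<mu>_def)
  have "\<exists>\<phi> \<psi>. is_solution N i0 Tmax m0 (c T) \<phi> \<psi>" if T: "T \<in> {0..Tmax}" for T
  proof -
    have "thrice_diff (\<lambda>s. c T (Tmax - s))" unfolding c_def by (rule thrice_diff_cost[OF smooth])
    from solution_exists[OF N i0 Tm this m0c assms(19) nonneg[OF T]] show ?thesis by blast
  qed
  then obtain \<phi> \<psi> where sol: "\<And>T. T \<in> {0..Tmax} \<Longrightarrow> is_solution N i0 Tmax m0 (c T) (\<phi> T) (\<psi> T)" by metis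
  define F where "F T = flux N i0 j0 (c T) (\<psi> T)" for T
  have Psi: "Psi N i0 j0 t0 Tmax \<theta> m0 c T = quorum_time t0 Tmax \<theta> (F T)" if T: "T \<in> {0..Tmax}" for T
    unfolding F_def
    by (rule Psi_eq_quorum_time[where c = c and T = T, OF N i0 j0 Tm sol[OF T] nonneg[OF T] m0])
  have mono: "strict_mono_on {0..Tmax} (F T)" if T: "T \<in> {0..Tmax}" for T
    unfolding F_def
    by (rule solution_flux_strict_mono[OF N i0 j0 Tm sol[OF T] nonneg[OF T] m0 assms(19) slope \<mu>])
  have sub: "{t0..Tmax} \<subseteq> {0..Tmax}" using assms by auto
  have cc: "continuous_on UNIV c1" "continuous_on UNIV c2" "continuous_on UNIV c3"
    using smooth smooth_on_continuous[of _ 0] by (auto simp: iter_deriv_simps)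
  have "continuous_on ({0..Tmax} \<times> {0..Tmax}) (\<lambda>(T, s). c T s)"
    unfolding c_def cost_def case_prod_beta
    by (intro continuous_intros continuous_on_compose2[OF cc(1)] continuous_on_compose2[OF cc(2)] continuous_on_compose2[OF cc(3)]) auto
  from diagonal_flux_continuous[where c = c and \<phi> = \<phi> and \<psi> = \<psi>, OF N i0 j0 Tm sol nonneg this m0]
  have diag: "continuous_on {t0..Tmax} (\<lambda>T. F T T)"
    unfolding F_def by (rule continuous_on_subset[OF _ sub])
  have "\<exists>T\<in>{t0..Tmax}. quorum_time t0 Tmax \<theta> (F T) = T"
  proof -
    consider "\<theta> \<le> F t0 t0" | "F Tmax Tmax < \<theta>" | "F t0 t0 \<le> \<theta>" "\<theta> \<le> F Tmax Tmax" by linarith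
    then show ?thesis
    proof cases
      case 1
      then have "quorum_time t0 Tmax \<theta> (F t0) = t0" using assms by (intro quorum_time_early) auto
      then show ?thesis using assms by force
    next
      case 2
      have Tin: "Tmax \<in> {0..Tmax}" using Tm by simp
      have "quorum_time t0 Tmax \<theta> (F Tmax) = Tmax"
      proof (rule quorum_time_never)
        fix s assume s: "s \<in> {0..Tmax}"
        then have "F Tmax s \<le> F Tmax Tmax"
          using strict_mono_onD[OF mono[OF Tin] s Tin] by (cases "s = Tmax") auto
        with 2 show "F Tmax s < \<theta>" by simp
      qed (use assms in simp)
      then show ?thesis using assms by force
    next
      case 3
      then obtain T where T: "t0 \<le> T" "T \<le> Tmax" "F T T = \<theta>"
        using IVT'[of "\<lambda>T. F T T" t0 \<theta> Tmax] diag assms by auto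
      then have "quorum_time t0 Tmax \<theta> (F T) = T"
        using assms by (intro quorum_time_attained mono) auto
      then show ?thesis using T by auto
    qed
  qed
  moreover have "quorum_time t0 Tmax \<theta> (F T) \<in> {t0..Tmax}" for T
    using assms by (intro quorum_time_range) simp
  moreover have "Psi N i0 j0 t0 Tmax \<theta> m0 c T = quorum_time t0 Tmax \<theta> (F T)" if "T \<in> {t0..Tmax}" for T
    using Psi sub that by blast
  ultimately show ?thesis by (metis (no_types, lifting) Pi_I)
qed

end
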